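(* Let $\kappa\ge 1$, $E_\kappa=\{0,1,\dots,\kappa\}$, and let $A$ be a probabilistic cellular automaton on $\mathbb{Z}$ with state set $E_\kappa$, neighbourhood $N(x)=(x,x+1)$ and transition matrix $T$ with positive rate, i.e. $T_{(a,b),c}>0$ for all $a,b,c\in E_\kappa$. Consider $A$ as acting on probability laws on $E_\kappa^{\mathsf{HZ}}$ (horizontal zigzag), and let $\gamma$, $D^\gamma$, $U^\gamma$, $X$ be the objects built from $T$ in the context. Then $A$ admits the law of some horizontal zigzag Markov chain (HZMC) as invariant distribution on $\mathsf{HZ}$ if and only if the following two conditions hold: (1) for all $a,b,c\in E_\kappa$, $$T_{(a,b),c}=\frac{T_{(0,0),0}\,T_{(a,b),0}\,T_{(a,0),c}\,T_{(0,b),c}}{T_{(a,0),0}\,T_{(0,b),0}\,T_{(0,0),c}};$$ (2) $D^\gamma U^\gamma=U^\gamma D^\gamma$. In this case the law of the $(D^\gamma,U^\gamma)$-HZMC is invariant under $A$, and the common invariant distribution of the Markov chains with Markov kernels $D^\gamma$, $U^\gamma$, $D^\gamma U^\gamma$ and $U^\gamma D^\gamma$ is $\rho=(\gamma_i\mu_i)_{0\le i\le\kappa}$, where $\mu={}^t(\mu_i)_{0\le i\le \kappa}$ is the Perron right eigenvector of $X$ normalised so that $\rho$ is a probability distribution. Moreover, when $\kappa=1$, condition (1) implies condition (2), so that the only condition is (1), which is then equivalent to $$T_{(0,0),0}T_{(1,1),0}T_{(1,0),1}T_{(0,1),1}=T_{(1,1),1}T_{(0,0),1}T_{(0,1),0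}T_{(1,0),0}.$$
   Context: A transition matrix is an array $T=(T_{(a,b),c})_{a,b,c\in E_\kappa}$ of non-negative numbers with $\sum_c T_{(a,b),c}=1$ for all $a,b$. The PCA with transition matrix $T$ on $\mathbb{Z}$ maps a (random) configuration $S_t\in E_\kappa^{\mathbb{Z}}$ to $S_{t+1}$ such that, conditionally on $S_t$ (and the past), the variables $S_{t+1}(x)$, $x\in\mathbb{Z}$, are independent and $S_{t+1}(x)=c$ with probability $T_{(S_t(x),S_t(x+1)),c}$. Action on the horizontal zigzag: a configuration on $\mathsf{HZ}$ is a pair $(S_0,S_1)\in E_\kappa^{\mathbb{Z}}\times E_\kappa^{\mathbb{Z}}$ of two consecutive lines. If $(S_0,S_1)$ has law $m$, the image of $m$ under $A$ is the law of $(S_1,S_2)$, where, conditionally on $(S_0,S_1)$, the $S_2(x)$ are independent with $S_2(x)=c$ with probability $T_{(S_1(x),S_1(x+1)),c}$. The law $m$ is invariant if it equals its image. A Markov kernel on $E_\kappa$ is a row-stochastic matrix indexed by $E_\kappa\times E_\kappa$. Given Markov kernels $D,U$ and a probability $\rho$ on $E_\kappa$ with $\rho=\rho DU$, a $(D,U)$-HZMC is a pair $(S_0,S_1)$ such that for all $i_0\in\mathbb{Z}$, $n\ge0$ and $a_i,b_i\in E_\kappa$, $$\mathbb{P}(S_0(i_0+i)=a_i,\ S_1(i_0+i)=b_i,\ 0\le i\le n)=\rho_{a_0}\Big(\prod_{i=0}^{n-1}D_{a_i,b_i}U_{b_i,a_{i+1}}\Big)D_{a_n,b_n}.$$ For a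 matrix with positive entries, the Perron eigenvalue is its eigenvalue of maximal modulus; the Perron left/right eigenvectors are the associated positive left/right eigenvectors, called stochastic when normalised to have sum 1. Let $\nu$ be the stochastic Perron left eigenvector of the stochastic matrix $Y=[T_{(i,i),j}]_{0\le i,j\le\kappa}$. Let $X$ be the matrix with entry, in row $d$ and column $a$, $$X_{d,a}=\frac{T_{(a,a),0}\,\nu_a}{T_{(a,d),0}},$$ and let $\gamma$ be the stochastic Perron left eigenvector of $X$. For a probability distribution $\eta$ on $E_\kappa$ with full support define the Markov kernels $$D^\eta_{a,c}=\frac{\sum_{\ell}\frac{\eta_\ell}{T_{(a,\ell),0}}T_{(a,\ell),c}}{\sum_{b'}\frac{\eta_{b'}}{T_{(a,b'),0}}},\qquad U^\eta_{c,b}=\frac{\frac{\eta_b}{T_{(0,b),0}}T_{(0,b),c}}{\sum_{b'}\frac{\eta_{b'}}{T_{(0,b'),0}}T_{(0,b'),c}},\qquad a,b,c\in E_\kappa.$$ *)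

theory Defs
  imports "HOL-Probability.Probability" "Jordan_Normal_Form.Spectral_Radius"
begin

(* HOL-Analysis and Jordan_Normal_Form both use $ and both name types/constants vec, mat.
   Below only the Jordan_Normal_Form versions occur; its dimension-as-a-value matrices are
   needed because kappa is a variable. *)
no_notation Finite_Cartesian_Product.vec_nth (infixl "$" 90)

section \<open>Probability vectors and Markov kernels on \<open>{0..\<kappa>}\<close>\<close>

definition prob_vec :: "nat \<Rightarrow> real Matrix.vec \<Rightarrow> bool" where
  "prob_vec \<kappa> v \<longleftrightarrow>
     v \<in> carrier_vec (\<kappa> + 1) \<and> (\<forall>i\<le>\<kappa>. 0 \<le> v $ i) \<and> (\<Sum>i\<le>\<kappa>. v $ i) = 1"

definition markov_kernel :: "nat \<Rightarrow> real Matrix.mat \<Rightarrow> bool" where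
  "markov_kernel \<kappa> K \<longleftrightarrow> K \<in> carrier_mat (\<kappa> + 1) (\<kappa> + 1) \<and>
     (\<forall>i\<le>\<kappa>. \<forall>j\<le>\<kappa>. 0 \<le> K $$ (i, j)) \<and> (\<forall>i\<le>\<kappa>. (\<Sum>j\<le>\<kappa>. K $$ (i, j)) = 1)"

(* The transpose turns the row-vector equation rho K = rho into a column-vector one. *)
definition invariant_dist :: "nat \<Rightarrow> real Matrix.mat \<Rightarrow> real Matrix.vec \<Rightarrow> bool" where
  "invariant_dist \<kappa> K \<rho> \<longleftrightarrow> prob_vec \<kappa> \<rho> \<and> transpose_mat K *\<^sub>v \<rho> = \<rho>"

section \<open>Perron eigenvectors\<close>

(* Maximality of the modulus is over all complex eigenvalues. *)
definition perron_eigenvalue :: "real Matrix.mat \<Rightarrow> complex \<Rightarrow> bool" where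
  "perron_eigenvalue A k \<longleftrightarrow>
     eigenvalue (map_mat complex_of_real A) k \<and>
     cmod k = spectral_radius (map_mat complex_of_real A)"

definition perron_right_eigenvector :: "real Matrix.mat \<Rightarrow> real Matrix.vec \<Rightarrow> bool" where
  "perron_right_eigenvector A v \<longleftrightarrow>
     (\<exists>k. perron_eigenvalue A k \<and>
          eigenvector (map_mat complex_of_real A) (map_vec complex_of_real v) k) \<and>
     (\<forall>i<dim_vec v. 0 < v $ i)"

definition perron_left_eigenvector :: "real Matrix.mat \<Rightarrow> real Matrix.vec \<Rightarrow> bool" where
  "perron_left_eigenvector A v \<longleftrightarrow>
     (\<exists>k. perron_eigenvalue A k \<and>
          eigenvector (transpose_mat (map_mat complex_of_real A)) (map_vec complex_of_real v) k) \<and>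
     (\<forall>i<dim_vec v. 0 < v $ i)"

section \<open>Transition matrices and the objects built from them\<close>

(* T a b c stands for T_{(a,b),c}; values outside {0..kappa} are irrelevant. *)
definition transition_matrix :: "nat \<Rightarrow> (nat \<Rightarrow> nat \<Rightarrow> nat \<Rightarrow> real) \<Rightarrow> bool" where
  "transition_matrix \<kappa> T \<longleftrightarrow>
     (\<forall>a\<le>\<kappa>. \<forall>b\<le>\<kappa>. (\<forall>c\<le>\<kappa>. 0 \<le> T a b c) \<and> (\<Sum>c\<le>\<kappa>. T a b c) = 1)"

definition positive_rate :: "nat \<Rightarrow> (nat \<Rightarrow> nat \<Rightarrow> nat \<Rightarrow> real) \<Rightarrow> bool" where
  "positive_rate \<kappa> T \<longleftrightarrow> (\<forall>a\<le>\<kappa>. \<forall>b\<le>\<kappa>. \<forall>c\<le>\<kappa>. 0 < T a b c)"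

definition Y_mat :: "nat \<Rightarrow> (nat \<Rightarrow> nat \<Rightarrow> nat \<Rightarrow> real) \<Rightarrow> real Matrix.mat" where
  "Y_mat \<kappa> T = Matrix.mat (\<kappa> + 1) (\<kappa> + 1) (\<lambda>(i, j). T i i j)"

definition nu_vec :: "nat \<Rightarrow> (nat \<Rightarrow> nat \<Rightarrow> nat \<Rightarrow> real) \<Rightarrow> real Matrix.vec" where
  "nu_vec \<kappa> T = (THE v. perron_left_eigenvector (Y_mat \<kappa> T) v \<and> prob_vec \<kappa> v)"

definition X_mat :: "nat \<Rightarrow> (nat \<Rightarrow> nat \<Rightarrow> nat \<Rightarrow> real) \<Rightarrow> real Matrix.mat" where
  "X_mat \<kappa> T = Matrix.mat (\<kappa> + 1) (\<kappa> + 1) (\<lambda>(d, a). T a a 0 * nu_vec \<kappa> T $ a / T a d 0)"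

definition gamma_vec :: "nat \<Rightarrow> (nat \<Rightarrow> nat \<Rightarrow> nat \<Rightarrow> real) \<Rightarrow> real Matrix.vec" where
  "gamma_vec \<kappa> T = (THE v. perron_left_eigenvector (X_mat \<kappa> T) v \<and> prob_vec \<kappa> v)"

definition pointwise_prod :: "nat \<Rightarrow> real Matrix.vec \<Rightarrow> real Matrix.vec \<Rightarrow> real Matrix.vec" where
  "pointwise_prod \<kappa> v w = Matrix.vec (\<kappa> + 1) (\<lambda>i. v $ i * w $ i)"

definition mu_vec :: "nat \<Rightarrow> (nat \<Rightarrow> nat \<Rightarrow> nat \<Rightarrow> real) \<Rightarrow> real Matrix.vec" where
  "mu_vec \<kappa> T = (THE v. perron_right_eigenvector (X_mat \<kappa> T) v \<and>
                        prob_vec \<kappa> (pointwise_prod \<kappa> (gamma_vec \<kappa> T) v))"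

definition D_mat ::
  "nat \<Rightarrow> (nat \<Rightarrow> nat \<Rightarrow> nat \<Rightarrow> real) \<Rightarrow> real Matrix.vec \<Rightarrow> real Matrix.mat" where
  "D_mat \<kappa> T \<eta> = Matrix.mat (\<kappa> + 1) (\<kappa> + 1) (\<lambda>(a, c).
     (\<Sum>l\<le>\<kappa>. \<eta> $ l / T a l 0 * T a l c) / (\<Sum>b\<le>\<kappa>. \<eta> $ b / T a b 0))"

definition U_mat ::
  "nat \<Rightarrow> (nat \<Rightarrow> nat \<Rightarrow> nat \<Rightarrow> real) \<Rightarrow> real Matrix.vec \<Rightarrow> real Matrix.mat" where
  "U_mat \<kappa> T \<eta> = Matrix.mat (\<kappa> + 1) (\<kappa> + 1) (\<lambda>(c, b).
     (\<eta> $ b / T 0 b 0 * T 0 b c) / (\<Sum>b'\<le>\<kappa>. \<eta> $ b' / T 0 b' 0 * T 0 b' c))"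

section \<open>Laws on the horizontal zigzag and the action of the automaton\<close>

definition line_space :: "nat \<Rightarrow> (int \<Rightarrow> nat) measure" where
  "line_space \<kappa> = PiM UNIV (\<lambda>_. count_space {..\<kappa>})"

definition HZ_space :: "nat \<Rightarrow> ((int \<Rightarrow> nat) \<times> (int \<Rightarrow> nat)) measure" where
  "HZ_space \<kappa> = line_space \<kappa> \<Otimes>\<^sub>M line_space \<kappa>"

definition HZ_law :: "nat \<Rightarrow> ((int \<Rightarrow> nat) \<times> (int \<Rightarrow> nat)) measure \<Rightarrow> bool" where
  "HZ_law \<kappa> m \<longleftrightarrow> prob_space m \<and> sets m = sets (HZ_space \<kappa>)"

(* Conditional law of the next line given the current line s: independent coordinates,
   the one at x having weights T (s x) (s (x + 1)). *)
definition pca_kernel ::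
  "nat \<Rightarrow> (nat \<Rightarrow> nat \<Rightarrow> nat \<Rightarrow> real) \<Rightarrow> (int \<Rightarrow> nat) \<Rightarrow> (int \<Rightarrow> nat) measure" where
  "pca_kernel \<kappa> T s =
     PiM UNIV (\<lambda>x. point_measure {..\<kappa>} (\<lambda>c. ennreal (T (s x) (s (x + 1)) c)))"

definition pca_image ::
  "nat \<Rightarrow> (nat \<Rightarrow> nat \<Rightarrow> nat \<Rightarrow> real) \<Rightarrow> ((int \<Rightarrow> nat) \<times> (int \<Rightarrow> nat)) measure
     \<Rightarrow> ((int \<Rightarrow> nat) \<times> (int \<Rightarrow> nat)) measure" where
  "pca_image \<kappa> T m =
     m \<bind> (\<lambda>(s0, s1). distr (pca_kernel \<kappa> T s1) (HZ_space \<kappa>) (\<lambda>s2. (s1, s2)))"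

definition pca_invariant ::
  "nat \<Rightarrow> (nat \<Rightarrow> nat \<Rightarrow> nat \<Rightarrow> real) \<Rightarrow> ((int \<Rightarrow> nat) \<times> (int \<Rightarrow> nat)) measure \<Rightarrow> bool" where
  "pca_invariant \<kappa> T m \<longleftrightarrow> pca_image \<kappa> T m = m"

section \<open>Horizontal zigzag Markov chains\<close>

definition HZMC_law_init ::
  "nat \<Rightarrow> real Matrix.mat \<Rightarrow> real Matrix.mat \<Rightarrow> real Matrix.vec
     \<Rightarrow> ((int \<Rightarrow> nat) \<times> (int \<Rightarrow> nat)) measure \<Rightarrow> bool" where
  "HZMC_law_init \<kappa> D U \<rho> m \<longleftrightarrow>
     markov_kernel \<kappa> D \<and> markov_kernel \<kappa> U \<and> invariant_dist \<kappa> (D * U) \<rho> \<and> HZ_law \<kappa> m \<and>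
     (\<forall>(i0::int) (n::nat) (a::nat \<Rightarrow> nat) (b::nat \<Rightarrow> nat).
        (\<forall>i\<le>n. a i \<le> \<kappa> \<and> b i \<le> \<kappa>) \<longrightarrow>
        measure m {(s0, s1) \<in> space m. \<forall>i\<le>n. s0 (i0 + int i) = a i \<and> s1 (i0 + int i) = b i} =
        \<rho> $ a 0 * (\<Prod>i<n. D $$ (a i, b i) * U $$ (b i, a (i + 1))) * D $$ (a n, b n))"

definition HZMC_law ::
  "nat \<Rightarrow> real Matrix.mat \<Rightarrow> real Matrix.mat \<Rightarrow> ((int \<Rightarrow> nat) \<times> (int \<Rightarrow> nat)) measure \<Rightarrow> bool" where
  "HZMC_law \<kappa> D U m \<longleftrightarrow> (\<exists>\<rho>. HZMC_law_init \<kappa> D U \<rho> m)"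

end

(* If a zigzag chain with kernels D, U and initial law \<rho> is invariant, comparing the windows with one
   and two columns before and after a step gives \<rho> = \<rho> D, D U = U D and
   T a b c * (D U)(a, b) = D(a, c) * U(c, b), all entries being positive. This factorization implies (1),
   and it determines D and U: with \<eta> = U(0, _), one finds D = D^\<eta>, U = U^\<eta>, the diagonal of D U is
   proportional to \<nu>, and \<eta> is a positive left eigenvector of X, hence \<eta> = \<gamma>. Conversely, (1) alone
   makes D^\<gamma>, U^\<gamma> satisfy the factorization, and with (2) the windows of the chain are preserved.
   Since D U and U D always have the same diagonal under (1), they agree if there are two states. *)
theory Submission
  imports Defs
begin

section \<open>Perron eigenvectors of positive matrices\<close>

text \<open>The vectors \<nu>, \<gamma>, \<mu> are definite descriptions of eigenvectors whose
  eigenvalue has maximal modulus among all complex ones, so they denote something only once Perron's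
  theorem for positive matrices is available; it is proved by the Collatz-Wielandt argument. The
  shapes of Y and X can be read off from \<open>T a b c\<close> = D(a,c) U(c,b) / W(a,b) with W = D
  U = U D. Weighting \<open>T i i j\<close> by W(i,i) and summing over i gives the diagonal of U D
  at j, so the normalised diagonal of W is fixed by Y. With this \<nu>, X(d,a) = U(0,a) W(a,d) / (t
  U(0,d)), t being the trace of W: a multiple of a diagonal conjugate of the transpose of W. The row
  sums of W make U(0,_) a left eigenvector, and \<rho> W = \<rho> makes \<rho> / U(0,_) a right one;
  hence \<rho> is the product of \<gamma> and \<mu>. Two obstacles remain. The kernels of an
  invariant chain may a priori have zeros, so positivity must be extracted from the positive rate.
  And the chain must be shown to exist on the two-sided line, where it has no first site.\<close>

lemma positive_eigenvalue_le:
  fixes A :: "nat \<Rightarrow> nat \<Rightarrow> real"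
  assumes A: "\<And>i j. i \<le> n \<Longrightarrow> j \<le> n \<Longrightarrow> 0 \<le> A i j"
    and x: "\<And>i. i \<le> n \<Longrightarrow> 0 < x i" "\<And>i. i \<le> n \<Longrightarrow> (\<Sum>j\<le>n. A i j * x j) = r * x i"
    and y: "\<exists>i\<le>n. y i \<noteq> 0"
      "\<And>i. i \<le> n \<Longrightarrow> (\<Sum>j\<le>n. complex_of_real (A i j) * y j) = s * y i"
  shows "cmod s \<le> r"
proof -
  let ?q = "\<lambda>i. cmod (y i) / x i"
  \<comment> \<open>The smallest factor with |y| \<le> t x entrywise. It is attained at some i, and
    the eigen-equation of y at i with the triangle inequality gives |s| t x_i \<le> r t x_i.\<close>
  define t where "t = Max (?q ` {..n})"
  have "t \<in> ?q ` {..n}" unfolding t_def by (rule Max_in) auto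
  then obtain i where i: "i \<le> n" "t = ?q i" by auto
  have t: "cmod (y j) \<le> t * x j" if "j \<le> n" for j
  proof -
    have "?q j \<le> t" unfolding t_def using that by (intro Max_ge) auto
    with x(1)[OF that] show ?thesis by (simp add: field_simps)
  qed
  obtain k where k: "k \<le> n" "y k \<noteq> 0" using y(1) by auto
  have "0 < cmod (y k)" using k by simp
  with t[OF k(1)] x(1)[OF k(1)] have tpos: "0 < t"
    by (metis less_le_trans zero_less_mult_pos2)
  have eqi: "t * x i = cmod (y i)" using i x(1)[OF i(1)] by simp
  have "cmod s * cmod (y i) = cmod (\<Sum>j\<le>n. complex_of_real (A i j) * y j)"
    using y(2)[OF i(1)] by (simp add: norm_mult)
  also have "\<dots> \<le> (\<Sum>j\<le>n. A i j * (t * x j))"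
    using A[OF i(1)] t by (intro sum_norm_le) (auto simp: norm_mult intro!: mult_left_mono)
  also have "\<dots> = t * (\<Sum>j\<le>n. A i j * x j)" by (simp add: sum_distrib_left mult_ac)
  also have "\<dots> = r * (t * x i)" by (simp add: x(2)[OF i(1)])
  finally have "cmod s * (t * x i) \<le> r * (t * x i)" by (simp add: eqi)
  with tpos x(1)[OF i(1)] show ?thesis by simp
qed

text \<open>By \<open>positive_eigenvalue_le\<close> in both directions the two eigenvalues agree.
  With t the least factor such that y \<le> t x, the nonnegative vector t x - y vanishes at one
  index and so does its image there; a row of positive entries then forces it to vanish
  everywhere.\<close>

lemma positive_eigenvector_unique:
  fixes A :: "nat \<Rightarrow> nat \<Rightarrow> real"
  assumes A: "\<And>i j. i \<le> n \<Longrightarrow> j \<le> n \<Longrightarrow> 0 < A i j"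
    and x: "\<And>i. i \<le> n \<Longrightarrow> 0 < x i" "\<And>i. i \<le> n \<Longrightarrow> (\<Sum>j\<le>n. A i j * x j) = r * x i"
    and y: "\<And>i. i \<le> n \<Longrightarrow> 0 < y i" "\<And>i. i \<le> n \<Longrightarrow> (\<Sum>j\<le>n. A i j * y j) = s * y i"
  obtains c where "0 < c" "\<And>i. i \<le> n \<Longrightarrow> y i = c * x i"
proof -
  have ex: "\<exists>i\<le>n. complex_of_real (z i) \<noteq> 0" if "\<And>i. i \<le> n \<Longrightarrow> 0 < z i" for z
    using that[of 0] by (intro exI[of _ 0]) auto
  have ev: "(\<Sum>j\<le>n. complex_of_real (A i j) * complex_of_real (z j)) = complex_of_real q * complex_of_real (z i)"
    if "(\<Sum>j\<le>n. A i j * z j) = q * z i" for z q i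
    by (simp only: of_real_mult[symmetric] of_real_sum[symmetric] that)
  have "cmod (complex_of_real s) \<le> r"
    by (rule positive_eigenvalue_le[where A = A and x = x and y = "\<lambda>i. complex_of_real (y i)" and n = n])
      (use A x y ex ev in \<open>auto simp: less_imp_le\<close>)
  moreover have "cmod (complex_of_real r) \<le> s"
    by (rule positive_eigenvalue_le[where A = A and x = y and y = "\<lambda>i. complex_of_real (x i)" and n = n])
      (use A x y ex ev in \<open>auto simp: less_imp_le\<close>)
  ultimately have rs: "s = r" by simp
  let ?q = "\<lambda>i. y i / x i"
  define t where "t = Max (?q ` {..n})"
  have "t \<in> ?q ` {..n}" unfolding t_def by (rule Max_in) auto
  then obtain i where i: "i \<le> n" "t = ?q i" by auto
  have t: "y j \<le> t * x j" if "j \<le> n" for j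
  proof -
    have "?q j \<le> t" unfolding t_def using that by (intro Max_ge) auto
    with x(1)[OF that] show ?thesis by (simp add: field_simps)
  qed
  have eqi: "y i = t * x i" using i x(1)[OF i(1)] by simp
  have "(\<Sum>j\<le>n. A i j * (t * x j - y j)) = t * (\<Sum>j\<le>n. A i j * x j) - (\<Sum>j\<le>n. A i j * y j)"
    by (simp add: sum_distrib_left sum_subtractf algebra_simps)
  also have "\<dots> = 0" by (simp add: x(2)[OF i(1)] y(2)[OF i(1)] rs eqi)
  finally have "\<forall>j\<in>{..n}. A i j * (t * x j - y j) = 0"
    using t A[OF i(1)] by (subst (asm) sum_nonneg_eq_0_iff) (auto simp: less_imp_le)
  then have eq: "y j = t * x j" if "j \<le> n" for j
    using A[OF i(1) that] that by (auto dest!: bspec[of _ _ j])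
  have "0 < t" using i x(1)[OF i(1)] y(1)[OF i(1)] by simp
  with eq show ?thesis using that by blast
qed

text \<open>Collatz-Wielandt: r is the largest t with t x \<le> A x for some x in the simplex. If a
  maximiser were no eigenvector, applying A once more would make all inequalities strict and leave
  room for a larger t.\<close>

lemma positive_eigenvector_exists:
  fixes A :: "nat \<Rightarrow> nat \<Rightarrow> real"
  assumes A: "\<And>i j. i \<le> n \<Longrightarrow> j \<le> n \<Longrightarrow> 0 < A i j"
  obtains r x where "0 < r" "\<And>i. i \<le> n \<Longrightarrow> 0 < x i" "(\<Sum>i\<le>n. x i) = 1"
    "\<And>i. i \<le> n \<Longrightarrow> (\<Sum>j\<le>n. A i j * x j) = r * x i"
proof -
  \<comment> \<open>Vectors are functions on all of \<open>nat\<close>; zeros beyond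
    \<open>n\<close> place the simplex inside a product of copies of [0,1], which is compact in the
    product topology.\<close>
  define S where "S = {x::nat \<Rightarrow> real. (\<forall>i\<le>n. 0 \<le> x i) \<and> (\<forall>i>n. x i = 0) \<and> (\<Sum>i\<le>n. x i) = 1}"
  define M where "M = (\<Sum>i\<le>n. \<Sum>j\<le>n. A i j)"
  \<comment> \<open>The cap \<open>M\<close> on t serves compactness; that the enlarged value
    \<open>r + e\<close> still respects it is checked where that value is produced.\<close>
  define K where "K = {(t, x). 0 \<le> t \<and> t \<le> M \<and> x \<in> S \<and> (\<forall>i\<le>n. t * x i \<le> (\<Sum>j\<le>n. A i j * x j))}"
  have le1: "x i \<le> 1" if "x \<in> S" for x i
  proof (cases "i \<le> n")
    case True
    then have "x i \<le> (\<Sum>i\<le>n. x i)" using that by (intro member_le_sum) (auto simp: S_def)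
    then show ?thesis using that by (simp add: S_def)
  qed (use that in \<open>auto simp: S_def\<close>)
  have nonneg: "0 \<le> x i" if "x \<in> S" for x i
    using that by (cases "i \<le> n") (auto simp: S_def)
  have cont: "continuous_on UNIV (\<lambda>p::real \<times> (nat \<Rightarrow> real). snd p i)" for i
    by (rule continuous_on_compose2[OF continuous_on_product_coordinates continuous_on_snd]) auto
  have "compact K"
  proof -
    have comp: "compact ({0..M} \<times> Pi\<^sub>E (UNIV::nat set) (\<lambda>_. {0..1::real}))"
      using compactin_PiE[of "\<lambda>_. euclideanreal" "UNIV::nat set" "\<lambda>_. {0..1}"]
      by (intro compact_Times compact_Icc) (simp add: euclidean_product_topology)
    have "K = ({0..M} \<times> Pi\<^sub>E (UNIV::nat set) (\<lambda>_. {0..1::real})) \<inter>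
        ((\<Inter>i\<in>{n<..}. {p. snd p i = 0}) \<inter> {p. (\<Sum>i\<le>n. snd p i) = 1} \<inter>
         (\<Inter>i\<in>{..n}. {p. fst p * snd p i \<le> (\<Sum>j\<le>n. A i j * snd p j)}))"
      (is "K = ?R")
    proof (rule Set.set_eqI)
      fix p :: "real \<times> (nat \<Rightarrow> real)"
      obtain t x where p: "p = (t, x)" by (cases p)
      have "(t, x) \<in> K \<longleftrightarrow> 0 \<le> t \<and> t \<le> M \<and> (\<forall>i. 0 \<le> x i \<and> x i \<le> 1) \<and> (\<forall>i>n. x i = 0) \<and> (\<Sum>i\<le>n. x i) = 1 \<and>
          (\<forall>i\<le>n. t * x i \<le> (\<Sum>j\<le>n. A i j * x j))" (is "?l = ?r")
      proof
        assume ?l then show ?r unfolding K_def using le1[of x] nonneg[of x] by (simp add: S_def)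
      next
        assume ?r then show ?l unfolding K_def S_def by simp
      qed
      also have "\<dots> \<longleftrightarrow> (t, x) \<in> ?R" 
        by (simp only: Ball_def Int_iff INT_iff mem_Times_iff PiE_UNIV_domain Pi_iff mem_Collect_eq
            fst_conv snd_conv atLeastAtMost_iff greaterThan_iff atMost_iff UNIV_I simp_thms conj_assoc)
      finally show "p \<in> K \<longleftrightarrow> p \<in> ?R" unfolding p .
    qed
    also have "compact \<dots>"
      by (intro compact_Int_closed comp closed_Int closed_INT ballI closed_Collect_eq closed_Collect_le
          continuous_intros cont)
    finally show ?thesis .
  qed
  moreover have "K \<noteq> {}"
  proof -
    have "M \<ge> 0" unfolding M_def using A by (intro sum_nonneg) (auto simp: less_imp_le)
    moreover have "(\<lambda>i. if i = 0 then 1 else 0) \<in> S" by (auto simp: S_def)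
    ultimately have "(0, \<lambda>i. if i = 0 then 1 else 0) \<in> K"
      using A by (auto simp: K_def less_imp_le intro!: sum_nonneg)
    then show ?thesis by blast
  qed
  moreover have "continuous_on K fst" by (intro continuous_intros)
  ultimately obtain p where "p \<in> K" and "\<forall>q\<in>K. fst q \<le> fst p"
    using continuous_attains_sup[of K fst] by blast
  then obtain r x where K: "(r, x) \<in> K" and max: "\<And>t y. (t, y) \<in> K \<Longrightarrow> t \<le> r" 
    by (cases p) force
  have xS: "x \<in> S" using K by (simp add: K_def)
  have pos: "0 < (\<Sum>j\<le>n. A i j * z j)" if i: "i \<le> n" and z: "\<And>j. j \<le> n \<Longrightarrow> 0 \<le> z j" "\<exists>j\<le>n. z j \<noteq> 0" for i z
  proof -
    from z obtain j where j: "j \<le> n" "0 < z j" by (metis less_eq_real_def)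
    have "0 < A i j * z j" using A[OF i j(1)] j by simp
    also have "\<dots> \<le> (\<Sum>j\<le>n. A i j * z j)"
      using j A[OF i] z(1) by (intro member_le_sum) (auto simp: less_imp_le)
    finally show ?thesis .
  qed
  have xne: "\<exists>j\<le>n. x j \<noteq> 0"
  proof (rule ccontr)
    assume "\<not> ?thesis"
    then have "(\<Sum>i\<le>n. x i) = 0" by auto
    with xS show False by (simp add: S_def)
  qed
  \<comment> \<open>z = A x. By \<open>pos\<close>, A sends nonzero nonnegative vectors to positive
    ones; this is applied to x and to z - r x.\<close>
  define z where "z = (\<lambda>i. if i \<le> n then \<Sum>j\<le>n. A i j * x j else 0)"
  have zpos: "0 < z i" if "i \<le> n" for i
    using pos[OF that, of x] nonneg[OF xS] xne that by (simp add: z_def)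
  have r0: "0 \<le> r" using K by (simp add: K_def)
  have zr: "r * x i \<le> z i" if "i \<le> n" for i using K that by (auto simp: K_def z_def)
  have eq: "z i = r * x i" if "i \<le> n" for i
  proof (rule ccontr)
    assume "\<not> ?thesis"
    then have ne: "\<exists>j\<le>n. z j - r * x j \<noteq> 0" using that by auto
    have strict: "0 < (\<Sum>j\<le>n. A i j * z j) - r * z i" if "i \<le> n" for i
    proof -
      have "0 < (\<Sum>j\<le>n. A i j * (z j - r * x j))"
        using pos[OF that, of "\<lambda>j. z j - r * x j"] ne zr by auto
      also have "\<dots> = (\<Sum>j\<le>n. A i j * z j) - r * z i"
        using that by (simp add: z_def sum_subtractf sum_distrib_left algebra_simps)
      finally show ?thesis .
    qed
    \<comment> \<open>The smallest relative slack, so that r + e works for z in every row at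
      once.\<close>
    define e where "e = Min ((\<lambda>i. ((\<Sum>j\<le>n. A i j * z j) - r * z i) / z i) ` {..n})"
    have e0: "0 < e" unfolding e_def using strict zpos by (subst Min_gr_iff) auto
    have ez: "(r + e) * z i \<le> (\<Sum>j\<le>n. A i j * z j)" if "i \<le> n" for i
    proof -
      have "e \<le> ((\<Sum>j\<le>n. A i j * z j) - r * z i) / z i" unfolding e_def using that by (intro Min_le) auto
      with zpos[OF that] show ?thesis by (simp add: field_simps)
    qed
    define N where "N = (\<Sum>i\<le>n. z i)"
    have N: "0 < N" unfolding N_def using zpos by (intro sum_pos) auto
    have zN: "z i \<le> N" if "i \<le> n" for i
      unfolding N_def using that zpos by (intro member_le_sum) (auto simp: less_imp_le)
    \<comment> \<open>Summing the row inequalities and bounding every z_j by N gives (r + e) N \<le>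
      M N.\<close>
    have "(\<Sum>i\<le>n. (r + e) * z i) \<le> (\<Sum>i\<le>n. \<Sum>j\<le>n. A i j * z j)"
      by (intro sum_mono ez) auto
    also have "\<dots> \<le> (\<Sum>i\<le>n. \<Sum>j\<le>n. A i j * N)"
      using A zN by (intro sum_mono mult_left_mono) (auto simp: less_imp_le)
    also have "\<dots> = M * N" by (simp add: M_def sum_distrib_right)
    finally have "(r + e) * N \<le> M * N" by (simp add: N_def sum_distrib_left)
    then have "r + e \<le> M" using N by simp
    moreover have "(\<lambda>i. z i / N) \<in> S"
    proof -
      have "(\<Sum>i\<le>n. z i / N) = 1" using N by (simp add: N_def flip: sum_divide_distrib)
      moreover have "z i / N = 0" if "n < i" for i using that by (simp add: z_def)
      ultimately show ?thesis using N zpos by (auto simp: S_def less_imp_le)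
    qed
    moreover have "(r + e) * (z i / N) \<le> (\<Sum>j\<le>n. A i j * (z j / N))" if "i \<le> n" for i
    proof -
      have "(r + e) * (z i / N) = ((r + e) * z i) / N" by simp
      also have "\<dots> \<le> (\<Sum>j\<le>n. A i j * z j) / N" using ez[OF that] N by (intro divide_right_mono) auto
      finally show ?thesis by (simp add: sum_divide_distrib)
    qed
    ultimately have "(r + e, \<lambda>i. z i / N) \<in> K"
      using r0 e0 by (auto simp: K_def)
    from max[OF this] e0 show False by simp
  qed
  have "0 < r" using eq[of 0] zpos[of 0] r0 by (cases "r = 0") auto
  moreover have "0 < x i" if "i \<le> n" for i
    using eq[OF that] zpos[OF that] calculation by (simp add: zero_less_mult_iff)
  moreover have "(\<Sum>i\<le>n. x i) = 1" using xS by (simp add: S_def)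
  moreover have "(\<Sum>j\<le>n. A i j * x j) = r * x i" if "i \<le> n" for i
    using eq[OF that] that by (simp add: z_def)
  ultimately show ?thesis using that by blast
qed

section \<open>Perron eigenvectors as positive real eigenvectors\<close>

lemma eigenvector_of_real_iff:
  assumes A: "A \<in> carrier_mat (n + 1) (n + 1)"
  shows "eigenvector (map_mat complex_of_real A) w k \<longleftrightarrow>
    w \<in> carrier_vec (n + 1) \<and> (\<exists>i\<le>n. w $ i \<noteq> 0) \<and>
    (\<forall>i\<le>n. (\<Sum>j\<le>n. complex_of_real (A $$ (i, j)) * w $ j) = k * w $ i)"
proof (cases "w \<in> carrier_vec (n + 1)")
  case True
  have "w \<noteq> 0\<^sub>v (n + 1) \<longleftrightarrow> (\<exists>i\<le>n. w $ i \<noteq> 0)"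
    using True by (auto simp: vec_eq_iff less_Suc_eq_le)
  moreover have "(map_mat complex_of_real A *\<^sub>v w) $ i = (\<Sum>j\<le>n. complex_of_real (A $$ (i, j)) * w $ j)"
    if "i \<le> n" for i
    using True A that
    by (auto simp: scalar_prod_def less_Suc_eq_le atLeast0LessThan lessThan_Suc_atMost intro!: sum.cong)
  then have "map_mat complex_of_real A *\<^sub>v w = k \<cdot>\<^sub>v w \<longleftrightarrow>
    (\<forall>i\<le>n. (\<Sum>j\<le>n. complex_of_real (A $$ (i, j)) * w $ j) = k * w $ i)"
    using True A by (auto simp: vec_eq_iff less_Suc_eq_le)
  ultimately show ?thesis using True A by (simp add: eigenvector_def)
qed (use A in \<open>auto simp: eigenvector_def\<close>)

text \<open>A matrix and its transpose share the characteristic polynomial, hence the spectrum and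
  the spectral radius. Left Perron eigenvectors refer to the eigenvalue of the matrix itself, so
  this is what reduces them to right ones.\<close>

lemma perron_eigenvalue_transpose:
  assumes "A \<in> carrier_mat n n"
  shows "perron_eigenvalue (transpose_mat A) k \<longleftrightarrow> perron_eigenvalue A k"
proof -
  let ?A = "map_mat complex_of_real A"
  have A: "?A \<in> carrier_mat n n" "transpose_mat ?A \<in> carrier_mat n n" using assms by auto
  have ev: "eigenvalue (transpose_mat ?A) k \<longleftrightarrow> eigenvalue ?A k" for k
    by (simp add: eigenvalue_root_char_poly[OF A(1)] eigenvalue_root_char_poly[OF A(2)]
        char_poly_transpose_mat[OF A(1)])
  have tr: "map_mat complex_of_real (transpose_mat A) = transpose_mat ?A" by (rule eq_matI) auto
  show ?thesis
    unfolding perron_eigenvalue_def spectral_radius_def spectrum_def tr ev ..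
qed

lemma perron_left_eigenvector_iff_right:
  assumes "A \<in> carrier_mat n n"
  shows "perron_left_eigenvector A v \<longleftrightarrow> perron_right_eigenvector (transpose_mat A) v"
proof -
  have "transpose_mat (map_mat complex_of_real A) = map_mat complex_of_real (transpose_mat A)"
    by (rule eq_matI) auto
  then show ?thesis
    by (simp add: perron_left_eigenvector_def perron_right_eigenvector_def
        perron_eigenvalue_transpose[OF assms])
qed

text \<open>The eigenvalue of a positive eigenvector bounds the modulus of every complex eigenvalue
  by \<open>positive_eigenvalue_le\<close>, so it is the spectral radius. This removes the
  maximality clause from all later arguments. In the other direction, real parts of the
  eigen-equation give a real eigenvalue.\<close>

lemma perron_right_eigenvector_iff:
  assumes A: "A \<in> carrier_mat (n + 1) (n + 1)"
    and pos: "\<forall>i\<le>n. \<forall>j\<le>n. 0 < A $$ (i, j)"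
  shows "perron_right_eigenvector A v \<longleftrightarrow>
    v \<in> carrier_vec (n + 1) \<and> (\<forall>i\<le>n. 0 < v $ i) \<and>
    (\<exists>r. \<forall>i\<le>n. (\<Sum>j\<le>n. A $$ (i, j) * v $ j) = r * v $ i)"
    (is "?L \<longleftrightarrow> ?C \<and> ?P \<and> ?E")
proof
  assume ?L
  then obtain k where k: "eigenvector (map_mat complex_of_real A) (map_vec complex_of_real v) k"
    and vp: "\<forall>i<dim_vec v. 0 < v $ i"
    unfolding perron_right_eigenvector_def by blast
  have "map_vec complex_of_real v \<in> carrier_vec (n + 1)"
    and k: "\<forall>i\<le>n. (\<Sum>j\<le>n. complex_of_real (A $$ (i, j)) * map_vec complex_of_real v $ j) =
      k * map_vec complex_of_real v $ i"
    using k unfolding eigenvector_of_real_iff[OF A] by blast+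
  then have C: ?C and dim: "dim_vec v = n + 1" by simp_all
  then have P: ?P using vp by simp
  have "(\<Sum>j\<le>n. A $$ (i, j) * v $ j) = Re k * v $ i" if i: "i \<le> n" for i
  proof -
    have "(\<Sum>j\<le>n. A $$ (i, j) * v $ j) =
        Re (\<Sum>j\<le>n. complex_of_real (A $$ (i, j)) * map_vec complex_of_real v $ j)"
      using dim by simp
    also have "\<dots> = Re k * v $ i" using k[rule_format, OF i] dim i by simp
    finally show ?thesis .
  qed
  with C P show "?C \<and> ?P \<and> ?E" by blast
next
  assume "?C \<and> ?P \<and> ?E"
  then obtain r where C: ?C and P: "\<And>i. i \<le> n \<Longrightarrow> 0 < v $ i"
    and E: "\<And>i. i \<le> n \<Longrightarrow> (\<Sum>j\<le>n. A $$ (i, j) * v $ j) = r * v $ i"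
    by blast
  let ?A = "map_mat complex_of_real A"
  have ne: "\<exists>i\<le>n. complex_of_real (v $ i) \<noteq> 0" using P[of 0] by (intro exI[of _ 0]) auto
  have Ec: "(\<Sum>j\<le>n. complex_of_real (A $$ (i, j)) * complex_of_real (v $ j)) =
      complex_of_real r * complex_of_real (v $ i)" if "i \<le> n" for i
    by (simp only: of_real_mult[symmetric] of_real_sum[symmetric] E[OF that])
  have ev: "eigenvector ?A (map_vec complex_of_real v) (complex_of_real r)"
  proof -
    have v: "map_vec complex_of_real v $ i = complex_of_real (v $ i)" if "i \<le> n" for i
      using C that by simp
    show ?thesis unfolding eigenvector_of_real_iff[OF A]
      using C ne Ec by (auto simp: v)
  qed
  have le: "cmod s \<le> r" if "eigenvalue ?A s" for s
  proof -
    from that obtain w where "eigenvector ?A w s" by (auto simp: eigenvalue_def)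
    then show ?thesis
      unfolding eigenvector_of_real_iff[OF A]
      by (intro positive_eigenvalue_le[where A = "\<lambda>i j. A $$ (i, j)" and x = "\<lambda>i. v $ i" and y = "\<lambda>i. w $ i" and n = n])
        (use pos P E in \<open>auto simp: less_imp_le\<close>)
  qed
  have evl: "eigenvalue ?A (complex_of_real r)" using ev by (auto simp: eigenvalue_def)
  have r: "cmod (complex_of_real r) = r"
    using le[OF evl] by simp
  have A': "?A \<in> carrier_mat (n + 1) (n + 1)" using A by simp
  have "spectral_radius ?A = r"
    unfolding spectral_radius_def
  proof (rule Max_eqI)
    show "finite (norm ` spectrum ?A)" using card_finite_spectrum(1)[OF A'] by simp
    show "y \<le> r" if "y \<in> norm ` spectrum ?A" for y
      using that le by (auto simp: spectrum_def)
    show "r \<in> norm ` spectrum ?A"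
      using evl r by (intro image_eqI[of _ _ "complex_of_real r"]) (auto simp: spectrum_def)
  qed
  then have "perron_eigenvalue A (complex_of_real r)"
    unfolding perron_eigenvalue_def using evl r by simp
  then show ?L
    unfolding perron_right_eigenvector_def using ev C P by (auto simp: less_Suc_eq_le)
qed

lemma perron_left_eigenvector_iff:
  assumes A: "A \<in> carrier_mat (n + 1) (n + 1)"
    and pos: "\<forall>i\<le>n. \<forall>j\<le>n. 0 < A $$ (i, j)"
  shows "perron_left_eigenvector A v \<longleftrightarrow>
    v \<in> carrier_vec (n + 1) \<and> (\<forall>i\<le>n. 0 < v $ i) \<and>
    (\<exists>r. \<forall>j\<le>n. (\<Sum>i\<le>n. v $ i * A $$ (i, j)) = r * v $ j)"
proof -
  have tr: "transpose_mat A $$ (i, j) = A $$ (j, i)" if "i \<le> n" "j \<le> n" for i j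
    using A that by simp
  have "transpose_mat A \<in> carrier_mat (n + 1) (n + 1)" using A by simp
  then have "perron_left_eigenvector A v \<longleftrightarrow> v \<in> carrier_vec (n + 1) \<and> (\<forall>i\<le>n. 0 < v $ i) \<and>
      (\<exists>r. \<forall>j\<le>n. (\<Sum>i\<le>n. transpose_mat A $$ (j, i) * v $ i) = r * v $ j)"
    unfolding perron_left_eigenvector_iff_right[OF A]
    by (rule perron_right_eigenvector_iff) (use pos tr in auto)
  moreover have "(\<Sum>i\<le>n. transpose_mat A $$ (j, i) * v $ i) = (\<Sum>i\<le>n. v $ i * A $$ (i, j))"
    if "j \<le> n" for j
    using that by (simp add: tr mult.commute)
  ultimately show ?thesis by (simp cong: imp_cong)
qed

lemma stochastic_perron_left_eigenvector_iff:
  assumes A: "A \<in> carrier_mat (n + 1) (n + 1)"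
    and pos: "\<forall>i\<le>n. \<forall>j\<le>n. 0 < A $$ (i, j)"
  shows "perron_left_eigenvector A v \<and> prob_vec n v \<longleftrightarrow>
    v \<in> carrier_vec (n + 1) \<and> (\<forall>i\<le>n. 0 < v $ i) \<and> (\<Sum>i\<le>n. v $ i) = 1 \<and>
    (\<exists>r. \<forall>j\<le>n. (\<Sum>i\<le>n. v $ i * A $$ (i, j)) = r * v $ j)"
  using perron_left_eigenvector_iff[OF assms, of v] unfolding prob_vec_def by (meson less_imp_le)

text \<open>Evaluates the definite descriptions behind \<open>nu_vec\<close> and
  \<open>gamma_vec\<close>: positive eigenvectors are proportional and the sum 1 fixes the
  factor.\<close>

lemma stochastic_perron_left_eigenvector_unique:
  assumes A: "A \<in> carrier_mat (n + 1) (n + 1)"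
    and pos: "\<forall>i\<le>n. \<forall>j\<le>n. 0 < A $$ (i, j)"
    and v: "perron_left_eigenvector A v \<and> prob_vec n v"
  shows "(THE v. perron_left_eigenvector A v \<and> prob_vec n v) = v"
proof (rule the_equality, rule v)
  fix w assume w: "perron_left_eigenvector A w \<and> prob_vec n w"
  from iffD1[OF stochastic_perron_left_eigenvector_iff[OF A pos] v] obtain r where v': "v \<in> carrier_vec (n + 1)" "\<And>i. i \<le> n \<Longrightarrow> 0 < v $ i"
    "\<And>j. j \<le> n \<Longrightarrow> (\<Sum>i\<le>n. v $ i * A $$ (i, j)) = r * v $ j" "(\<Sum>i\<le>n. v $ i) = 1"
    by auto
  from iffD1[OF stochastic_perron_left_eigenvector_iff[OF A pos] w] obtain s where w': "w \<in> carrier_vec (n + 1)" "\<And>i. i \<le> n \<Longrightarrow> 0 < w $ i"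
    "\<And>j. j \<le> n \<Longrightarrow> (\<Sum>i\<le>n. w $ i * A $$ (i, j)) = s * w $ j" "(\<Sum>i\<le>n. w $ i) = 1"
    by auto
  obtain c where c: "\<And>i. i \<le> n \<Longrightarrow> w $ i = c * v $ i"
    by (rule positive_eigenvector_unique[where A = "\<lambda>i j. A $$ (j, i)" and n = n and x = "\<lambda>i. v $ i" and y = "\<lambda>i. w $ i"])
      (use pos v' w' in \<open>auto simp: mult.commute\<close>)
  have "(\<Sum>i\<le>n. w $ i) = c * (\<Sum>i\<le>n. v $ i)" using c by (simp add: sum_distrib_left)
  then have "c = 1" using v' w' by simp
  then show "w = v" using c v' w' by (intro eq_vecI) (auto simp: less_Suc_eq_le)
qed

lemma stochastic_perron_left_eigenvector:
  assumes A: "A \<in> carrier_mat (n + 1) (n + 1)"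
    and pos: "\<forall>i\<le>n. \<forall>j\<le>n. 0 < A $$ (i, j)"
  defines "v \<equiv> (THE v. perron_left_eigenvector A v \<and> prob_vec n v)"
  shows "perron_left_eigenvector A v" "prob_vec n v"
proof -
  obtain r x where x: "\<And>i. i \<le> n \<Longrightarrow> 0 < x i" "(\<Sum>i\<le>n. x i) = 1"
      "\<And>i. i \<le> n \<Longrightarrow> (\<Sum>j\<le>n. A $$ (j, i) * x j) = r * x i"
    by (rule positive_eigenvector_exists[of n "\<lambda>i j. A $$ (j, i)"]) (use pos in auto)
  define w where "w = Matrix.vec (n + 1) x"
  have w: "w \<in> carrier_vec (n + 1)" "\<And>i. i \<le> n \<Longrightarrow> w $ i = x i" by (auto simp: w_def)
  have *: "perron_left_eigenvector A w \<and> prob_vec n w"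
    by (rule iffD2[OF stochastic_perron_left_eigenvector_iff[OF A pos]])
      (use x w in \<open>auto simp: mult.commute intro!: exI[of _ r]\<close>)
  from stochastic_perron_left_eigenvector_unique[OF A pos this] *
  show "perron_left_eigenvector A v" "prob_vec n v" unfolding v_def by auto
qed

section \<open>Kernels and invariant distributions\<close>

lemma mult_mat_index:
  assumes "A \<in> carrier_mat (n + 1) (n + 1)" "B \<in> carrier_mat (n + 1) (n + 1)" "i \<le> n" "j \<le> n"
  shows "(A * B) $$ (i, j) = (\<Sum>k\<le>n. A $$ (i, k) * B $$ (k, j))"
  using assms by (auto simp: scalar_prod_def atLeast0LessThan lessThan_Suc_atMost intro!: sum.cong)

lemma markov_kernelD:
  assumes "markov_kernel \<kappa> K"
  shows "K \<in> carrier_mat (\<kappa> + 1) (\<kappa> + 1)"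
    and "i \<le> \<kappa> \<Longrightarrow> j \<le> \<kappa> \<Longrightarrow> 0 \<le> K $$ (i, j)"
    and "i \<le> \<kappa> \<Longrightarrow> (\<Sum>j\<le>\<kappa>. K $$ (i, j)) = 1"
  using assms unfolding markov_kernel_def by auto

lemma markov_kernel_mult:
  assumes K: "markov_kernel \<kappa> K" and L: "markov_kernel \<kappa> L"
  shows "markov_kernel \<kappa> (K * L)"
proof -
  note ix = mult_mat_index[OF markov_kernelD(1)[OF K] markov_kernelD(1)[OF L]]
  have "(\<Sum>j\<le>\<kappa>. \<Sum>k\<le>\<kappa>. K $$ (i, k) * L $$ (k, j)) = 1" if "i \<le> \<kappa>" for i
  proof -
    have "(\<Sum>j\<le>\<kappa>. \<Sum>k\<le>\<kappa>. K $$ (i, k) * L $$ (k, j)) = (\<Sum>k\<le>\<kappa>. K $$ (i, k) * (\<Sum>j\<le>\<kappa>. L $$ (k, j)))"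
      by (subst sum.swap) (simp add: sum_distrib_left)
    then show ?thesis using that by (simp add: markov_kernelD(3)[OF K] markov_kernelD(3)[OF L])
  qed
  moreover have "0 \<le> (K * L) $$ (i, j)" if "i \<le> \<kappa>" "j \<le> \<kappa>" for i j
    unfolding ix[OF that] using that markov_kernelD(2)[OF K] markov_kernelD(2)[OF L]
    by (intro sum_nonneg mult_nonneg_nonneg) auto
  moreover have "K * L \<in> carrier_mat (\<kappa> + 1) (\<kappa> + 1)"
    by (rule mult_carrier_mat[OF markov_kernelD(1)[OF K] markov_kernelD(1)[OF L]])
  ultimately show ?thesis unfolding markov_kernel_def using ix by (simp del: index_mult_mat)
qed

lemma mult_mat_vec_transpose_index:
  fixes K :: "real Matrix.mat"
  assumes "K \<in> carrier_mat (n + 1) (n + 1)" "v \<in> carrier_vec (n + 1)" "j \<le> n"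
  shows "(transpose_mat K *\<^sub>v v) $ j = (\<Sum>i\<le>n. v $ i * K $$ (i, j))"
  using assms
  by (auto simp: scalar_prod_def atLeast0LessThan lessThan_Suc_atMost mult.commute intro!: sum.cong)

lemma invariant_dist_iff:
  assumes K: "K \<in> carrier_mat (\<kappa> + 1) (\<kappa> + 1)"
  shows "invariant_dist \<kappa> K \<rho> \<longleftrightarrow> prob_vec \<kappa> \<rho> \<and> (\<forall>j\<le>\<kappa>. (\<Sum>i\<le>\<kappa>. \<rho> $ i * K $$ (i, j)) = \<rho> $ j)"
proof (cases "\<rho> \<in> carrier_vec (\<kappa> + 1)")
  case True
  have "transpose_mat K *\<^sub>v \<rho> = \<rho> \<longleftrightarrow> (\<forall>j\<le>\<kappa>. (transpose_mat K *\<^sub>v \<rho>) $ j = \<rho> $ j)"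
    using True K by (auto simp: vec_eq_iff less_Suc_eq_le)
  then show ?thesis
    unfolding invariant_dist_def
    using mult_mat_vec_transpose_index[OF K True] by (simp cong: imp_cong)
qed (simp add: invariant_dist_def prob_vec_def)

lemma invariant_dist_pos:
  assumes K: "K \<in> carrier_mat (\<kappa> + 1) (\<kappa> + 1)"
    and pos: "\<forall>i\<le>\<kappa>. \<forall>j\<le>\<kappa>. 0 < K $$ (i, j)"
    and \<rho>: "invariant_dist \<kappa> K \<rho>" and j: "j \<le> \<kappa>"
  shows "0 < \<rho> $ j"
proof -
  have nn: "\<And>i. i \<le> \<kappa> \<Longrightarrow> 0 \<le> \<rho> $ i" and s: "(\<Sum>i\<le>\<kappa>. \<rho> $ i) = 1"
    using \<rho> unfolding invariant_dist_def prob_vec_def by auto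
  have "\<exists>i\<le>\<kappa>. \<rho> $ i \<noteq> 0"
  proof (rule ccontr)
    assume "\<not> ?thesis"
    then have "(\<Sum>i\<le>\<kappa>. \<rho> $ i) = 0" by auto
    with s show False by simp
  qed
  then obtain i where i: "i \<le> \<kappa>" "0 < \<rho> $ i" using nn by (metis less_eq_real_def)
  have "0 < \<rho> $ i * K $$ (i, j)" using i pos j by simp
  also have "\<dots> \<le> (\<Sum>i\<le>\<kappa>. \<rho> $ i * K $$ (i, j))"
    using i nn pos j by (intro member_le_sum) (auto simp: less_imp_le)
  also have "\<dots> = \<rho> $ j" using \<rho> j unfolding invariant_dist_iff[OF K] by blast
  finally show ?thesis .
qed

text \<open>An invariant distribution of a positive kernel has no zero entry, so it is a positive
  eigenvector and therefore unique. Conversely, summing the eigen-equation of the Perron vector over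
  all columns shows that its eigenvalue is 1, since the rows sum to 1.\<close>

lemma invariant_dist_iff_perron:
  assumes K: "markov_kernel \<kappa> K"
    and pos: "\<forall>i\<le>\<kappa>. \<forall>j\<le>\<kappa>. 0 < K $$ (i, j)"
  shows "invariant_dist \<kappa> K \<rho> \<longleftrightarrow> \<rho> = (THE v. perron_left_eigenvector K v \<and> prob_vec \<kappa> v)"
proof -
  note C = markov_kernelD(1)[OF K]
  let ?v = "THE v. perron_left_eigenvector K v \<and> prob_vec \<kappa> v"
  have uniq: "?v = \<rho>" if "invariant_dist \<kappa> K \<rho>" for \<rho>
  proof (rule stochastic_perron_left_eigenvector_unique[OF C pos])
    have inv: "prob_vec \<kappa> \<rho>" "\<And>j. j \<le> \<kappa> \<Longrightarrow> (\<Sum>i\<le>\<kappa>. \<rho> $ i * K $$ (i, j)) = 1 * \<rho> $ j"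
      using that unfolding invariant_dist_iff[OF C] by auto
    with invariant_dist_pos[OF C pos that] show "perron_left_eigenvector K \<rho> \<and> prob_vec \<kappa> \<rho>"
      unfolding perron_left_eigenvector_iff[OF C pos] prob_vec_def by blast
  qed
  define v where "v = (THE v. perron_left_eigenvector K v \<and> prob_vec \<kappa> v)"
  have "perron_left_eigenvector K v \<and> prob_vec \<kappa> v"
    unfolding v_def using stochastic_perron_left_eigenvector[OF C pos] by blast
  from iffD1[OF stochastic_perron_left_eigenvector_iff[OF C pos] this] obtain r
    where v: "v \<in> carrier_vec (\<kappa> + 1)" "\<And>i. i \<le> \<kappa> \<Longrightarrow> 0 < v $ i" "(\<Sum>i\<le>\<kappa>. v $ i) = 1"
      "\<And>j. j \<le> \<kappa> \<Longrightarrow> (\<Sum>i\<le>\<kappa>. v $ i * K $$ (i, j)) = r * v $ j"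
    by blast
  have "r = (\<Sum>j\<le>\<kappa>. r * v $ j)" using v(3) by (simp flip: sum_distrib_left)
  also have "\<dots> = (\<Sum>j\<le>\<kappa>. \<Sum>i\<le>\<kappa>. v $ i * K $$ (i, j))" using v(4) by simp
  also have "\<dots> = (\<Sum>i\<le>\<kappa>. v $ i * (\<Sum>j\<le>\<kappa>. K $$ (i, j)))"
    by (subst sum.swap) (simp add: sum_distrib_left)
  also have "\<dots> = 1" using v(3) by (simp add: markov_kernelD(3)[OF K])
  finally have "invariant_dist \<kappa> K v"
    unfolding invariant_dist_iff[OF C] prob_vec_def using v by (auto simp: less_imp_le)
  with uniq[folded v_def] show ?thesis unfolding v_def by metis
qed

lemma invariant_dist_mult:
  assumes "K \<in> carrier_mat (\<kappa> + 1) (\<kappa> + 1)" "L \<in> carrier_mat (\<kappa> + 1) (\<kappa> + 1)"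
    and "invariant_dist \<kappa> K \<rho>" "invariant_dist \<kappa> L \<rho>"
  shows "invariant_dist \<kappa> (K * L) \<rho>"
proof -
  have "\<rho> \<in> carrier_vec (\<kappa> + 1)" using assms(3) by (simp add: invariant_dist_def prob_vec_def)
  then have "transpose_mat (K * L) *\<^sub>v \<rho> = transpose_mat L *\<^sub>v (transpose_mat K *\<^sub>v \<rho>)"
    using assms(1,2) by (simp add: transpose_mult[of K _ _ L] assoc_mult_mat_vec[of _ "\<kappa> + 1" "\<kappa> + 1" _ "\<kappa> + 1"])
  then show ?thesis using assms(3,4) by (simp add: invariant_dist_def)
qed

text \<open>As the kernels commute, L maps invariant distributions of K to invariant distributions
  of K, and the positive kernel K has only one.\<close>

lemma invariant_dist_commute:
  assumes K: "markov_kernel \<kappa> K" and L: "markov_kernel \<kappa> L"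
    and pos: "\<forall>i\<le>\<kappa>. \<forall>j\<le>\<kappa>. 0 < K $$ (i, j)"
    and comm: "K * L = L * K" and \<rho>: "invariant_dist \<kappa> K \<rho>"
  shows "invariant_dist \<kappa> L \<rho>"
proof -
  note CK = markov_kernelD(1)[OF K] and CL = markov_kernelD(1)[OF L]
  have C: "\<rho> \<in> carrier_vec (\<kappa> + 1)" and P: "prob_vec \<kappa> \<rho>" and E: "transpose_mat K *\<^sub>v \<rho> = \<rho>"
    using \<rho> by (simp_all add: invariant_dist_def prob_vec_def)
  define \<sigma> where "\<sigma> = transpose_mat L *\<^sub>v \<rho>"
  have C\<sigma>: "\<sigma> \<in> carrier_vec (\<kappa> + 1)" using CL C by (simp add: \<sigma>_def)
  have ix: "\<sigma> $ j = (\<Sum>i\<le>\<kappa>. \<rho> $ i * L $$ (i, j))" if "j \<le> \<kappa>" for j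
    unfolding \<sigma>_def by (rule mult_mat_vec_transpose_index[OF CL C that])
  have "transpose_mat K *\<^sub>v \<sigma> = transpose_mat (L * K) *\<^sub>v \<rho>"
    using CK CL C by (simp add: \<sigma>_def transpose_mult[of L _ _ K] assoc_mult_mat_vec[of _ "\<kappa> + 1" "\<kappa> + 1" _ "\<kappa> + 1"])
  also have "\<dots> = transpose_mat L *\<^sub>v (transpose_mat K *\<^sub>v \<rho>)"
    using CK CL C by (simp add: comm[symmetric] transpose_mult[of K _ _ L] assoc_mult_mat_vec[of _ "\<kappa> + 1" "\<kappa> + 1" _ "\<kappa> + 1"])
  finally have eig: "transpose_mat K *\<^sub>v \<sigma> = \<sigma>" by (simp add: E \<sigma>_def)
  have "(\<Sum>j\<le>\<kappa>. \<sigma> $ j) = (\<Sum>i\<le>\<kappa>. \<rho> $ i * (\<Sum>j\<le>\<kappa>. L $$ (i, j)))"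
    using ix by simp (subst sum.swap, simp add: sum_distrib_left)
  also have "\<dots> = 1" using P by (simp add: markov_kernelD(3)[OF L] prob_vec_def)
  finally have "prob_vec \<kappa> \<sigma>"
    using C\<sigma> ix P markov_kernelD(2)[OF L]
    by (auto simp: prob_vec_def intro!: sum_nonneg mult_nonneg_nonneg)
  with eig have "invariant_dist \<kappa> K \<sigma>" by (simp add: invariant_dist_def)
  then have "\<sigma> = \<rho>" using \<rho> unfolding invariant_dist_iff_perron[OF K pos] by simp
  with P show ?thesis by (simp add: invariant_dist_def \<sigma>_def)
qed

section \<open>Factorized transition matrices\<close>

locale positive_pca =
  fixes \<kappa> :: nat and T :: "nat \<Rightarrow> nat \<Rightarrow> nat \<Rightarrow> real"
  assumes transition: "transition_matrix \<kappa> T" and positive: "positive_rate \<kappa> T"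
begin

lemma T_pos [simp]: "a \<le> \<kappa> \<Longrightarrow> b \<le> \<kappa> \<Longrightarrow> c \<le> \<kappa> \<Longrightarrow> 0 < T a b c"
  using positive by (simp add: positive_rate_def)

lemma T_sum: "a \<le> \<kappa> \<Longrightarrow> b \<le> \<kappa> \<Longrightarrow> (\<Sum>c\<le>\<kappa>. T a b c) = 1"
  using transition by (simp add: transition_matrix_def)

text \<open>For positive T this says that \<open>T a b c\<close> splits into a product f(a,b) g(a,c)
  h(b,c); the right-hand side recovers such a product from its values at the reference state
  0.\<close>

definition separable :: bool where
  "separable \<longleftrightarrow> (\<forall>a\<le>\<kappa>. \<forall>b\<le>\<kappa>. \<forall>c\<le>\<kappa>.
     T a b c = (T 0 0 0 * T a b 0 * T a 0 c * T 0 b c) / (T a 0 0 * T 0 b 0 * T 0 0 c))"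

text \<open>The last clause says that, along a stationary chain with kernel \<open>D U\<close>, the transition
  \<open>a \<rightarrow> c \<rightarrow> b\<close> through \<open>D\<close> and \<open>U\<close> conditioned on its endpoints is a step of the automaton.\<close>

definition zigzag_factorization :: "real Matrix.mat \<Rightarrow> real Matrix.mat \<Rightarrow> real Matrix.vec \<Rightarrow> bool" where
  "zigzag_factorization D U \<rho> \<longleftrightarrow> markov_kernel \<kappa> D \<and> markov_kernel \<kappa> U \<and>
     (\<forall>i\<le>\<kappa>. \<forall>j\<le>\<kappa>. 0 < D $$ (i, j)) \<and> (\<forall>i\<le>\<kappa>. \<forall>j\<le>\<kappa>. 0 < U $$ (i, j)) \<and>
     D * U = U * D \<and> invariant_dist \<kappa> D \<rho> \<and> invariant_dist \<kappa> U \<rho> \<and>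
     (\<forall>a\<le>\<kappa>. \<forall>b\<le>\<kappa>. \<forall>c\<le>\<kappa>. T a b c * (D * U) $$ (a, b) = D $$ (a, c) * U $$ (c, b))"

section \<open>The matrices Y and X and the vectors \<nu>, \<gamma>, \<mu>\<close>

lemma Y_mat_carrier: "Y_mat \<kappa> T \<in> carrier_mat (\<kappa> + 1) (\<kappa> + 1)"
  by (simp add: Y_mat_def)

lemma Y_mat_index: "i \<le> \<kappa> \<Longrightarrow> j \<le> \<kappa> \<Longrightarrow> Y_mat \<kappa> T $$ (i, j) = T i i j"
  by (simp add: Y_mat_def)

lemma Y_mat_kernel: "markov_kernel \<kappa> (Y_mat \<kappa> T)"
  unfolding markov_kernel_def using Y_mat_carrier by (simp add: Y_mat_index T_sum less_imp_le)

text \<open>Y is stochastic, so its Perron left eigenvector is its invariant distribution. As an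
  equivalence this serves both to recognise \<nu> and, by reflexivity, to extract its
  properties.\<close>

lemma nu_vec_iff: "\<nu> = nu_vec \<kappa> T \<longleftrightarrow> invariant_dist \<kappa> (Y_mat \<kappa> T) \<nu>"
  unfolding nu_vec_def
  by (subst invariant_dist_iff_perron[OF Y_mat_kernel]) (auto simp: Y_mat_index)

lemma nu_vec_pos: "i \<le> \<kappa> \<Longrightarrow> 0 < nu_vec \<kappa> T $ i"
  using nu_vec_iff[of "nu_vec \<kappa> T"]
  by (intro invariant_dist_pos[OF Y_mat_carrier, of "nu_vec \<kappa> T"]) (auto simp: Y_mat_index)

lemma nu_vec_invariant: "j \<le> \<kappa> \<Longrightarrow> (\<Sum>i\<le>\<kappa>. nu_vec \<kappa> T $ i * T i i j) = nu_vec \<kappa> T $ j"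
  using nu_vec_iff[of "nu_vec \<kappa> T"] unfolding invariant_dist_iff[OF Y_mat_carrier]
  by (simp add: Y_mat_index)

lemma X_mat_carrier: "X_mat \<kappa> T \<in> carrier_mat (\<kappa> + 1) (\<kappa> + 1)"
  by (simp add: X_mat_def)

lemma X_mat_index: "d \<le> \<kappa> \<Longrightarrow> a \<le> \<kappa> \<Longrightarrow> X_mat \<kappa> T $$ (d, a) = T a a 0 * nu_vec \<kappa> T $ a / T a d 0"
  by (simp add: X_mat_def)

lemma X_mat_pos: "\<forall>i\<le>\<kappa>. \<forall>j\<le>\<kappa>. 0 < X_mat \<kappa> T $$ (i, j)"
  by (simp add: X_mat_index nu_vec_pos)

lemma gamma_vec:
  obtains r where "gamma_vec \<kappa> T \<in> carrier_vec (\<kappa> + 1)" "\<And>i. i \<le> \<kappa> \<Longrightarrow> 0 < gamma_vec \<kappa> T $ i"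
    "(\<Sum>i\<le>\<kappa>. gamma_vec \<kappa> T $ i) = 1"
    "\<And>a. a \<le> \<kappa> \<Longrightarrow> (\<Sum>d\<le>\<kappa>. gamma_vec \<kappa> T $ d * X_mat \<kappa> T $$ (d, a)) = r * gamma_vec \<kappa> T $ a"
proof -
  have "perron_left_eigenvector (X_mat \<kappa> T) (gamma_vec \<kappa> T) \<and> prob_vec \<kappa> (gamma_vec \<kappa> T)"
    unfolding gamma_vec_def using stochastic_perron_left_eigenvector[OF X_mat_carrier X_mat_pos] by blast
  from iffD1[OF stochastic_perron_left_eigenvector_iff[OF X_mat_carrier X_mat_pos] this]
  show ?thesis using that by blast
qed

lemma gamma_vec_eqI:
  assumes "\<eta> \<in> carrier_vec (\<kappa> + 1)" "\<And>i. i \<le> \<kappa> \<Longrightarrow> 0 < \<eta> $ i" "(\<Sum>i\<le>\<kappa>. \<eta> $ i) = 1"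
    and "\<And>a. a \<le> \<kappa> \<Longrightarrow> (\<Sum>d\<le>\<kappa>. \<eta> $ d * X_mat \<kappa> T $$ (d, a)) = r * \<eta> $ a"
  shows "gamma_vec \<kappa> T = \<eta>"
  unfolding gamma_vec_def
  by (rule stochastic_perron_left_eigenvector_unique[OF X_mat_carrier X_mat_pos],
      rule iffD2[OF stochastic_perron_left_eigenvector_iff[OF X_mat_carrier X_mat_pos]])
    (use assms in blast)

text \<open>Positive right eigenvectors of X are proportional, and the sum weighted by the positive
  vector \<gamma> fixes the factor.\<close>

lemma mu_vec_eqI:
  assumes v: "v \<in> carrier_vec (\<kappa> + 1)" "\<And>i. i \<le> \<kappa> \<Longrightarrow> 0 < v $ i"
      "(\<Sum>i\<le>\<kappa>. gamma_vec \<kappa> T $ i * v $ i) = 1"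
      "\<And>d. d \<le> \<kappa> \<Longrightarrow> (\<Sum>a\<le>\<kappa>. X_mat \<kappa> T $$ (d, a) * v $ a) = r * v $ d"
  shows "mu_vec \<kappa> T = v"
  unfolding mu_vec_def
proof (rule the_equality)
  have \<gamma>: "\<And>i. i \<le> \<kappa> \<Longrightarrow> 0 < gamma_vec \<kappa> T $ i" using gamma_vec by blast
  have pw: "pointwise_prod \<kappa> (gamma_vec \<kappa> T) w $ i = gamma_vec \<kappa> T $ i * w $ i" if "i \<le> \<kappa>" for w i
    using that by (simp add: pointwise_prod_def)
  have pwC: "pointwise_prod \<kappa> (gamma_vec \<kappa> T) w \<in> carrier_vec (\<kappa> + 1)" for w
    by (simp add: pointwise_prod_def)
  have "perron_right_eigenvector (X_mat \<kappa> T) v"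
    unfolding perron_right_eigenvector_iff[OF X_mat_carrier X_mat_pos] using v by blast
  moreover have "prob_vec \<kappa> (pointwise_prod \<kappa> (gamma_vec \<kappa> T) v)"
    unfolding prob_vec_def using pwC v \<gamma> by (simp add: pw less_imp_le)
  ultimately show "perron_right_eigenvector (X_mat \<kappa> T) v \<and> prob_vec \<kappa> (pointwise_prod \<kappa> (gamma_vec \<kappa> T) v)"
    by blast
  fix w assume w: "perron_right_eigenvector (X_mat \<kappa> T) w \<and> prob_vec \<kappa> (pointwise_prod \<kappa> (gamma_vec \<kappa> T) w)"
  then obtain s where w': "w \<in> carrier_vec (\<kappa> + 1)" "\<And>i. i \<le> \<kappa> \<Longrightarrow> 0 < w $ i"
      "\<And>d. d \<le> \<kappa> \<Longrightarrow> (\<Sum>a\<le>\<kappa>. X_mat \<kappa> T $$ (d, a) * w $ a) = s * w $ d"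
    unfolding perron_right_eigenvector_iff[OF X_mat_carrier X_mat_pos] by blast
  from w have "(\<Sum>i\<le>\<kappa>. pointwise_prod \<kappa> (gamma_vec \<kappa> T) w $ i) = 1" by (simp add: prob_vec_def)
  then have w1: "(\<Sum>i\<le>\<kappa>. gamma_vec \<kappa> T $ i * w $ i) = 1" by (simp add: pw)
  obtain c where c: "\<And>i. i \<le> \<kappa> \<Longrightarrow> w $ i = c * v $ i"
    by (rule positive_eigenvector_unique[where A = "\<lambda>i j. X_mat \<kappa> T $$ (i, j)" and n = \<kappa>
          and x = "\<lambda>i. v $ i" and y = "\<lambda>i. w $ i" and r = r and s = s])
      (use X_mat_pos v w' in auto)
  have "1 = (\<Sum>i\<le>\<kappa>. c * (gamma_vec \<kappa> T $ i * v $ i))" using w1 c by (simp add: mult_ac)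
  then have "c = 1" using v(3) by (simp flip: sum_distrib_left)
  then show "w = v" using c v(1) w'(1) by (intro eq_vecI) (auto simp: less_Suc_eq_le)
qed

text \<open>Everything comes from substituting D(a,c) U(c,b) / W(a,b) for \<open>T a b c\<close>,
  after which the defining formulas collapse by cancellation.\<close>

lemma zigzag_factorizationD:
  assumes Z: "zigzag_factorization D U \<rho>"
  shows "separable" and "D_mat \<kappa> T (gamma_vec \<kappa> T) = D" and "U_mat \<kappa> T (gamma_vec \<kappa> T) = U"
    and "pointwise_prod \<kappa> (gamma_vec \<kappa> T) (mu_vec \<kappa> T) = \<rho>"
proof -
  have D: "markov_kernel \<kappa> D" and U: "markov_kernel \<kappa> U"
    and Dp: "\<And>i j. i \<le> \<kappa> \<Longrightarrow> j \<le> \<kappa> \<Longrightarrow> 0 < D $$ (i, j)"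
    and Up: "\<And>i j. i \<le> \<kappa> \<Longrightarrow> j \<le> \<kappa> \<Longrightarrow> 0 < U $$ (i, j)"
    and comm: "D * U = U * D" and \<rho>D: "invariant_dist \<kappa> D \<rho>" and \<rho>U: "invariant_dist \<kappa> U \<rho>"
    and fact: "\<And>a b c. a \<le> \<kappa> \<Longrightarrow> b \<le> \<kappa> \<Longrightarrow> c \<le> \<kappa> \<Longrightarrow>
      T a b c * (D * U) $$ (a, b) = D $$ (a, c) * U $$ (c, b)"
    using Z unfolding zigzag_factorization_def by blast+
  note CD = markov_kernelD(1)[OF D] and CU = markov_kernelD(1)[OF U]
  define W where "W a b = (D * U) $$ (a, b)" for a b
  have W: "W a b = (\<Sum>c\<le>\<kappa>. D $$ (a, c) * U $$ (c, b))" if "a \<le> \<kappa>" "b \<le> \<kappa>" for a b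
    unfolding W_def by (rule mult_mat_index[OF CD CU that])
  have W': "W a b = (\<Sum>c\<le>\<kappa>. U $$ (a, c) * D $$ (c, b))" if "a \<le> \<kappa>" "b \<le> \<kappa>" for a b
    unfolding W_def comm by (rule mult_mat_index[OF CU CD that])
  have Wp: "0 < W a b" if "a \<le> \<kappa>" "b \<le> \<kappa>" for a b
    unfolding W[OF that] using that Dp Up by (intro sum_pos) auto
  have T: "T a b c = D $$ (a, c) * U $$ (c, b) / W a b" if "a \<le> \<kappa>" "b \<le> \<kappa>" "c \<le> \<kappa>" for a b c
    using fact[OF that] Wp[OF that(1,2)] by (simp add: W_def field_simps)
  have ne: "D $$ (a, b) \<noteq> 0" "U $$ (a, b) \<noteq> 0" "W a b \<noteq> 0" if "a \<le> \<kappa>" "b \<le> \<kappa>" for a b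
    using Dp[OF that] Up[OF that] Wp[OF that] by auto
  show "separable"
    unfolding separable_def by (auto simp: T ne field_simps)
  define \<eta> where "\<eta> = Matrix.vec (\<kappa> + 1) (\<lambda>b. U $$ (0, b))"
  have \<eta>C: "\<eta> \<in> carrier_vec (\<kappa> + 1)" and \<eta>: "\<And>i. i \<le> \<kappa> \<Longrightarrow> \<eta> $ i = U $$ (0, i)"
    by (auto simp: \<eta>_def)
  \<comment> \<open>The trace of W normalises its diagonal; its inverse turns out to be the Perron
    eigenvalue of X.\<close>
  define t where "t = (\<Sum>i\<le>\<kappa>. W i i)"
  have t: "0 < t" unfolding t_def using Wp by (intro sum_pos) auto
  define \<nu> where "\<nu> = Matrix.vec (\<kappa> + 1) (\<lambda>i. W i i / t)"
  have \<nu>C: "\<nu> \<in> carrier_vec (\<kappa> + 1)" and \<nu>: "\<And>i. i \<le> \<kappa> \<Longrightarrow> \<nu> $ i = W i i / t"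
    by (auto simp: \<nu>_def)
  have \<nu>_eq: "\<nu> = nu_vec \<kappa> T"
    unfolding nu_vec_iff invariant_dist_iff[OF Y_mat_carrier] prob_vec_def
  proof (intro conjI allI impI)
    show "(\<Sum>i\<le>\<kappa>. \<nu> $ i) = 1" using t by (simp add: \<nu> t_def flip: sum_divide_distrib)
    fix j assume j: "j \<le> \<kappa>"
    show "0 \<le> \<nu> $ j" using j Wp t by (simp add: \<nu> less_imp_le)
    \<comment> \<open>\<nu>_i times \<open>T i i j\<close> is U(j,i) D(i,j) / t; summing over i and
      using W = U D returns the diagonal entry at j.\<close>
    have "(\<Sum>i\<le>\<kappa>. \<nu> $ i * Y_mat \<kappa> T $$ (i, j)) = (\<Sum>i\<le>\<kappa>. U $$ (j, i) * D $$ (i, j) / t)"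
      using j ne by (intro sum.cong) (auto simp: \<nu> Y_mat_index T)
    also have "\<dots> = \<nu> $ j" using j by (simp add: W' \<nu> flip: sum_divide_distrib)
    finally show "(\<Sum>i\<le>\<kappa>. \<nu> $ i * Y_mat \<kappa> T $$ (i, j)) = \<nu> $ j" .
  qed (fact \<nu>C)
  \<comment> \<open>In \<open>T a a 0\<close> times \<nu>_a the entry W(a,a) cancels, and D(a,0)
    cancels against \<open>T a d 0\<close>.\<close>
  have X: "X_mat \<kappa> T $$ (d, a) = U $$ (0, a) * W a d / (t * U $$ (0, d))"
    if "d \<le> \<kappa>" "a \<le> \<kappa>" for d a
    using that ne t by (simp add: X_mat_index T flip: \<nu>_eq) (simp add: \<nu> field_simps)
  have Wrow: "(\<Sum>b\<le>\<kappa>. W a b) = 1" if "a \<le> \<kappa>" for a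
    unfolding W_def by (rule markov_kernelD(3)[OF markov_kernel_mult[OF D U] that])
  have \<gamma>: "gamma_vec \<kappa> T = \<eta>"
  proof (rule gamma_vec_eqI[OF \<eta>C, where r = "1 / t"])
    show "(\<Sum>i\<le>\<kappa>. \<eta> $ i) = 1" by (simp add: \<eta> markov_kernelD(3)[OF U])
    show "0 < \<eta> $ i" if "i \<le> \<kappa>" for i using that Up by (simp add: \<eta>)
    fix a assume a: "a \<le> \<kappa>"
    have "(\<Sum>d\<le>\<kappa>. \<eta> $ d * X_mat \<kappa> T $$ (d, a)) = (\<Sum>d\<le>\<kappa>. U $$ (0, a) / t * W a d)"
      using a ne t by (intro sum.cong) (auto simp: \<eta> X)
    also have "\<dots> = 1 / t * \<eta> $ a" by (simp only: Wrow[OF a] \<eta>[OF a] sum_distrib_left[symmetric]) simp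
    finally show "(\<Sum>d\<le>\<kappa>. \<eta> $ d * X_mat \<kappa> T $$ (d, a)) = 1 / t * \<eta> $ a" .
  qed
  show "D_mat \<kappa> T (gamma_vec \<kappa> T) = D"
  proof (rule eq_matI)
    fix a c assume "a < dim_row D" "c < dim_col D"
    then have ac: "a \<le> \<kappa>" "c \<le> \<kappa>" using CD by auto
    \<comment> \<open>The ratio of \<open>T a l c\<close> and \<open>T a l 0\<close> is D(a,c)
      U(c,l) / (D(a,0) U(0,l)), and \<eta>_l = U(0,l) removes the last denominator that depends on
      l.\<close>
    have "(\<Sum>l\<le>\<kappa>. \<eta> $ l / T a l 0 * T a l c) = (\<Sum>l\<le>\<kappa>. D $$ (a, c) / D $$ (a, 0) * U $$ (c, l))"
      using ac ne by (intro sum.cong) (auto simp: \<eta> T)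
    also have "\<dots> = D $$ (a, c) / D $$ (a, 0)"
      by (simp only: markov_kernelD(3)[OF U ac(2)] sum_distrib_left[symmetric] mult_1_right)
    finally have 1: "(\<Sum>l\<le>\<kappa>. \<eta> $ l / T a l 0 * T a l c) = D $$ (a, c) / D $$ (a, 0)" .
    have "(\<Sum>b\<le>\<kappa>. \<eta> $ b / T a b 0) = (\<Sum>b\<le>\<kappa>. W a b / D $$ (a, 0))"
      using ac ne by (intro sum.cong) (auto simp: \<eta> T)
    also have "\<dots> = 1 / D $$ (a, 0)" using ac by (simp add: Wrow flip: sum_divide_distrib)
    finally have 2: "(\<Sum>b\<le>\<kappa>. \<eta> $ b / T a b 0) = 1 / D $$ (a, 0)" .
    show "D_mat \<kappa> T (gamma_vec \<kappa> T) $$ (a, c) = D $$ (a, c)"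
    proof -
      have "D_mat \<kappa> T \<eta> $$ (a, c) = (\<Sum>l\<le>\<kappa>. \<eta> $ l / T a l 0 * T a l c) / (\<Sum>b\<le>\<kappa>. \<eta> $ b / T a b 0)"
        using ac by (simp add: D_mat_def)
      also have "\<dots> = D $$ (a, c)" unfolding 1 2 using ac ne by simp
      finally show ?thesis unfolding \<gamma> .
    qed
  qed (use CD in \<open>auto simp: D_mat_def\<close>)
  show "U_mat \<kappa> T (gamma_vec \<kappa> T) = U"
  proof (rule eq_matI)
    fix c b assume "c < dim_row U" "b < dim_col U"
    then have cb: "c \<le> \<kappa>" "b \<le> \<kappa>" using CU by auto
    have 1: "\<eta> $ b / T 0 b 0 * T 0 b c = D $$ (0, c) / D $$ (0, 0) * U $$ (c, b)" if "b \<le> \<kappa>" for b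
      using cb that ne by (simp add: \<eta> T)
    have 2: "(\<Sum>b\<le>\<kappa>. \<eta> $ b / T 0 b 0 * T 0 b c) = D $$ (0, c) / D $$ (0, 0)"
    proof -
      have "(\<Sum>b\<le>\<kappa>. \<eta> $ b / T 0 b 0 * T 0 b c) = (\<Sum>b\<le>\<kappa>. D $$ (0, c) / D $$ (0, 0) * U $$ (c, b))"
        using 1 by (intro sum.cong) auto
      then show ?thesis by (simp only: markov_kernelD(3)[OF U cb(1)] sum_distrib_left[symmetric] mult_1_right)
    qed
    have "U_mat \<kappa> T \<eta> $$ (c, b) = (\<eta> $ b / T 0 b 0 * T 0 b c) / (\<Sum>b\<le>\<kappa>. \<eta> $ b / T 0 b 0 * T 0 b c)"
      using cb by (simp add: U_mat_def)
    also have "\<dots> = U $$ (c, b)" unfolding 2 1[OF cb(2)] using cb ne by simp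
    finally show "U_mat \<kappa> T (gamma_vec \<kappa> T) $$ (c, b) = U $$ (c, b)" unfolding \<gamma> .
  qed (use CU in \<open>auto simp: U_mat_def\<close>)
  have \<rho>: "\<rho> \<in> carrier_vec (\<kappa> + 1)" "(\<Sum>i\<le>\<kappa>. \<rho> $ i) = 1"
    using \<rho>D by (simp_all add: invariant_dist_def prob_vec_def)
  have \<rho>p: "0 < \<rho> $ i" if "i \<le> \<kappa>" for i
    using invariant_dist_pos[OF CD _ \<rho>D that] Dp by blast
  have \<rho>W: "(\<Sum>a\<le>\<kappa>. \<rho> $ a * W a d) = \<rho> $ d" if "d \<le> \<kappa>" for d
    using invariant_dist_mult[OF CD CU \<rho>D \<rho>U] that
    unfolding W_def invariant_dist_iff[OF mult_carrier_mat[OF CD CU]] by blast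
  \<comment> \<open>Dividing by \<eta> = \<gamma> makes the product with \<gamma> return \<rho>; the
    right eigen-equation of X is then \<rho> W = \<rho>.\<close>
  define \<mu> where "\<mu> = Matrix.vec (\<kappa> + 1) (\<lambda>i. \<rho> $ i / U $$ (0, i))"
  have \<mu>C: "\<mu> \<in> carrier_vec (\<kappa> + 1)" and \<mu>: "\<And>i. i \<le> \<kappa> \<Longrightarrow> \<mu> $ i = \<rho> $ i / U $$ (0, i)"
    by (auto simp: \<mu>_def)
  have "mu_vec \<kappa> T = \<mu>"
  proof (rule mu_vec_eqI[OF \<mu>C, where r = "1 / t"])
    show "0 < \<mu> $ i" if "i \<le> \<kappa>" for i using that \<rho>p Up by (simp add: \<mu>)
    show "(\<Sum>i\<le>\<kappa>. gamma_vec \<kappa> T $ i * \<mu> $ i) = 1" using \<rho> ne by (simp add: \<gamma> \<eta> \<mu>)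
    fix d assume d: "d \<le> \<kappa>"
    have "(\<Sum>a\<le>\<kappa>. X_mat \<kappa> T $$ (d, a) * \<mu> $ a) = (\<Sum>a\<le>\<kappa>. 1 / (t * U $$ (0, d)) * (\<rho> $ a * W a d))"
      using d ne by (intro sum.cong) (auto simp: X \<mu>)
    also have "\<dots> = 1 / t * \<mu> $ d" by (simp only: \<rho>W[OF d] \<mu>[OF d] sum_distrib_left[symmetric]) simp
    finally show "(\<Sum>a\<le>\<kappa>. X_mat \<kappa> T $$ (d, a) * \<mu> $ a) = 1 / t * \<mu> $ d" .
  qed
  then show "pointwise_prod \<kappa> (gamma_vec \<kappa> T) (mu_vec \<kappa> T) = \<rho>"
    using \<rho>(1) ne by (intro eq_vecI) (auto simp: pointwise_prod_def \<gamma> \<eta> \<mu> less_Suc_eq_le)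
qed

end

section \<open>From condition (1) to the factorization; the case of two states\<close>

context positive_pca
begin

text \<open>Condition (1) splits the ratio of \<open>T a l c\<close> and \<open>T a l 0\<close> into
  a function of (a,c) and one of (l,c). Hence D(a,c) contains as a factor the normalising sum of row
  c of U, and it cancels in D(a,c) U(c,b). The eigen-equation of \<gamma> enters in the last
  conclusion, where it makes the diagonal of D U proportional to \<nu>.\<close>

lemma separable_D_U:
  assumes sep: separable
  defines "\<gamma> \<equiv> gamma_vec \<kappa> T"
  defines "D \<equiv> D_mat \<kappa> T \<gamma>" and "U \<equiv> U_mat \<kappa> T \<gamma>"
  shows "markov_kernel \<kappa> D" and "markov_kernel \<kappa> U"
    and "\<forall>i\<le>\<kappa>. \<forall>j\<le>\<kappa>. 0 < D $$ (i, j)" and "\<forall>i\<le>\<kappa>. \<forall>j\<le>\<kappa>. 0 < U $$ (i, j)"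
    and "\<forall>a\<le>\<kappa>. \<forall>b\<le>\<kappa>. \<forall>c\<le>\<kappa>. T a b c * (D * U) $$ (a, b) = D $$ (a, c) * U $$ (c, b)"
    and "\<And>i. i \<le> \<kappa> \<Longrightarrow> (D * U) $$ (i, i) = (U * D) $$ (i, i)"
proof -
  obtain r where "\<gamma> \<in> carrier_vec (\<kappa> + 1)" and \<gamma>: "\<And>i. i \<le> \<kappa> \<Longrightarrow> 0 < \<gamma> $ i"
    and "(\<Sum>i\<le>\<kappa>. \<gamma> $ i) = 1"
    and \<gamma>X: "\<And>a. a \<le> \<kappa> \<Longrightarrow> (\<Sum>d\<le>\<kappa>. \<gamma> $ d * X_mat \<kappa> T $$ (d, a)) = r * \<gamma> $ a"
    by (rule gamma_vec[folded \<gamma>_def]) (rule that)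
  define Z where "Z a = (\<Sum>b\<le>\<kappa>. \<gamma> $ b / T a b 0)" for a
  define B where "B c = (\<Sum>b\<le>\<kappa>. \<gamma> $ b / T 0 b 0 * T 0 b c)" for c
  have Z: "0 < Z a" if "a \<le> \<kappa>" for a unfolding Z_def using that \<gamma> by (intro sum_pos) auto
  have B: "0 < B c" if "c \<le> \<kappa>" for c unfolding B_def using that \<gamma> by (intro sum_pos) auto
  have Tne: "T a b c \<noteq> 0" if "a \<le> \<kappa>" "b \<le> \<kappa>" "c \<le> \<kappa>" for a b c using T_pos[OF that] by simp
  have sep': "T a l c / T a l 0 = T 0 0 0 * T a 0 c / (T a 0 0 * T 0 0 c) * (T 0 l c / T 0 l 0)"
    if "a \<le> \<kappa>" "l \<le> \<kappa>" "c \<le> \<kappa>" for a l c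
  proof -
    have "T a l c = (T 0 0 0 * T a l 0 * T a 0 c * T 0 l c) / (T a 0 0 * T 0 l 0 * T 0 0 c)"
      using sep that unfolding separable_def by blast
    then show ?thesis using Tne[OF that(1,2), of 0] by (simp add: mult_ac)
  qed
  have CD: "D \<in> carrier_mat (\<kappa> + 1) (\<kappa> + 1)" and CU: "U \<in> carrier_mat (\<kappa> + 1) (\<kappa> + 1)"
    by (simp_all add: D_def D_mat_def U_def U_mat_def)
  have D0: "D $$ (a, c) = (\<Sum>l\<le>\<kappa>. \<gamma> $ l / T a l 0 * T a l c) / Z a" if "a \<le> \<kappa>" "c \<le> \<kappa>" for a c
    using that by (simp add: D_def D_mat_def Z_def)
  \<comment> \<open>The l-dependent part of the split ratio, weighted by \<gamma> and summed, is
    exactly \<open>B c\<close>.\<close>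
  have Dix: "D $$ (a, c) = T 0 0 0 * T a 0 c / (T a 0 0 * T 0 0 c) * B c / Z a" if "a \<le> \<kappa>" "c \<le> \<kappa>" for a c
  proof -
    have "(\<Sum>l\<le>\<kappa>. \<gamma> $ l / T a l 0 * T a l c) =
        (\<Sum>l\<le>\<kappa>. T 0 0 0 * T a 0 c / (T a 0 0 * T 0 0 c) * (\<gamma> $ l / T 0 l 0 * T 0 l c))"
    proof (rule sum.cong[OF refl])
      fix l assume "l \<in> {..\<kappa>}"
      then have l: "l \<le> \<kappa>" by simp
      have "\<gamma> $ l / T a l 0 * T a l c = \<gamma> $ l * (T a l c / T a l 0)" by simp
      also have "\<dots> = T 0 0 0 * T a 0 c / (T a 0 0 * T 0 0 c) * (\<gamma> $ l / T 0 l 0 * T 0 l c)"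
        unfolding sep'[OF that(1) l that(2)] by simp
      finally show "\<gamma> $ l / T a l 0 * T a l c = T 0 0 0 * T a 0 c / (T a 0 0 * T 0 0 c) * (\<gamma> $ l / T 0 l 0 * T 0 l c)" .
    qed
    also have "\<dots> = T 0 0 0 * T a 0 c / (T a 0 0 * T 0 0 c) * B c"
      unfolding B_def by (simp only: sum_distrib_left)
    finally show ?thesis using D0[OF that] by simp
  qed
  have Uix: "U $$ (c, b) = (\<gamma> $ b / T 0 b 0 * T 0 b c) / B c" if "c \<le> \<kappa>" "b \<le> \<kappa>" for c b
    using that by (simp add: U_def U_mat_def B_def)
  show Dp: "\<forall>i\<le>\<kappa>. \<forall>j\<le>\<kappa>. 0 < D $$ (i, j)"
    using B Z by (simp add: Dix)
  show Up: "\<forall>i\<le>\<kappa>. \<forall>j\<le>\<kappa>. 0 < U $$ (i, j)"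
    using B \<gamma> by (simp add: Uix)
  have "(\<Sum>c\<le>\<kappa>. D $$ (a, c)) = 1" if a: "a \<le> \<kappa>" for a
  proof -
    have "(\<Sum>c\<le>\<kappa>. \<Sum>l\<le>\<kappa>. \<gamma> $ l / T a l 0 * T a l c) = (\<Sum>l\<le>\<kappa>. \<gamma> $ l / T a l 0 * (\<Sum>c\<le>\<kappa>. T a l c))"
      by (subst sum.swap) (simp only: sum_distrib_left)
    also have "\<dots> = Z a" using a by (simp add: T_sum Z_def)
    finally have "(\<Sum>c\<le>\<kappa>. \<Sum>l\<le>\<kappa>. \<gamma> $ l / T a l 0 * T a l c) / Z a = 1" using Z[OF a] by simp
    then show ?thesis using a by (simp add: D0 sum_divide_distrib)
  qed
  with CD Dp show "markov_kernel \<kappa> D" by (simp add: markov_kernel_def less_imp_le)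
  have "(\<Sum>b\<le>\<kappa>. U $$ (c, b)) = 1" if c: "c \<le> \<kappa>" for c
  proof -
    have "(\<Sum>b\<le>\<kappa>. U $$ (c, b)) = (\<Sum>b\<le>\<kappa>. \<gamma> $ b / T 0 b 0 * T 0 b c) / B c"
      using c by (simp add: Uix sum_divide_distrib)
    then show ?thesis using B[OF c] unfolding B_def by simp
  qed
  with CU Up show "markov_kernel \<kappa> U" by (simp add: markov_kernel_def less_imp_le)
  have prod: "D $$ (a, c) * U $$ (c, b) = T a b c * (\<gamma> $ b / (T a b 0 * Z a))"
    if "a \<le> \<kappa>" "b \<le> \<kappa>" "c \<le> \<kappa>" for a b c
  proof -
    have "D $$ (a, c) * U $$ (c, b) =
        (T 0 0 0 * T a 0 c / (T a 0 0 * T 0 0 c) * (T 0 b c / T 0 b 0)) * (\<gamma> $ b / Z a)"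
      using that B[OF that(3)] by (simp add: Dix Uix mult_ac)
    also have "\<dots> = T a b c / T a b 0 * (\<gamma> $ b / Z a)"
      by (simp only: sep'[OF that])
    finally show ?thesis by simp
  qed
  have DU: "(D * U) $$ (a, b) = \<gamma> $ b / (T a b 0 * Z a)" if "a \<le> \<kappa>" "b \<le> \<kappa>" for a b
  proof -
    have "(D * U) $$ (a, b) = (\<Sum>c\<le>\<kappa>. T a b c * (\<gamma> $ b / (T a b 0 * Z a)))"
      unfolding mult_mat_index[OF CD CU that] using that by (intro sum.cong) (auto simp: prod)
    then show ?thesis using that by (simp only: sum_distrib_right[symmetric] T_sum mult_1_left)
  qed
  show fact: "\<forall>a\<le>\<kappa>. \<forall>b\<le>\<kappa>. \<forall>c\<le>\<kappa>. T a b c * (D * U) $$ (a, b) = D $$ (a, c) * U $$ (c, b)"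
    using prod DU by simp
  have r: "0 < r"
  proof -
    have "0 < (\<Sum>d\<le>\<kappa>. \<gamma> $ d * X_mat \<kappa> T $$ (d, 0))" using \<gamma> X_mat_pos by (intro sum_pos) auto
    then show ?thesis using \<gamma>[of 0] by (simp add: \<gamma>X zero_less_mult_iff)
  qed
  \<comment> \<open>The eigen-equation at i reads r \<gamma>_i = \<open>T i i 0\<close> \<nu>_i
    \<open>Z i\<close>, to be inserted in the closed form of the diagonal entry given by
    \<open>DU\<close>.\<close>
  have diag: "(D * U) $$ (i, i) = nu_vec \<kappa> T $ i / r" if i: "i \<le> \<kappa>" for i
  proof -
    have "r * \<gamma> $ i = (\<Sum>d\<le>\<kappa>. T i i 0 * nu_vec \<kappa> T $ i * (\<gamma> $ d / T i d 0))"
      unfolding \<gamma>X[OF i, symmetric] using i by (intro sum.cong) (auto simp: X_mat_index)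
    also have "\<dots> = T i i 0 * nu_vec \<kappa> T $ i * Z i" unfolding Z_def by (simp only: sum_distrib_left)
    finally show ?thesis using i r Z[OF i] Tne[OF i i, of 0] by (simp add: DU field_simps)
  qed
  show "(D * U) $$ (j, j) = (U * D) $$ (j, j)" if j: "j \<le> \<kappa>" for j
  proof -
    \<comment> \<open>The factorization gives U(j,i) D(i,j) = \<open>T i i j\<close> (D U)(i,i), so
      the invariance of \<nu> under Y transfers to the two diagonals.\<close>
    have "(U * D) $$ (j, j) = (\<Sum>i\<le>\<kappa>. T i i j * (D * U) $$ (i, i))"
      unfolding mult_mat_index[OF CU CD j j] using j fact by (intro sum.cong) auto
    also have "\<dots> = (\<Sum>i\<le>\<kappa>. nu_vec \<kappa> T $ i * T i i j) / r"
      unfolding sum_divide_distrib by (intro sum.cong) (auto simp: diag simp del: index_mult_mat)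
    also have "\<dots> = (D * U) $$ (j, j)" unfolding nu_vec_invariant[OF j] diag[OF j] ..
    finally show ?thesis ..
  qed
qed

text \<open>Commutation makes the invariant distribution of D invariant under U. It is obtained
  abstractly here; \<open>zigzag_factorizationD\<close> identifies it in terms of \<gamma> and
  \<mu>.\<close>

lemma zigzag_factorizationI:
  assumes sep: separable
    and comm: "D_mat \<kappa> T (gamma_vec \<kappa> T) * U_mat \<kappa> T (gamma_vec \<kappa> T) =
      U_mat \<kappa> T (gamma_vec \<kappa> T) * D_mat \<kappa> T (gamma_vec \<kappa> T)"
  obtains \<rho> where "zigzag_factorization (D_mat \<kappa> T (gamma_vec \<kappa> T)) (U_mat \<kappa> T (gamma_vec \<kappa> T)) \<rho>"
proof -
  note S = separable_D_U[OF sep]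
  obtain \<rho> where D\<rho>: "invariant_dist \<kappa> (D_mat \<kappa> T (gamma_vec \<kappa> T)) \<rho>"
    using invariant_dist_iff_perron[OF S(1) S(3)] by blast
  have "invariant_dist \<kappa> (U_mat \<kappa> T (gamma_vec \<kappa> T)) \<rho>"
    by (rule invariant_dist_commute[OF S(1,2,3) comm D\<rho>])
  with D\<rho> show ?thesis using that S comm unfolding zigzag_factorization_def by blast
qed

lemma zigzag_factorization_kernels:
  assumes Z: "zigzag_factorization D U \<rho>" and K: "K \<in> {D, U, D * U, U * D}"
  shows "markov_kernel \<kappa> K \<and> (\<forall>\<eta>. invariant_dist \<kappa> K \<eta> \<longleftrightarrow> \<eta> = \<rho>)"
proof -
  have D: "markov_kernel \<kappa> D" and U: "markov_kernel \<kappa> U"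
    and Dp: "\<forall>i\<le>\<kappa>. \<forall>j\<le>\<kappa>. 0 < D $$ (i, j)" and Up: "\<forall>i\<le>\<kappa>. \<forall>j\<le>\<kappa>. 0 < U $$ (i, j)"
    and comm: "D * U = U * D" and \<rho>: "invariant_dist \<kappa> D \<rho>" "invariant_dist \<kappa> U \<rho>"
    using Z unfolding zigzag_factorization_def by blast+
  have mult_pos: "\<forall>i\<le>\<kappa>. \<forall>j\<le>\<kappa>. 0 < (A * B) $$ (i, j)"
    if "markov_kernel \<kappa> A" "markov_kernel \<kappa> B" "\<forall>i\<le>\<kappa>. \<forall>j\<le>\<kappa>. 0 < A $$ (i, j)" "\<forall>i\<le>\<kappa>. \<forall>j\<le>\<kappa>. 0 < B $$ (i, j)"
    for A B
    using that(3,4) mult_mat_index[OF markov_kernelD(1)[OF that(1)] markov_kernelD(1)[OF that(2)]]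
    by (auto intro!: sum_pos simp del: index_mult_mat)
  have *: "markov_kernel \<kappa> L \<and> (\<forall>\<eta>. invariant_dist \<kappa> L \<eta> \<longleftrightarrow> \<eta> = \<rho>)"
    if L: "markov_kernel \<kappa> L" "\<forall>i\<le>\<kappa>. \<forall>j\<le>\<kappa>. 0 < L $$ (i, j)" "invariant_dist \<kappa> L \<rho>" for L
    using L(1,3) invariant_dist_iff_perron[OF L(1,2)] by simp
  have "markov_kernel \<kappa> (D * U) \<and> (\<forall>\<eta>. invariant_dist \<kappa> (D * U) \<eta> \<longleftrightarrow> \<eta> = \<rho>)"
    by (intro * markov_kernel_mult D U mult_pos Dp Up invariant_dist_mult \<rho> markov_kernelD(1))
  then show ?thesis using K *[OF D Dp \<rho>(1)] *[OF U Up \<rho>(2)] comm by auto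
qed

text \<open>A stochastic 2 x 2 matrix is determined by its diagonal.\<close>

lemma separable_commute_two_states:
  assumes \<kappa>: "\<kappa> = 1" and sep: separable
  shows "D_mat \<kappa> T (gamma_vec \<kappa> T) * U_mat \<kappa> T (gamma_vec \<kappa> T) =
    U_mat \<kappa> T (gamma_vec \<kappa> T) * D_mat \<kappa> T (gamma_vec \<kappa> T)" (is "?A = ?B")
proof -
  note S = separable_D_U[OF sep]
  have A: "markov_kernel \<kappa> ?A" and B: "markov_kernel \<kappa> ?B" by (intro markov_kernel_mult S)+
  have row: "K $$ (i, 0) + K $$ (i, 1) = 1" if "markov_kernel \<kappa> K" "i \<le> 1" for K i
    using markov_kernelD(3)[OF that(1), of i] that(2) \<kappa> by simp
  have eq: "?A $$ (i, j) = ?B $$ (i, j)" if ij: "i \<le> 1" "j \<le> 1" for i j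
  proof -
    from ij have "(i = 0 \<or> i = 1) \<and> (j = 0 \<or> j = 1)" by auto
    then show ?thesis
      using row[OF A, of 0] row[OF A, of 1] row[OF B, of 0] row[OF B, of 1] S(6)[of 0] S(6)[of 1] \<kappa>
      by (auto simp del: index_mult_mat)
  qed
  have "dim_row ?A = 2" "dim_col ?A = 2" "dim_row ?B = 2" "dim_col ?B = 2"
    using markov_kernelD(1)[OF A] markov_kernelD(1)[OF B] \<kappa> by auto
  then show ?thesis using eq by (intro eq_matI) (simp_all del: index_mult_mat)
qed

text \<open>With a zero among a, b, c the equation of condition (1) is an identity, so only a = b =
  c = 1 carries information.\<close>

lemma separable_two_states_iff:
  assumes \<kappa>: "\<kappa> = 1"
  shows "separable \<longleftrightarrow> T 0 0 0 * T 1 1 0 * T 1 0 1 * T 0 1 1 = T 1 1 1 * T 0 0 1 * T 0 1 0 * T 1 0 0"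
proof -
  have ne: "T a b c \<noteq> 0" if "a \<le> 1" "b \<le> 1" "c \<le> 1" for a b c
    using T_pos that \<kappa> by (metis less_irrefl)
  define R where "R a b c = (T 0 0 0 * T a b 0 * T a 0 c * T 0 b c) / (T a 0 0 * T 0 b 0 * T 0 0 c)" for a b c
  have triv: "T a b c = R a b c" if "a \<le> 1" "b \<le> 1" "c \<le> 1" "a = 0 \<or> b = 0 \<or> c = 0" for a b c
    using that(4,1-3) by (elim disjE) (simp_all add: R_def ne)
  have "separable \<longleftrightarrow> (\<forall>a\<le>1. \<forall>b\<le>1. \<forall>c\<le>1. T a b c = R a b c)"
    unfolding separable_def R_def using \<kappa> by simp
  also have "\<dots> \<longleftrightarrow> T 1 1 1 = R 1 1 1"
  proof
    assume eq: "T 1 1 1 = R 1 1 1"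
    have "T a b c = R a b c" if abc: "a \<le> 1" "b \<le> 1" "c \<le> 1" for a b c
    proof (cases "a = 0 \<or> b = 0 \<or> c = 0")
      case False
      then have "a = 1" "b = 1" "c = 1" using abc by auto
      then show ?thesis using eq by simp
    qed (rule triv[OF abc])
    then show "\<forall>a\<le>1. \<forall>b\<le>1. \<forall>c\<le>1. T a b c = R a b c" by blast
  qed simp
  also have "\<dots> \<longleftrightarrow> T 1 1 1 * (T 1 0 0 * T 0 1 0 * T 0 0 1) = T 0 0 0 * T 1 1 0 * T 1 0 1 * T 0 1 1"
    unfolding R_def by (rule eq_divide_eq[THEN trans]) (simp add: ne)
  also have "\<dots> \<longleftrightarrow> T 0 0 0 * T 1 1 0 * T 1 0 1 * T 0 1 1 = T 1 1 1 * T 0 0 1 * T 0 1 0 * T 1 0 0"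
    by (auto simp only: mult_ac)
  finally show ?thesis .
qed

end

section \<open>Laws on the zigzag and their cylinders\<close>

text \<open>\<open>F\<close> enlarges a finite index set to a convenient one, such as a full window.
  A cylinder over J is a finite disjoint union of cylinders fixing every coordinate in
  \<open>F J\<close>, so agreement on the latter suffices.\<close>

lemma PiM_count_space_eqI:
  fixes S :: "'a set" and P Q :: "('i \<Rightarrow> 'a) measure"
  assumes S: "finite S"
    and sP: "sets P = sets (PiM UNIV (\<lambda>_. count_space S))"
    and sQ: "sets Q = sets (PiM UNIV (\<lambda>_. count_space S))"
    and P: "finite_measure P"
    and F: "\<And>J. finite J \<Longrightarrow> finite (F J)" "\<And>J. finite J \<Longrightarrow> J \<subseteq> F J"
    and eq: "\<And>J x. finite J \<Longrightarrow> x \<in> Pi\<^sub>E (F J) (\<lambda>_. S) \<Longrightarrow>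
      emeasure P {\<omega> \<in> space P. \<forall>k\<in>F J. \<omega> k = x k} = emeasure Q {\<omega> \<in> space Q. \<forall>k\<in>F J. \<omega> k = x k}"
  shows "P = Q"
proof (rule measure_eqI_PiM_infinite[OF sP sQ _ P])
  fix A and J :: "'i set"
  assume J: "finite J" and A: "\<And>i. i \<in> J \<Longrightarrow> A i \<in> sets (count_space S)"
  let ?M = "\<lambda>_::'i. count_space S"
  let ?E = "prod_emb UNIV ?M J (Pi\<^sub>E J A)"
  define K where "K = F J"
  have K: "finite K" "J \<subseteq> K" unfolding K_def using F[OF J] by auto
  note eqK = eq[OF J, folded K_def]
  define X where "X = {x \<in> Pi\<^sub>E K (\<lambda>_. S). \<forall>j\<in>J. x j \<in> A j}"
  have X': "X \<subseteq> Pi\<^sub>E K (\<lambda>_. S)" by (simp add: X_def)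
  then have X: "finite X" "X \<subseteq> Pi\<^sub>E K (\<lambda>_. S)"
    using finite_subset[OF X' finite_PiE[OF K(1) S]] by simp_all
  have sp: "space R = Pi\<^sub>E UNIV (\<lambda>_. S)" if "sets R = sets (PiM UNIV ?M)" for R
    using sets_eq_imp_space_eq[OF that] by (simp add: space_PiM)
  have sum: "emeasure R ?E = (\<Sum>x\<in>X. emeasure R {\<omega> \<in> space R. \<forall>k\<in>K. \<omega> k = x k})"
    if R: "sets R = sets (PiM UNIV ?M)" for R
  proof -
    have "?E = (\<Union>x\<in>X. {\<omega> \<in> space R. \<forall>k\<in>K. \<omega> k = x k})" (is "_ = ?U")
    proof (rule Set.set_eqI)
      fix \<omega>
      have "\<omega> \<in> ?E \<longleftrightarrow> \<omega> \<in> space R \<and> (\<forall>j\<in>J. \<omega> j \<in> A j)"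
        unfolding sp[OF R] by (auto simp: prod_emb_iff PiE_iff)
      also have "\<dots> \<longleftrightarrow> \<omega> \<in> ?U"
      proof
        assume \<omega>: "\<omega> \<in> space R \<and> (\<forall>j\<in>J. \<omega> j \<in> A j)"
        then have "restrict \<omega> K \<in> X" using K(2) unfolding sp[OF R] X_def by (auto simp: PiE_iff)
        with \<omega> show "\<omega> \<in> ?U" by (intro UN_I[of "restrict \<omega> K"]) auto
      next
        assume "\<omega> \<in> ?U"
        then show "\<omega> \<in> space R \<and> (\<forall>j\<in>J. \<omega> j \<in> A j)" using K(2) unfolding X_def by force
      qed
      finally show "\<omega> \<in> ?E \<longleftrightarrow> \<omega> \<in> ?U" .
    qed
    also have "emeasure R ?U = (\<Sum>x\<in>X. emeasure R {\<omega> \<in> space R. \<forall>k\<in>K. \<omega> k = x k})"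
    proof (rule sum_emeasure[symmetric])
      show "(\<lambda>x. {\<omega> \<in> space R. \<forall>k\<in>K. \<omega> k = x k}) ` X \<subseteq> sets R"
      proof safe
        fix x assume x: "x \<in> X"
        have "{\<omega> \<in> space R. \<forall>k\<in>K. \<omega> k = x k} = prod_emb UNIV ?M K (Pi\<^sub>E K (\<lambda>k. {x k}))"
          unfolding sp[OF R] by (auto simp: prod_emb_iff PiE_iff)
        also have "\<dots> \<in> sets (PiM UNIV ?M)"
          using x K X(2) by (intro sets_PiM_I) (auto simp: PiE_iff)
        finally show "{\<omega> \<in> space R. \<forall>k\<in>K. \<omega> k = x k} \<in> sets R" using R by simp
      qed
      show "disjoint_family_on (\<lambda>x. {\<omega> \<in> space R. \<forall>k\<in>K. \<omega> k = x k}) X"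
        unfolding disjoint_family_on_def
      proof (intro ballI impI)
        fix x y assume xy: "x \<in> X" "y \<in> X" "x \<noteq> y"
        then have "x \<in> Pi\<^sub>E K (\<lambda>_. S)" "y \<in> Pi\<^sub>E K (\<lambda>_. S)" using X(2) by blast+
        with xy(3) obtain k where "k \<in> K" "x k \<noteq> y k" by (metis PiE_ext)
        then show "{\<omega> \<in> space R. \<forall>k\<in>K. \<omega> k = x k} \<inter> {\<omega> \<in> space R. \<forall>k\<in>K. \<omega> k = y k} = {}" by force
      qed
    qed (fact X)
    finally show ?thesis .
  qed
  show "emeasure P ?E = emeasure Q ?E"
    unfolding sum[OF sP] sum[OF sQ] by (rule sum.cong[OF refl eqK]) (use X(2) in blast)
qed

lemma space_line_space: "space (line_space \<kappa>) = Pi\<^sub>E UNIV (\<lambda>_. {..\<kappa>})"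
  by (simp add: line_space_def space_PiM)

lemma space_HZ_space: "space (HZ_space \<kappa>) = space (line_space \<kappa>) \<times> space (line_space \<kappa>)"
  by (simp add: HZ_space_def space_pair_measure)

lemma measurable_line_coordinate [measurable]:
  "(\<lambda>s. s x) \<in> measurable (line_space \<kappa>) (count_space {..\<kappa>})"
  unfolding line_space_def by (rule measurable_component_singleton) simp

text \<open>Taken inside \<open>HZ_space\<close> instead of the space of a particular law, so that
  the same set can be measured under a law and under its image.\<close>

definition window :: "nat \<Rightarrow> int \<Rightarrow> nat \<Rightarrow> (nat \<Rightarrow> nat) \<Rightarrow> (nat \<Rightarrow> nat) \<Rightarrow> ((int \<Rightarrow> nat) \<times> (int \<Rightarrow> nat)) set" where
  "window \<kappa> i0 n a b =
     {(s0, s1) \<in> space (HZ_space \<kappa>). \<forall>i\<le>n. s0 (i0 + int i) = a i \<and> s1 (i0 + int i) = b i}"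

lemma measurable_fst_coordinate [measurable]:
  "(\<lambda>s. fst s x) \<in> measurable (HZ_space \<kappa>) (count_space {..\<kappa>})"
  unfolding HZ_space_def by measurable

lemma measurable_snd_coordinate [measurable]:
  "(\<lambda>s. snd s x) \<in> measurable (HZ_space \<kappa>) (count_space {..\<kappa>})"
  unfolding HZ_space_def by measurable

lemma coordinate_eq_sets:
  assumes f: "f \<in> measurable M (count_space {..\<kappa>::nat})"
  shows "{\<omega> \<in> space M. f \<omega> = c} \<in> sets M"
proof (cases "c \<le> \<kappa>")
  case True
  then have "f -` {c} \<inter> space M \<in> sets M" by (intro measurable_sets[OF f]) auto
  also have "f -` {c} \<inter> space M = {\<omega> \<in> space M. f \<omega> = c}" by auto
  finally show ?thesis .
next
  case False
  have "f \<omega> \<le> \<kappa>" if "\<omega> \<in> space M" for \<omega> using measurable_space[OF f that] by simp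
  with False have "{\<omega> \<in> space M. f \<omega> = c} = {}" by auto
  then show ?thesis by (simp only: sets.empty_sets)
qed

lemma window_sets: "window \<kappa> i0 n a b \<in> sets (HZ_space \<kappa>)"
proof -
  have "window \<kappa> i0 n a b = (\<Inter>i\<in>{..n}. {s \<in> space (HZ_space \<kappa>). fst s (i0 + int i) = a i} \<inter>
      {s \<in> space (HZ_space \<kappa>). snd s (i0 + int i) = b i})"
    unfolding window_def by auto
  also have "\<dots> \<in> sets (HZ_space \<kappa>)"
    by (intro sets.finite_INT sets.Int coordinate_eq_sets[OF measurable_fst_coordinate]
        coordinate_eq_sets[OF measurable_snd_coordinate]) auto
  finally show ?thesis .
qed

lemma HZ_lawD:
  assumes "HZ_law \<kappa> m"
  shows "prob_space m" "sets m = sets (HZ_space \<kappa>)" "space m = space (HZ_space \<kappa>)"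
  using assms sets_eq_imp_space_eq unfolding HZ_law_def by blast+

text \<open>The two lines are merged into one process indexed by site and line, to which the
  cylinder criterion applies; every finite index set lies in a symmetric window.\<close>

lemma HZ_law_eqI:
  assumes m: "HZ_law \<kappa> m" and m': "HZ_law \<kappa> m'"
    and eq: "\<And>i0 n a b. (\<And>i. i \<le> n \<Longrightarrow> a i \<le> \<kappa> \<and> b i \<le> \<kappa>) \<Longrightarrow>
      measure m (window \<kappa> i0 n a b) = measure m' (window \<kappa> i0 n a b)"
  shows "m = m'"
proof -
  let ?S = "PiM UNIV (\<lambda>_::int \<times> bool. count_space {..\<kappa>})"
  define f where "f = (\<lambda>s (i::int, k). if k then snd s i else fst s i :: nat)"
  define g where "g = (\<lambda>\<omega>. (\<lambda>i::int. \<omega> (i, False) :: nat, \<lambda>i. \<omega> (i, True)))"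
  have f: "f \<in> measurable (HZ_space \<kappa>) ?S"
    unfolding f_def
  proof (rule measurable_PiM_single')
    fix p :: "int \<times> bool"
    show "(\<lambda>s. (\<lambda>(i, k). if k then snd s i else fst s i) p) \<in> measurable (HZ_space \<kappa>) (count_space {..\<kappa>})"
      by (cases p; cases "snd p") auto
  qed (auto simp: space_HZ_space space_line_space PiE_iff)
  have g: "g \<in> measurable ?S (HZ_space \<kappa>)"
    unfolding g_def HZ_space_def line_space_def
    by (intro measurable_Pair measurable_PiM_single') (auto simp: space_PiM PiE_iff)
  have fg: "distr (distr p ?S f) (HZ_space \<kappa>) g = p" if p: "HZ_law \<kappa> p" for p
  proof -
    note p = HZ_lawD[OF p]
    have "distr (distr p ?S f) (HZ_space \<kappa>) g = distr p (HZ_space \<kappa>) (g \<circ> f)"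
      by (rule distr_distr[OF g]) (use f p in \<open>simp cong: measurable_cong_sets\<close>)
    also have "g \<circ> f = (\<lambda>s. s)" by (auto simp: g_def f_def fun_eq_iff)
    also have "distr p (HZ_space \<kappa>) (\<lambda>s. s) = p" using p(2) by (intro distr_id2) simp
    finally show ?thesis .
  qed
  have "distr m ?S f = distr m' ?S f"
  proof -
    \<comment> \<open>The largest distance from 0 of a site in J; the inserted 0 covers the empty
      set.\<close>
    define N where "N J = Max (insert 0 ((\<lambda>p. nat \<bar>fst p\<bar>) ` J))" for J :: "(int \<times> bool) set"
    define F where "F J = {- int (N J)..int (N J)} \<times> (UNIV :: bool set)" for J
    have F: "finite (F J)" "J \<subseteq> F J" if J: "finite J" for J
    proof -
      have "\<bar>i\<bar> \<le> int (N J)" if "(i, k) \<in> J" for i k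
      proof -
        have "nat \<bar>fst (i, k)\<bar> \<le> N J" unfolding N_def by (rule Max_ge) (use that J in blast)+
        then show ?thesis by simp
      qed
      then show "finite (F J)" "J \<subseteq> F J" unfolding F_def by fastforce+
    qed
    \<comment> \<open>The sites -N, ..., N are the 2 N + 1 columns, numbered 0 to 2 N, of a window
      starting at -N.\<close>
    have em: "emeasure (distr p ?S f) {\<omega> \<in> space (distr p ?S f). \<forall>k\<in>{- int N..int N} \<times> UNIV. \<omega> k = x k} =
        ennreal (measure p (window \<kappa> (- int N) (2 * N) (\<lambda>i. x (int i - int N, False)) (\<lambda>i. x (int i - int N, True))))"
      (is "_ = ennreal (measure p ?W)")
      if p: "HZ_law \<kappa> p" and x: "x \<in> Pi\<^sub>E ({- int N..int N} \<times> UNIV) (\<lambda>_. {..\<kappa>})" for p x N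
    proof -
      let ?K = "{- int N..int N} \<times> (UNIV :: bool set)"
      note p = HZ_lawD[OF p]
      interpret prob_space p by (fact p)
      have fm: "f \<in> measurable p ?S" using f p(2) by (simp cong: measurable_cong_sets)
      have "{\<omega> \<in> space ?S. \<forall>k\<in>?K. \<omega> k = x k} = prod_emb UNIV (\<lambda>_. count_space {..\<kappa>}) ?K (Pi\<^sub>E ?K (\<lambda>k. {x k}))"
        by (auto simp: prod_emb_iff PiE_iff space_PiM)
      also have "\<dots> \<in> sets ?S" using x by (intro sets_PiM_I) (auto simp: PiE_iff)
      finally have "emeasure (distr p ?S f) {\<omega> \<in> space ?S. \<forall>k\<in>?K. \<omega> k = x k} =
          emeasure p (f -` {\<omega> \<in> space ?S. \<forall>k\<in>?K. \<omega> k = x k} \<inter> space p)"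
        by (rule emeasure_distr[OF fm])
      also have "f -` {\<omega> \<in> space ?S. \<forall>k\<in>?K. \<omega> k = x k} \<inter> space p = ?W"
      proof (rule Set.set_eqI)
        fix s
        have rng: "(\<forall>i\<in>{- int N..int N}. P i) \<longleftrightarrow> (\<forall>j\<le>2 * N. P (- int N + int j))" for P
        proof
          assume *: "\<forall>j\<le>2 * N. P (- int N + int j)"
          show "\<forall>i\<in>{- int N..int N}. P i"
          proof
            fix i assume "i \<in> {- int N..int N}"
            then have "nat (i + int N) \<le> 2 * N" by auto
            then have "P (- int N + int (nat (i + int N)))" using * by blast
            then show "P i" using \<open>i \<in> _\<close> by simp
          qed
        qed auto
        have "s \<in> f -` {\<omega> \<in> space ?S. \<forall>k\<in>?K. \<omega> k = x k} \<inter> space p \<longleftrightarrow>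
            s \<in> space (HZ_space \<kappa>) \<and> (\<forall>i\<in>{- int N..int N}. fst s i = x (i, False) \<and> snd s i = x (i, True))"
          unfolding p(3) using measurable_space[OF f, of s] by (auto simp: f_def)
        also have "\<dots> \<longleftrightarrow> s \<in> ?W"
          unfolding rng window_def by (cases s) (simp add: add.commute)
        finally show "s \<in> f -` {\<omega> \<in> space ?S. \<forall>k\<in>?K. \<omega> k = x k} \<inter> space p \<longleftrightarrow> s \<in> ?W" .
      qed
      finally show ?thesis by (simp add: emeasure_eq_measure)
    qed
    show ?thesis
    proof (rule PiM_count_space_eqI[of "{..\<kappa>}" _ _ F])
      show "finite_measure (distr m ?S f)"
        using HZ_lawD[OF m] f by (intro finite_measure.finite_measure_distr prob_space.finite_measure)
          (simp_all cong: measurable_cong_sets)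
      fix J x assume J: "finite J" and x: "x \<in> Pi\<^sub>E (F J) (\<lambda>_. {..\<kappa>})"
      show "emeasure (distr m ?S f) {\<omega> \<in> space (distr m ?S f). \<forall>k\<in>F J. \<omega> k = x k} =
        emeasure (distr m' ?S f) {\<omega> \<in> space (distr m' ?S f). \<forall>k\<in>F J. \<omega> k = x k}"
        unfolding F_def em[OF m x[unfolded F_def]] em[OF m' x[unfolded F_def]]
        using x by (subst eq) (auto simp: PiE_iff F_def)
    qed (use F in auto)
  qed
  then show ?thesis using fg[OF m] fg[OF m'] by metis
qed

section \<open>The action of the automaton on laws\<close>

lemma sets_pca_kernel: "sets (pca_kernel \<kappa> T s) = sets (line_space \<kappa>)"
  unfolding pca_kernel_def line_space_def by (intro sets_PiM_cong) (auto simp: sets_point_measure)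

lemma line_spaceD: "s \<in> space (line_space \<kappa>) \<Longrightarrow> s x \<le> \<kappa>"
  by (auto simp: space_line_space PiE_iff)

lemma HZ_spaceD:
  assumes "s \<in> space (HZ_space \<kappa>)"
  shows "fst s x \<le> \<kappa>" "snd s x \<le> \<kappa>" "fst s \<in> space (line_space \<kappa>)" "snd s \<in> space (line_space \<kappa>)"
  using assms line_spaceD by (auto simp: space_HZ_space)

lemma measurable_two_sites:
  fixes h :: "nat \<Rightarrow> nat \<Rightarrow> ennreal"
  shows "(\<lambda>s. h (s x) (s y)) \<in> borel_measurable (line_space \<kappa>)"
  by (rule measurable_compose_countable'[where f = "\<lambda>i s. h i (s y)" and g = "\<lambda>s. s x" and I = "{..\<kappa>}"])
    (auto simp: measurable_line_coordinate intro: measurable_compose[OF measurable_line_coordinate])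

context positive_pca
begin

lemma prob_space_site:
  assumes "a \<le> \<kappa>" "b \<le> \<kappa>"
  shows "prob_space (point_measure {..\<kappa>} (\<lambda>c. ennreal (T a b c)))"
proof (rule prob_space_point_measure)
  have "(\<Sum>c\<le>\<kappa>. ennreal (T a b c)) = ennreal (\<Sum>c\<le>\<kappa>. T a b c)"
    using assms by (intro sum_ennreal) (simp add: less_imp_le)
  then show "(\<Sum>c\<le>\<kappa>. ennreal (T a b c)) = 1" using assms by (simp add: T_sum)
qed simp_all

lemma prob_space_pca_kernel:
  "s \<in> space (line_space \<kappa>) \<Longrightarrow> prob_space (pca_kernel \<kappa> T s)"
  unfolding pca_kernel_def by (intro prob_space_PiM prob_space_site line_spaceD)

lemma emeasure_pca_kernel:
  assumes s: "s \<in> space (line_space \<kappa>)" and J: "finite J" "\<And>j. j \<in> J \<Longrightarrow> A j \<subseteq> {..\<kappa>}"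
  shows "emeasure (pca_kernel \<kappa> T s) (prod_emb UNIV (\<lambda>_. count_space {..\<kappa>}) J (Pi\<^sub>E J A)) =
    (\<Prod>j\<in>J. \<Sum>c\<in>A j. ennreal (T (s j) (s (j + 1)) c))"
proof -
  let ?M = "\<lambda>x. point_measure {..\<kappa>} (\<lambda>c. ennreal (T (s x) (s (x + 1)) c))"
  have "prod_emb UNIV (\<lambda>_. count_space {..\<kappa>}) J (Pi\<^sub>E J A) = prod_emb UNIV ?M J (Pi\<^sub>E J A)"
    by (simp add: prod_emb_def space_point_measure)
  also have "emeasure (pca_kernel \<kappa> T s) \<dots> = (\<Prod>j\<in>J. emeasure (?M j) (A j))"
    unfolding pca_kernel_def
    by (rule emeasure_PiM_emb) (use s J in \<open>auto intro!: prob_space_site line_spaceD simp: sets_point_measure\<close>)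
  also have "\<dots> = (\<Prod>j\<in>J. \<Sum>c\<in>A j. ennreal (T (s j) (s (j + 1)) c))"
    using J by (intro prod.cong) (auto simp: emeasure_point_measure_finite)
  finally show ?thesis .
qed

text \<open>It is enough to test generating cylinders, where \<open>emeasure_pca_kernel\<close>
  gives a finite product of sums of functions of two coordinates of the current line.\<close>

lemma measurable_pca_kernel:
  "pca_kernel \<kappa> T \<in> measurable (line_space \<kappa>) (prob_algebra (line_space \<kappa>))"
proof (rule measurable_prob_algebra_generated)
  show "sets (line_space \<kappa>) =
      sigma_sets (\<Pi>\<^sub>E i\<in>(UNIV :: int set). space (count_space {..\<kappa>})) (prod_algebra UNIV (\<lambda>_. count_space {..\<kappa>}))"
    unfolding line_space_def by (rule sets_PiM)
  show "prod_algebra UNIV (\<lambda>_. count_space {..\<kappa>}) \<subseteq> Pow (\<Pi>\<^sub>E i\<in>(UNIV :: int set). space (count_space {..\<kappa>}))"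
    by (rule prod_algebra_sets_into_space)
  fix A :: "(int \<Rightarrow> nat) set" assume "A \<in> prod_algebra UNIV (\<lambda>_. count_space {..\<kappa>})"
  then obtain J :: "int set" and E where A: "A = prod_emb UNIV (\<lambda>_. count_space {..\<kappa>}) J (Pi\<^sub>E J E)"
    and J: "finite J" "\<And>j. j \<in> J \<Longrightarrow> E j \<subseteq> {..\<kappa>}"
    by (rule prod_algebraE) auto
  have "(\<lambda>s. \<Prod>j\<in>J. \<Sum>c\<in>E j. ennreal (T (s j) (s (j + 1)) c)) \<in> borel_measurable (line_space \<kappa>)"
    by (intro borel_measurable_prod_ennreal borel_measurable_sum
        measurable_two_sites[where h = "\<lambda>a b. ennreal (T a b _)"])
  then show "(\<lambda>s. emeasure (pca_kernel \<kappa> T s) A) \<in> borel_measurable (line_space \<kappa>)"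
    by (rule measurable_cong[THEN iffD1, rotated]) (simp add: A emeasure_pca_kernel J)
qed (auto simp: Int_stable_prod_algebra prob_space_pca_kernel sets_pca_kernel)

definition pca_step :: "(int \<Rightarrow> nat) \<times> (int \<Rightarrow> nat) \<Rightarrow> ((int \<Rightarrow> nat) \<times> (int \<Rightarrow> nat)) measure" where
  "pca_step s = distr (pca_kernel \<kappa> T (snd s)) (HZ_space \<kappa>) (\<lambda>s2. (snd s, s2))"

lemma pca_image_eq: "pca_image \<kappa> T m = m \<bind> pca_step"
  unfolding pca_image_def pca_step_def by (simp add: case_prod_unfold)

lemma measurable_pca_step: "pca_step \<in> measurable (HZ_space \<kappa>) (subprob_algebra (HZ_space \<kappa>))"
  unfolding pca_step_def
proof (rule measurable_distr2)
  have "(\<lambda>(s, s2). (snd s, s2)) \<in> measurable ((line_space \<kappa> \<Otimes>\<^sub>M line_space \<kappa>) \<Otimes>\<^sub>M line_space \<kappa>) (line_space \<kappa> \<Otimes>\<^sub>M line_space \<kappa>)"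
    by measurable
  then show "(\<lambda>(s, s2). (snd s, s2)) \<in> measurable (HZ_space \<kappa> \<Otimes>\<^sub>M line_space \<kappa>) (HZ_space \<kappa>)"
    by (simp add: HZ_space_def)
  have "snd \<in> measurable (HZ_space \<kappa>) (line_space \<kappa>)" by (simp add: HZ_space_def)
  then show "(\<lambda>s. pca_kernel \<kappa> T (snd s)) \<in> measurable (HZ_space \<kappa>) (subprob_algebra (line_space \<kappa>))"
    by (rule measurable_compose[OF _ measurable_prob_algebraD[OF measurable_pca_kernel]])
qed

lemma measurable_Pair_line:
  assumes "s \<in> space (HZ_space \<kappa>)"
  shows "(\<lambda>s2. (snd s, s2)) \<in> measurable (pca_kernel \<kappa> T (snd s)) (HZ_space \<kappa>)"
proof -
  have "(\<lambda>s2. (snd s, s2)) \<in> measurable (line_space \<kappa>) (HZ_space \<kappa>)"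
    unfolding HZ_space_def using HZ_spaceD(4)[OF assms] by simp
  then show ?thesis by (simp add: sets_pca_kernel cong: measurable_cong_sets)
qed

lemma HZ_law_pca_image:
  assumes m: "HZ_law \<kappa> m"
  shows "HZ_law \<kappa> (pca_image \<kappa> T m)"
proof -
  note m = HZ_lawD[OF m]
  interpret prob_space m by fact
  have step: "pca_step \<in> measurable m (subprob_algebra (HZ_space \<kappa>))"
    using measurable_pca_step m(2) by (simp cong: measurable_cong_sets)
  have "prob_space (m \<bind> pca_step)"
  proof (rule prob_space_bind[OF _ step])
    show "AE s in m. prob_space (pca_step s)"
    proof (rule AE_I2)
      fix s assume "s \<in> space m"
      then have s: "s \<in> space (HZ_space \<kappa>)" using m(3) by simp
      show "prob_space (pca_step s)"
        unfolding pca_step_def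
        by (rule prob_space.prob_space_distr[OF prob_space_pca_kernel measurable_Pair_line]) (use HZ_spaceD[OF s] s in auto)
    qed
  qed
  moreover have "sets (m \<bind> pca_step) = sets (HZ_space \<kappa>)"
    by (rule sets_bind) (auto simp: pca_step_def not_empty)
  ultimately show ?thesis by (simp add: HZ_law_def pca_image_eq)
qed

end

section \<open>Window probabilities after one step\<close>

definition line_window :: "nat \<Rightarrow> int \<Rightarrow> nat \<Rightarrow> (nat \<Rightarrow> nat) \<Rightarrow> ((int \<Rightarrow> nat) \<times> (int \<Rightarrow> nat)) set" where
  "line_window \<kappa> i0 n b = {s \<in> space (HZ_space \<kappa>). \<forall>i\<le>n. snd s (i0 + int i) = b i}"

lemma line_window_sets: "line_window \<kappa> i0 n b \<in> sets (HZ_space \<kappa>)"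
proof -
  have "line_window \<kappa> i0 n b = (\<Inter>i\<in>{..n}. {s \<in> space (HZ_space \<kappa>). snd s (i0 + int i) = b i})"
    unfolding line_window_def by auto
  also have "\<dots> \<in> sets (HZ_space \<kappa>)"
    by (intro sets.finite_INT coordinate_eq_sets[OF measurable_snd_coordinate]) auto
  finally show ?thesis .
qed

text \<open>A step copies the second line to the first, so the event is void unless that line
  already reads \<open>a\<close>; otherwise it is a cylinder for the product law of the new
  line.\<close>

lemma (in positive_pca) emeasure_pca_step_window:
  assumes s: "s \<in> space (HZ_space \<kappa>)" and b: "\<And>i. i \<le> n \<Longrightarrow> b i \<le> \<kappa>"
  shows "emeasure (pca_step s) (window \<kappa> i0 n a b) =
    (if \<forall>i\<le>n. snd s (i0 + int i) = a i
     then \<Prod>i\<le>n. ennreal (T (snd s (i0 + int i)) (snd s (i0 + int i + 1)) (b i)) else 0)"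
proof -
  note sD = HZ_spaceD[OF s]
  have sp: "space (pca_kernel \<kappa> T (snd s)) = space (line_space \<kappa>)"
    by (rule sets_eq_imp_space_eq[OF sets_pca_kernel])
  have "emeasure (pca_step s) (window \<kappa> i0 n a b) =
      emeasure (pca_kernel \<kappa> T (snd s)) ((\<lambda>s2. (snd s, s2)) -` window \<kappa> i0 n a b \<inter> space (line_space \<kappa>))"
    unfolding pca_step_def sp[symmetric]
    by (rule emeasure_distr[OF measurable_Pair_line[OF s] window_sets])
  also have "(\<lambda>s2. (snd s, s2)) -` window \<kappa> i0 n a b \<inter> space (line_space \<kappa>) =
      {s2 \<in> space (line_space \<kappa>). \<forall>i\<le>n. snd s (i0 + int i) = a i \<and> s2 (i0 + int i) = b i}"
    using sD by (auto simp: window_def space_HZ_space)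
  finally have eq: "emeasure (pca_step s) (window \<kappa> i0 n a b) = emeasure (pca_kernel \<kappa> T (snd s)) \<dots>" .
  show ?thesis
  proof (cases "\<forall>i\<le>n. snd s (i0 + int i) = a i")
    case False
    then have "{s2 \<in> space (line_space \<kappa>). \<forall>i\<le>n. snd s (i0 + int i) = a i \<and> s2 (i0 + int i) = b i} = {}"
      by auto
    then have "emeasure (pca_step s) (window \<kappa> i0 n a b) = 0" unfolding eq by (simp only: emeasure_empty)
    with False show ?thesis by (simp only: if_False)
  next
    case True
    let ?f = "\<lambda>i. i0 + int i"
    let ?J = "?f ` {..n}"
    let ?A = "\<lambda>j. {b (nat (j - i0))}"
    have "{s2 \<in> space (line_space \<kappa>). \<forall>i\<le>n. snd s (i0 + int i) = a i \<and> s2 (i0 + int i) = b i} =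
        prod_emb UNIV (\<lambda>_. count_space {..\<kappa>}) ?J (Pi\<^sub>E ?J ?A)"
      using True by (auto simp: prod_emb_iff PiE_iff space_line_space)
    then have "emeasure (pca_step s) (window \<kappa> i0 n a b) =
        (\<Prod>j\<in>?J. \<Sum>c\<in>?A j. ennreal (T (snd s j) (snd s (j + 1)) c))"
      unfolding eq using b by (simp only:) (rule emeasure_pca_kernel[OF sD(4)], auto)
    also have "\<dots> = (\<Prod>i\<le>n. ennreal (T (snd s (i0 + int i)) (snd s (i0 + int i + 1)) (b i)))"
      by (subst prod.reindex) (auto intro: inj_onI)
    finally show ?thesis using True by simp
  qed
qed

text \<open>The new state in column n depends on the site one beyond the window; c runs over the
  state there, and \<open>a(Suc n := c)\<close> is the extended word.\<close>

lemma (in positive_pca) measure_pca_image_window: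
  assumes m: "HZ_law \<kappa> m" and a: "\<And>i. i \<le> n \<Longrightarrow> a i \<le> \<kappa>" and b: "\<And>i. i \<le> n \<Longrightarrow> b i \<le> \<kappa>"
  shows "measure (pca_image \<kappa> T m) (window \<kappa> i0 n a b) =
    (\<Sum>c\<le>\<kappa>. measure m (line_window \<kappa> i0 (Suc n) (a(Suc n := c))) *
      (\<Prod>i\<le>n. T ((a(Suc n := c)) i) ((a(Suc n := c)) (Suc i)) (b i)))"
proof -
  note mD = HZ_lawD[OF m]
  interpret m: prob_space m by (fact mD)
  interpret im: prob_space "pca_image \<kappa> T m" by (rule HZ_lawD(1)[OF HZ_law_pca_image[OF m]])
  let ?B = "\<lambda>c. line_window \<kappa> i0 (Suc n) (a(Suc n := c))"
  let ?p = "\<lambda>c. \<Prod>i\<le>n. T ((a(Suc n := c)) i) ((a(Suc n := c)) (Suc i)) (b i)"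
  have p: "0 \<le> ?p c" if "c \<le> \<kappa>" for c
    using a b that by (intro prod_nonneg) (auto simp: less_imp_le)
  have B: "?B c \<in> sets m" for c using line_window_sets mD(2) by blast
  have step: "pca_step \<in> measurable m (subprob_algebra (HZ_space \<kappa>))"
    using measurable_pca_step mD(2) by (simp cong: measurable_cong_sets)
  have pt: "emeasure (pca_step s) (window \<kappa> i0 n a b) = (\<Sum>c\<le>\<kappa>. ennreal (?p c) * indicator (?B c) s)"
    if "s \<in> space m" for s
  proof -
    have s: "s \<in> space (HZ_space \<kappa>)" using that mD(3) by simp
    let ?d = "snd s (i0 + int (Suc n))"
    have d: "?d \<le> \<kappa>" by (rule HZ_spaceD(2)[OF s])
    have B_iff: "s \<in> ?B c \<longleftrightarrow> (\<forall>i\<le>n. snd s (i0 + int i) = a i) \<and> ?d = c" for c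
      unfolding line_window_def using s by (auto simp: le_Suc_eq)
    have w: "emeasure (pca_step s) (window \<kappa> i0 n a b) =
      (if \<forall>i\<le>n. snd s (i0 + int i) = a i
       then \<Prod>i\<le>n. ennreal (T (snd s (i0 + int i)) (snd s (i0 + int i + 1)) (b i)) else 0)"
      by (rule emeasure_pca_step_window[OF s]) (rule b)
    show ?thesis
    proof (cases "\<forall>i\<le>n. snd s (i0 + int i) = a i")
      case True
      \<comment> \<open>Only the summand with c equal to the actual state at the extra site
        survives.\<close>
      have "(\<Sum>c\<le>\<kappa>. ennreal (?p c) * indicator (?B c) s) = (\<Sum>c\<le>\<kappa>. if c = ?d then ennreal (?p ?d) else 0)"
        by (intro sum.cong) (auto simp: indicator_def B_iff True)
      also have "\<dots> = ennreal (?p ?d)" using d by simp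
      also have "\<dots> = (\<Prod>i\<le>n. ennreal (T ((a(Suc n := ?d)) i) ((a(Suc n := ?d)) (Suc i)) (b i)))"
        using a b d by (intro prod_ennreal[symmetric]) (auto simp: less_imp_le)
      also have "\<dots> = (\<Prod>i\<le>n. ennreal (T (snd s (i0 + int i)) (snd s (i0 + int i + 1)) (b i)))"
      proof (rule prod.cong[OF refl])
        fix i assume "i \<in> {..n}"
        then have i: "i \<le> n" by simp
        have "(a(Suc n := ?d)) (Suc i) = snd s (i0 + int i + 1)"
        proof (cases "i = n")
          case False
          then have "Suc i \<le> n" using i by simp
          then have "snd s (i0 + int (Suc i)) = a (Suc i)" using True by blast
          then show ?thesis using False by (simp add: ac_simps)
        qed (simp add: ac_simps)
        then show "ennreal (T ((a(Suc n := ?d)) i) ((a(Suc n := ?d)) (Suc i)) (b i)) =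
            ennreal (T (snd s (i0 + int i)) (snd s (i0 + int i + 1)) (b i))"
          using True i by simp
      qed
      finally show ?thesis unfolding w if_P[OF True] by (rule sym)
    next
      case False
      then show ?thesis unfolding w by (auto simp: B_iff)
    qed
  qed
  have "emeasure (pca_image \<kappa> T m) (window \<kappa> i0 n a b) = (\<integral>\<^sup>+s. emeasure (pca_step s) (window \<kappa> i0 n a b) \<partial>m)"
    unfolding pca_image_eq by (rule emeasure_bind[OF m.not_empty step window_sets])
  also have "\<dots> = (\<integral>\<^sup>+s. (\<Sum>c\<le>\<kappa>. ennreal (?p c) * indicator (?B c) s) \<partial>m)"
    by (rule nn_integral_cong) (rule pt)
  also have "\<dots> = (\<Sum>c\<le>\<kappa>. ennreal (?p c) * emeasure m (?B c))"
    using B by (subst nn_integral_sum) (auto intro!: sum.cong nn_integral_cmult_indicator)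
  also have "\<dots> = (\<Sum>c\<le>\<kappa>. ennreal (measure m (?B c) * ?p c))"
    using p by (intro sum.cong) (auto simp: m.emeasure_eq_measure ennreal_mult' mult.commute)
  also have "\<dots> = ennreal (\<Sum>c\<le>\<kappa>. measure m (?B c) * ?p c)"
    using p by (intro sum_ennreal) auto
  finally have "ennreal (measure (pca_image \<kappa> T m) (window \<kappa> i0 n a b)) = ennreal (\<Sum>c\<le>\<kappa>. measure m (?B c) * ?p c)"
    by (simp only: im.emeasure_eq_measure)
  then show ?thesis
    using p by (subst (asm) ennreal_inj) (auto intro!: sum_nonneg mult_nonneg_nonneg)
qed

section \<open>Invariant zigzag chains\<close>

lemma HZMC_law_initD:
  assumes "HZMC_law_init \<kappa> D U \<rho> m"
  shows "markov_kernel \<kappa> D" "markov_kernel \<kappa> U" "invariant_dist \<kappa> (D * U) \<rho>" "HZ_law \<kappa> m"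
  using assms unfolding HZMC_law_init_def by blast+

lemma HZMC_window:
  assumes H: "HZMC_law_init \<kappa> D U \<rho> m" and ab: "\<And>i. i \<le> n \<Longrightarrow> a i \<le> \<kappa> \<and> b i \<le> \<kappa>"
  shows "measure m (window \<kappa> i0 n a b) =
    \<rho> $ a 0 * (\<Prod>i<n. D $$ (a i, b i) * U $$ (b i, a (i + 1))) * D $$ (a n, b n)"
proof -
  have "window \<kappa> i0 n a b = {(s0, s1) \<in> space m. \<forall>i\<le>n. s0 (i0 + int i) = a i \<and> s1 (i0 + int i) = b i}"
    unfolding window_def HZ_lawD(3)[OF HZMC_law_initD(4)[OF H]] ..
  then show ?thesis using H ab unfolding HZMC_law_init_def by simp
qed

text \<open>Summing out the first line factorizes: each of its states sits between two prescribed
  ones and contributes an entry of U D, except the leftmost, which contributes an entry of \<rho>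
  D.\<close>

lemma HZMC_line_window:
  assumes H: "HZMC_law_init \<kappa> D U \<rho> m" and b: "\<And>i. i \<le> n \<Longrightarrow> b i \<le> \<kappa>"
  shows "measure m (line_window \<kappa> i0 n b) =
    (\<Sum>y\<le>\<kappa>. \<rho> $ y * D $$ (y, b 0)) * (\<Prod>i<n. (U * D) $$ (b i, b (Suc i)))"
proof -
  note HD = HZMC_law_initD[OF H]
  note m = HZ_lawD[OF HD(4)]
  note CD = markov_kernelD(1)[OF HD(1)] and CU = markov_kernelD(1)[OF HD(2)]
  interpret prob_space m by fact
  let ?X = "Pi\<^sub>E {..n} (\<lambda>_. {..\<kappa>})"
  \<comment> \<open>\<open>g j\<close> collects the factors of the window formula that contain the
    first-line state in column j.\<close>
  define g where "g j y = (if j = 0 then \<rho> $ y * D $$ (y, b 0) else U $$ (b (j - 1), y) * D $$ (y, b j))" for j y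
  have prod: "\<rho> $ x 0 * (\<Prod>i<k. D $$ (x i, b i) * U $$ (b i, x (i + 1))) * D $$ (x k, b k) = (\<Prod>j\<le>k. g j (x j))"
    for x :: "nat \<Rightarrow> nat" and k
  proof (induction k)
    case (Suc k)
    show ?case unfolding prod.atMost_Suc Suc.IH[symmetric] by (simp add: g_def)
  qed (simp add: g_def)
  have "line_window \<kappa> i0 n b = (\<Union>x\<in>?X. window \<kappa> i0 n x b)"
  proof (rule Set.set_eqI)
    fix s
    show "s \<in> line_window \<kappa> i0 n b \<longleftrightarrow> s \<in> (\<Union>x\<in>?X. window \<kappa> i0 n x b)"
    proof
      assume s: "s \<in> line_window \<kappa> i0 n b"
      then have sp: "s \<in> space (HZ_space \<kappa>)" by (simp add: line_window_def)
      let ?x = "\<lambda>i\<in>{..n}. fst s (i0 + int i)"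
      have "?x \<in> ?X" using HZ_spaceD(1)[OF sp] by auto
      moreover have "s \<in> window \<kappa> i0 n ?x b"
        using s by (cases s) (simp add: line_window_def window_def)
      ultimately show "s \<in> (\<Union>x\<in>?X. window \<kappa> i0 n x b)" by blast
    next
      assume "s \<in> (\<Union>x\<in>?X. window \<kappa> i0 n x b)"
      then obtain x where "s \<in> window \<kappa> i0 n x b" by blast
      then show "s \<in> line_window \<kappa> i0 n b" by (cases s) (simp add: line_window_def window_def)
    qed
  qed
  also have "measure m \<dots> = (\<Sum>x\<in>?X. measure m (window \<kappa> i0 n x b))"
  proof (rule finite_measure_finite_Union)
    show "finite ?X" by (intro finite_PiE) auto
    show "(\<lambda>x. window \<kappa> i0 n x b) ` ?X \<subseteq> sets m" using window_sets m(2) by blast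
    show "disjoint_family_on (\<lambda>x. window \<kappa> i0 n x b) ?X"
      unfolding disjoint_family_on_def
    proof (intro ballI impI)
      fix x y assume xy: "x \<in> ?X" "y \<in> ?X" "x \<noteq> y"
      then obtain i where "i \<in> {..n}" "x i \<noteq> y i" by (metis PiE_ext)
      then show "window \<kappa> i0 n x b \<inter> window \<kappa> i0 n y b = {}" by (fastforce simp: window_def)
    qed
  qed
  also have "\<dots> = (\<Sum>x\<in>?X. \<Prod>j\<le>n. g j (x j))"
  proof (rule sum.cong[OF refl])
    fix x assume "x \<in> ?X"
    then have x: "\<And>i. i \<le> n \<Longrightarrow> x i \<le> \<kappa> \<and> b i \<le> \<kappa>" using b by (auto simp: PiE_iff)
    have "measure m (window \<kappa> i0 n x b) =
        \<rho> $ x 0 * (\<Prod>i<n. D $$ (x i, b i) * U $$ (b i, x (i + 1))) * D $$ (x n, b n)"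
      by (rule HZMC_window[OF H]) (rule x)
    then show "measure m (window \<kappa> i0 n x b) = (\<Prod>j\<le>n. g j (x j))" unfolding prod .
  qed
  also have "\<dots> = (\<Prod>j\<le>n. \<Sum>y\<le>\<kappa>. g j y)"
    by (rule prod_sum_PiE[symmetric]) auto
  also have "\<dots> = (\<Sum>y\<le>\<kappa>. g 0 y) * (\<Prod>i<n. \<Sum>y\<le>\<kappa>. g (Suc i) y)"
    by (rule prod.atMost_shift)
  also have "(\<Prod>i<n. \<Sum>y\<le>\<kappa>. g (Suc i) y) = (\<Prod>i<n. (U * D) $$ (b i, b (Suc i)))"
    using b by (intro prod.cong) (auto simp: g_def mult_mat_index[OF CU CD] simp del: index_mult_mat)
  finally show ?thesis by (simp add: g_def)
qed

section \<open>Invariance of a zigzag chain and the factorization\<close>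

context positive_pca
begin

text \<open>The extended word has n + 2 sites, hence n + 1 transitions of \<open>U * D\<close>, one
  for each local probability; so both products run over i \<le> n and merge.\<close>

lemma HZMC_image_window:
  assumes H: "HZMC_law_init \<kappa> D U \<rho> m" and ab: "\<And>i. i \<le> n \<Longrightarrow> a i \<le> \<kappa> \<and> b i \<le> \<kappa>"
  shows "measure (pca_image \<kappa> T m) (window \<kappa> i0 n a b) =
    (\<Sum>c\<le>\<kappa>. (\<Sum>y\<le>\<kappa>. \<rho> $ y * D $$ (y, a 0)) *
      (\<Prod>i\<le>n. (U * D) $$ ((a(Suc n := c)) i, (a(Suc n := c)) (Suc i)) *
        T ((a(Suc n := c)) i) ((a(Suc n := c)) (Suc i)) (b i)))"
proof -
  have "measure (pca_image \<kappa> T m) (window \<kappa> i0 n a b) =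
    (\<Sum>c\<le>\<kappa>. measure m (line_window \<kappa> i0 (Suc n) (a(Suc n := c))) *
      (\<Prod>i\<le>n. T ((a(Suc n := c)) i) ((a(Suc n := c)) (Suc i)) (b i)))"
    by (rule measure_pca_image_window[OF HZMC_law_initD(4)[OF H]]) (use ab in auto)
  also have "\<dots> = (\<Sum>c\<le>\<kappa>. (\<Sum>y\<le>\<kappa>. \<rho> $ y * D $$ (y, a 0)) *
      (\<Prod>i\<le>n. (U * D) $$ ((a(Suc n := c)) i, (a(Suc n := c)) (Suc i)) *
        T ((a(Suc n := c)) i) ((a(Suc n := c)) (Suc i)) (b i)))"
  proof (rule sum.cong[OF refl])
    fix c assume "c \<in> {..\<kappa>}"
    then have *: "(a(Suc n := c)) i \<le> \<kappa>" if "i \<le> Suc n" for i using that ab[of i] by auto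
    have "measure m (line_window \<kappa> i0 (Suc n) (a(Suc n := c))) =
        (\<Sum>y\<le>\<kappa>. \<rho> $ y * D $$ (y, (a(Suc n := c)) 0)) *
        (\<Prod>i<Suc n. (U * D) $$ ((a(Suc n := c)) i, (a(Suc n := c)) (Suc i)))"
      by (rule HZMC_line_window[OF H]) (rule *)
    then show "measure m (line_window \<kappa> i0 (Suc n) (a(Suc n := c))) *
        (\<Prod>i\<le>n. T ((a(Suc n := c)) i) ((a(Suc n := c)) (Suc i)) (b i)) =
        (\<Sum>y\<le>\<kappa>. \<rho> $ y * D $$ (y, a 0)) *
        (\<Prod>i\<le>n. (U * D) $$ ((a(Suc n := c)) i, (a(Suc n := c)) (Suc i)) *
          T ((a(Suc n := c)) i) ((a(Suc n := c)) (Suc i)) (b i))"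
      by (simp only: prod.distrib lessThan_Suc_atMost mult.assoc fun_upd_apply) simp
  qed
  finally show ?thesis .
qed

text \<open>At the outset D, U and \<rho> may have zeros, so the window identities come multiplied
  by \<rho>. Positivity then spreads from one state charged by \<rho> to all entries through the
  positive rate, and \<rho> can be cancelled.\<close>

lemma zigzag_factorization_of_invariant:
  assumes H: "HZMC_law_init \<kappa> D U \<rho> m" and inv: "pca_invariant \<kappa> T m"
  shows "zigzag_factorization D U \<rho>"
proof -
  note HD = HZMC_law_initD[OF H]
  note KD = HD(1) and KU = HD(2)
  note CD = markov_kernelD(1)[OF KD] and CU = markov_kernelD(1)[OF KU]
  note sD = markov_kernelD(3)[OF KD] and sU = markov_kernelD(3)[OF KU]
  have im: "pca_image \<kappa> T m = m" using inv by (simp add: pca_invariant_def)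
  \<comment> \<open>The one-site law of the second line, which becomes the first line after the
    step.\<close>
  define R where "R x = (\<Sum>y\<le>\<kappa>. \<rho> $ y * D $$ (y, x))" for x
  define V where "V x y = (U * D) $$ (x, y)" for x y
  have sV: "(\<Sum>c\<le>\<kappa>. V x c) = 1" if "x \<le> \<kappa>" for x
    unfolding V_def by (rule markov_kernelD(3)[OF markov_kernel_mult[OF KU KD] that])
  \<comment> \<open>The two-column window at site 0, before the step on the left and after it on the
    right; c is the state at the extra site.\<close>
  have eq1: "\<rho> $ a * (D $$ (a, b) * U $$ (b, a')) * D $$ (a', b') =
      (\<Sum>c\<le>\<kappa>. R a * (V a a' * T a a' b * (V a' c * T a' c b')))"
    if "a \<le> \<kappa>" "b \<le> \<kappa>" "a' \<le> \<kappa>" "b' \<le> \<kappa>" for a b a' b'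
  proof -
    let ?a = "\<lambda>i::nat. if i = 0 then a else a'" and ?b = "\<lambda>i::nat. if i = 0 then b else b'"
    have ab: "?a i \<le> \<kappa> \<and> ?b i \<le> \<kappa>" for i using that by simp
    have "measure m (window \<kappa> 0 1 ?a ?b) =
        \<rho> $ ?a 0 * (\<Prod>i<1. D $$ (?a i, ?b i) * U $$ (?b i, ?a (i + 1))) * D $$ (?a 1, ?b 1)"
      by (rule HZMC_window[OF H]) (rule ab)
    moreover have "measure (pca_image \<kappa> T m) (window \<kappa> 0 1 ?a ?b) =
      (\<Sum>c\<le>\<kappa>. R (?a 0) * (\<Prod>i\<le>1. V ((?a(Suc 1 := c)) i) ((?a(Suc 1 := c)) (Suc i)) *
        T ((?a(Suc 1 := c)) i) ((?a(Suc 1 := c)) (Suc i)) (?b i)))"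
      unfolding R_def V_def by (rule HZMC_image_window[OF H]) (rule ab)
    ultimately show ?thesis unfolding im by (simp add: numeral_2_eq_2)
  qed
  \<comment> \<open>Summation over b' removes the last state: D has row sums 1 on the left, and on
    the right so do T and V.\<close>
  have key: "\<rho> $ a * (D $$ (a, b) * U $$ (b, a')) = R a * (V a a' * T a a' b)"
    if abc: "a \<le> \<kappa>" "b \<le> \<kappa>" "a' \<le> \<kappa>" for a b a'
  proof -
    have "(\<Sum>b'\<le>\<kappa>. \<rho> $ a * (D $$ (a, b) * U $$ (b, a')) * D $$ (a', b')) =
        (\<Sum>b'\<le>\<kappa>. \<Sum>c\<le>\<kappa>. R a * (V a a' * T a a' b * (V a' c * T a' c b')))"
      using abc by (intro sum.cong refl eq1) auto
    also have "\<dots> = (\<Sum>c\<le>\<kappa>. \<Sum>b'\<le>\<kappa>. R a * (V a a' * T a a' b * (V a' c * T a' c b')))"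
      by (rule sum.swap)
    also have "\<dots> = R a * (V a a' * T a a' b * (\<Sum>c\<le>\<kappa>. V a' c * (\<Sum>b'\<le>\<kappa>. T a' c b')))"
      by (simp only: sum_distrib_left)
    also have "\<dots> = R a * (V a a' * T a a' b)" using abc by (simp add: T_sum sV)
    finally show ?thesis by (simp only: sum_distrib_left[symmetric] sD[OF abc(3)] mult_1_right)
  qed
  have W: "(\<Sum>b\<le>\<kappa>. D $$ (a, b) * U $$ (b, a')) = (D * U) $$ (a, a')" if "a \<le> \<kappa>" "a' \<le> \<kappa>" for a a'
    using mult_mat_index[OF CD CU that] by simp
  have key2: "\<rho> $ a * (D * U) $$ (a, a') = R a * V a a'" if aa: "a \<le> \<kappa>" "a' \<le> \<kappa>" for a a'
  proof -
    have "(\<Sum>b\<le>\<kappa>. \<rho> $ a * (D $$ (a, b) * U $$ (b, a'))) = (\<Sum>b\<le>\<kappa>. R a * (V a a' * T a a' b))"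
      using aa by (intro sum.cong refl key) auto
    then show ?thesis
      by (simp only: sum_distrib_left[symmetric] W[OF aa] T_sum[OF aa] mult_1_right)
  qed
  \<comment> \<open>Summing \<open>key2\<close> over a' leaves \<rho> D = \<rho>, because D U and U
    D are both stochastic.\<close>
  have R: "R a = \<rho> $ a" if a: "a \<le> \<kappa>" for a
  proof -
    have "(\<Sum>a'\<le>\<kappa>. \<rho> $ a * (D * U) $$ (a, a')) = (\<Sum>a'\<le>\<kappa>. R a * V a a')"
      using a by (intro sum.cong refl key2) auto
    then show ?thesis
      by (simp only: sum_distrib_left[symmetric] markov_kernelD(3)[OF markov_kernel_mult[OF KD KU] a] sV[OF a] mult_1_right)
  qed
  have \<rho>: "prob_vec \<kappa> \<rho>" using HD(3) by (simp add: invariant_dist_def)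
  then have \<rho>0: "\<And>i. i \<le> \<kappa> \<Longrightarrow> 0 \<le> \<rho> $ i" and \<rho>1: "(\<Sum>i\<le>\<kappa>. \<rho> $ i) = 1" by (auto simp: prob_vec_def)
  have \<rho>D: "invariant_dist \<kappa> D \<rho>"
    unfolding invariant_dist_iff[OF CD] using \<rho> R by (simp add: R_def)
  have nzsum: "\<exists>i\<le>\<kappa>. 0 < f i" if "(\<Sum>i\<le>\<kappa>. f i) = 1" for f :: "nat \<Rightarrow> real"
  proof (rule ccontr)
    assume "\<not> ?thesis"
    then have "(\<Sum>i\<le>\<kappa>. f i) \<le> 0" by (intro sum_nonpos) auto
    with that show False by simp
  qed
  have Drow: "0 < D $$ (a, b)" if a: "a \<le> \<kappa>" "0 < \<rho> $ a" and b: "b \<le> \<kappa>" for a b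
  proof -
    \<comment> \<open>Row a of V charges some a'; as T is positive, the right-hand side of
      \<open>key\<close> is then positive for every b.\<close>
    obtain a' where a': "a' \<le> \<kappa>" "0 < V a a'" using nzsum[OF sV[OF a(1)]] by blast
    have "0 < R a * (V a a' * T a a' b)" using a a' b by (simp add: R)
    then have "0 < \<rho> $ a * (D $$ (a, b) * U $$ (b, a'))" using key[OF a(1) b a'(1)] by simp
    then have "D $$ (a, b) \<noteq> 0" by auto
    then show ?thesis using markov_kernelD(2)[OF KD a(1) b] by simp
  qed
  have \<rho>p: "0 < \<rho> $ b" if b: "b \<le> \<kappa>" for b
  proof -
    \<comment> \<open>One charged state is enough: its row of D is positive, and \<rho> = \<rho> D
      carries its mass to every b.\<close>
    obtain a where a: "a \<le> \<kappa>" "0 < \<rho> $ a" using nzsum[OF \<rho>1] by blast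
    have "0 < \<rho> $ a * D $$ (a, b)" using Drow[OF a b] a by simp
    also have "\<dots> \<le> R b" unfolding R_def
      using a b \<rho>0 markov_kernelD(2)[OF KD] by (intro member_le_sum) (auto intro!: mult_nonneg_nonneg)
    finally show ?thesis using R[OF b] by simp
  qed
  have Dp: "0 < D $$ (a, b)" if "a \<le> \<kappa>" "b \<le> \<kappa>" for a b by (rule Drow[OF that(1) \<rho>p[OF that(1)] that(2)])
  have Vp: "0 < V a a'" if aa: "a \<le> \<kappa>" "a' \<le> \<kappa>" for a a'
  proof -
    obtain k where k: "k \<le> \<kappa>" "0 < U $$ (a, k)" using nzsum[OF sU[OF aa(1)]] by blast
    have "0 < U $$ (a, k) * D $$ (k, a')" using k Dp aa by simp
    also have "\<dots> \<le> (\<Sum>k\<le>\<kappa>. U $$ (a, k) * D $$ (k, a'))"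
      using k aa markov_kernelD(2)[OF KU] markov_kernelD(2)[OF KD]
      by (intro member_le_sum) (auto intro!: mult_nonneg_nonneg)
    finally show ?thesis unfolding V_def mult_mat_index[OF CU CD aa] .
  qed
  have fact0: "D $$ (a, b) * U $$ (b, a') = V a a' * T a a' b" if "a \<le> \<kappa>" "b \<le> \<kappa>" "a' \<le> \<kappa>" for a b a'
    using key[OF that] \<rho>p[OF that(1)] by (simp add: R[OF that(1)])
  have Up: "0 < U $$ (b, a')" if "b \<le> \<kappa>" "a' \<le> \<kappa>" for b a'
  proof -
    have "0 < V 0 a' * T 0 a' b" using that Vp by simp
    then have "U $$ (b, a') \<noteq> 0" using fact0[of 0 b a'] that by auto
    then show ?thesis using markov_kernelD(2)[OF KU that] by simp
  qed
  have WV: "(D * U) $$ (a, a') = V a a'" if "a \<le> \<kappa>" "a' \<le> \<kappa>" for a a'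
    using key2[OF that] \<rho>p[OF that(1)] by (simp add: R[OF that(1)] del: index_mult_mat)
  have comm: "D * U = U * D"
    using WV CD CU by (intro eq_matI) (auto simp: V_def less_Suc_eq_le simp del: index_mult_mat(1))
  have "invariant_dist \<kappa> U \<rho>"
    by (rule invariant_dist_commute[OF KD KU _ comm \<rho>D]) (use Dp in blast)
  moreover have "T a b c * (D * U) $$ (a, b) = D $$ (a, c) * U $$ (c, b)" if "a \<le> \<kappa>" "b \<le> \<kappa>" "c \<le> \<kappa>" for a b c
    unfolding WV[OF that(1,2)] fact0[OF that(1,3,2)] by (rule mult.commute)
  ultimately show ?thesis
    unfolding zigzag_factorization_def using KD KU Dp Up comm \<rho>D by blast
qed

text \<open>The factorization turns each transition of U D times its local probability into a D
  entry times a U entry. The surplus last U entry sums to 1 over the extra state, and \<rho> D =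
  \<rho> restores the initial weight.\<close>

lemma pca_invariant_zigzag:
  assumes Z: "zigzag_factorization D U \<rho>" and H: "HZMC_law_init \<kappa> D U \<rho> m"
  shows "pca_invariant \<kappa> T m"
  unfolding pca_invariant_def
proof (rule HZ_law_eqI)
  note HD = HZMC_law_initD[OF H]
  note CD = markov_kernelD(1)[OF HD(1)]
  have comm: "U * D = D * U" and \<rho>D: "invariant_dist \<kappa> D \<rho>"
    and fact: "\<And>a b c. a \<le> \<kappa> \<Longrightarrow> b \<le> \<kappa> \<Longrightarrow> c \<le> \<kappa> \<Longrightarrow> T a b c * (D * U) $$ (a, b) = D $$ (a, c) * U $$ (c, b)"
    using Z unfolding zigzag_factorization_def by auto
  show "HZ_law \<kappa> (pca_image \<kappa> T m)" by (rule HZ_law_pca_image[OF HD(4)])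
  show "HZ_law \<kappa> m" by (rule HD(4))
  fix i0 n and a b :: "nat \<Rightarrow> nat" assume ab: "\<And>i. i \<le> n \<Longrightarrow> a i \<le> \<kappa> \<and> b i \<le> \<kappa>"
  have R: "(\<Sum>y\<le>\<kappa>. \<rho> $ y * D $$ (y, a 0)) = \<rho> $ a 0"
    using \<rho>D ab[of 0] unfolding invariant_dist_iff[OF CD] by blast
  have "measure (pca_image \<kappa> T m) (window \<kappa> i0 n a b) =
    (\<Sum>c\<le>\<kappa>. (\<Sum>y\<le>\<kappa>. \<rho> $ y * D $$ (y, a 0)) *
      (\<Prod>i\<le>n. (U * D) $$ ((a(Suc n := c)) i, (a(Suc n := c)) (Suc i)) *
        T ((a(Suc n := c)) i) ((a(Suc n := c)) (Suc i)) (b i)))"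
    by (rule HZMC_image_window[OF H]) (rule ab)
  also have "\<dots> = (\<Sum>c\<le>\<kappa>. \<rho> $ a 0 * (\<Prod>i<n. D $$ (a i, b i) * U $$ (b i, a (i + 1))) * D $$ (a n, b n) * U $$ (b n, c))"
  proof (rule sum.cong[OF refl])
    fix c assume c: "c \<in> {..\<kappa>}"
    have "(\<Prod>i\<le>n. (U * D) $$ ((a(Suc n := c)) i, (a(Suc n := c)) (Suc i)) *
        T ((a(Suc n := c)) i) ((a(Suc n := c)) (Suc i)) (b i)) =
      (\<Prod>i\<le>n. D $$ ((a(Suc n := c)) i, b i) * U $$ (b i, (a(Suc n := c)) (Suc i)))"
    proof (rule prod.cong[OF refl])
      fix i assume "i \<in> {..n}"
      then have "(a(Suc n := c)) i \<le> \<kappa>" "(a(Suc n := c)) (Suc i) \<le> \<kappa>" "b i \<le> \<kappa>"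
        using ab[of i] ab[of "Suc i"] c by auto
      from fact[OF this]
      show "(U * D) $$ ((a(Suc n := c)) i, (a(Suc n := c)) (Suc i)) *
          T ((a(Suc n := c)) i) ((a(Suc n := c)) (Suc i)) (b i) =
        D $$ ((a(Suc n := c)) i, b i) * U $$ (b i, (a(Suc n := c)) (Suc i))"
        unfolding comm by (simp only: mult.commute)
    qed
    also have "\<dots> = (\<Prod>i<n. D $$ (a i, b i) * U $$ (b i, a (i + 1))) * (D $$ (a n, b n) * U $$ (b n, c))"
      by (simp flip: lessThan_Suc_atMost)
    finally show "(\<Sum>y\<le>\<kappa>. \<rho> $ y * D $$ (y, a 0)) *
      (\<Prod>i\<le>n. (U * D) $$ ((a(Suc n := c)) i, (a(Suc n := c)) (Suc i)) *
        T ((a(Suc n := c)) i) ((a(Suc n := c)) (Suc i)) (b i)) =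
      \<rho> $ a 0 * (\<Prod>i<n. D $$ (a i, b i) * U $$ (b i, a (i + 1))) * D $$ (a n, b n) * U $$ (b n, c)"
      unfolding R by (simp only: mult.assoc)
  qed
  also have "\<dots> = \<rho> $ a 0 * (\<Prod>i<n. D $$ (a i, b i) * U $$ (b i, a (i + 1))) * D $$ (a n, b n)"
    using ab[of n] by (simp only: sum_distrib_left[symmetric] markov_kernelD(3)[OF HD(2)] order_refl mult_1_right)
  also have "\<dots> = measure m (window \<kappa> i0 n a b)"
    by (rule HZMC_window[OF H, symmetric]) (rule ab)
  finally show "measure (pca_image \<kappa> T m) (window \<kappa> i0 n a b) = measure m (window \<kappa> i0 n a b)" .
qed

lemma HZMC_law_init_unique:
  assumes H: "HZMC_law_init \<kappa> D U \<rho> m" and H': "HZMC_law_init \<kappa> D U \<rho> m'"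
  shows "m = m'"
proof (rule HZ_law_eqI[OF HZMC_law_initD(4)[OF H] HZMC_law_initD(4)[OF H']])
  fix i0 n and a b :: "nat \<Rightarrow> nat" assume ab: "\<And>i. i \<le> n \<Longrightarrow> a i \<le> \<kappa> \<and> b i \<le> \<kappa>"
  show "measure m (window \<kappa> i0 n a b) = measure m' (window \<kappa> i0 n a b)"
    using HZMC_window[OF H, of n a b i0] HZMC_window[OF H', of n a b i0] ab by simp
qed

text \<open>\<open>HZMC_law\<close> leaves the initial law open; the positive kernel D U has a
  single invariant distribution, which pins it down.\<close>

lemma HZMC_law_zigzag_iff:
  assumes Z: "zigzag_factorization D U \<rho>"
  shows "HZMC_law \<kappa> D U m \<longleftrightarrow> HZMC_law_init \<kappa> D U \<rho> m"
proof
  assume "HZMC_law \<kappa> D U m"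
  then obtain \<sigma> where H: "HZMC_law_init \<kappa> D U \<sigma> m" by (auto simp: HZMC_law_def)
  then have "invariant_dist \<kappa> (D * U) \<sigma>" by (rule HZMC_law_initD)
  then have "\<sigma> = \<rho>" using zigzag_factorization_kernels[OF Z, of "D * U"] by simp
  with H show "HZMC_law_init \<kappa> D U \<rho> m" by simp
qed (auto simp: HZMC_law_def)

end

section \<open>Two-sided Markov chains\<close>

text \<open>\<sigma> is the direction away from 0: the identity to the right, negation to the left.
  Site 0 has no neighbour closer to 0, so its second index is a dummy 0.\<close>

primrec half_path :: "(int \<Rightarrow> int) \<Rightarrow> (int \<times> nat \<Rightarrow> nat) \<Rightarrow> nat \<Rightarrow> nat" where
  "half_path \<sigma> \<omega> 0 = \<omega> (0, 0)"
| "half_path \<sigma> \<omega> (Suc n) = \<omega> (\<sigma> (int (Suc n)), half_path \<sigma> \<omega> n)"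

text \<open>The path of a two-sided chain driven by independent variables: \<open>\<omega> (i, x)\<close> is the state at
  time \<open>i\<close> if the neighbouring state on the side of \<open>0\<close> is \<open>x\<close>.\<close>

definition driven_path :: "(int \<times> nat \<Rightarrow> nat) \<Rightarrow> int \<Rightarrow> nat" where
  "driven_path \<omega> i = (if 0 \<le> i then half_path (\<lambda>k. k) \<omega> (nat i) else half_path uminus \<omega> (nat (- i)))"

lemma driven_path_rec:
  "driven_path \<omega> 0 = \<omega> (0, 0)"
  "0 < i \<Longrightarrow> driven_path \<omega> i = \<omega> (i, driven_path \<omega> (i - 1))"
  "i < 0 \<Longrightarrow> driven_path \<omega> i = \<omega> (i, driven_path \<omega> (i + 1))"
proof -
  show "driven_path \<omega> 0 = \<omega> (0, 0)" by (simp add: driven_path_def)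
  show "driven_path \<omega> i = \<omega> (i, driven_path \<omega> (i - 1))" if "0 < i"
  proof -
    define n where "n = nat (i - 1)"
    have i: "i = int (Suc n)" using that by (simp add: n_def)
    show ?thesis unfolding i by (simp add: driven_path_def nat_add_distrib)
  qed
  show "driven_path \<omega> i = \<omega> (i, driven_path \<omega> (i + 1))" if "i < 0"
  proof -
    define n where "n = nat (- i - 1)"
    have i: "i = - int (Suc n)" using that by (simp add: n_def)
    have neg: "driven_path \<omega> (- int k) = half_path uminus \<omega> k" for k
      by (cases "k = 0") (simp_all add: driven_path_def)
    have i1: "i + 1 = - int n" by (simp add: i)
    show ?thesis unfolding i1 neg unfolding i neg by (rule half_path.simps(2))
  qed
qed

text \<open>In a window containing 0, the neighbour of a site on the side of 0 is again in the
  window, so its state is prescribed. The path event thus fixes one coordinate of \<omega> per site,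
  and these are independent.\<close>

lemma driven_path_eq_iff:
  fixes l r :: int
  assumes "l \<le> 0" "0 \<le> r"
  shows "(\<forall>i\<in>{l..r}. driven_path \<omega> i = z i) \<longleftrightarrow>
    (\<forall>i\<in>{l..r}. \<omega> (i, if i = 0 then 0 else if 0 < i then z (i - 1) else z (i + 1)) = z i)"
    (is "?L \<longleftrightarrow> (\<forall>i\<in>_. \<omega> (i, ?p i) = _)")
proof
  assume L: ?L
  show "\<forall>i\<in>{l..r}. \<omega> (i, ?p i) = z i"
  proof
    fix i assume i: "i \<in> {l..r}"
    then have *: "driven_path \<omega> i = z i" using L by blast
    consider "i = 0" | "0 < i" | "i < 0" by linarith
    then show "\<omega> (i, ?p i) = z i"
    proof cases
      case 1 then show ?thesis using * driven_path_rec(1)[of \<omega>] by simp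
    next
      case 2
      then have "driven_path \<omega> (i - 1) = z (i - 1)" using L i assms by auto
      then show ?thesis using 2 * driven_path_rec(2)[OF 2, of \<omega>] by simp
    next
      case 3
      then have "driven_path \<omega> (i + 1) = z (i + 1)" using L i assms by auto
      then show ?thesis using 3 * driven_path_rec(3)[OF 3, of \<omega>] by simp
    qed
  qed
next
  assume R: "\<forall>i\<in>{l..r}. \<omega> (i, ?p i) = z i"
  have up: "i \<le> r \<longrightarrow> driven_path \<omega> i = z i" if "0 \<le> i" for i
    using that
  proof (induction i rule: int_ge_induct)
    case base
    have "0 \<in> {l..r}" using assms by simp
    with R have "\<omega> (0, ?p 0) = z 0" by blast
    then show ?case by (simp add: driven_path_rec)
  next
    case (step i)
    show ?case
    proof
      assume "i + 1 \<le> r"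
      then have "i + 1 \<in> {l..r}" using step(1) assms by simp
      with R have "\<omega> (i + 1, ?p (i + 1)) = z (i + 1)" by blast
      then show "driven_path \<omega> (i + 1) = z (i + 1)"
        using step \<open>i + 1 \<le> r\<close> by (simp add: driven_path_rec(2))
    qed
  qed
  have down: "l \<le> i \<longrightarrow> driven_path \<omega> i = z i" if "i \<le> 0" for i
    using that
  proof (induction i rule: int_le_induct)
    case base then show ?case using up[of 0] assms by simp
  next
    case (step i)
    show ?case
    proof
      assume "l \<le> i - 1"
      then have "i - 1 \<in> {l..r}" using step(1) assms by simp
      with R have "\<omega> (i - 1, ?p (i - 1)) = z (i - 1)" by blast
      then show "driven_path \<omega> (i - 1) = z (i - 1)"
        using step \<open>l \<le> i - 1\<close> by (simp add: driven_path_rec(3))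
    qed
  qed
  show ?L
  proof
    fix i assume "i \<in> {l..r}"
    then show "driven_path \<omega> i = z i" using up[of i] down[of i] by (cases "0 \<le> i") auto
  qed
qed

section \<open>Existence of a stationary chain on the two-sided line\<close>

lemma line_cylinder_sets:
  assumes "finite J"
  shows "{s \<in> space (line_space \<kappa>). \<forall>i\<in>J. s i = z i} \<in> sets (line_space \<kappa>)"
  by (rule sets.sets_Collect_finite_All[OF coordinate_eq_sets[OF measurable_line_coordinate] assms])

text \<open>Serves to reach windows that miss site 0 from windows that contain it, one site at a
  time.\<close>

lemma line_cylinder_marginal:
  assumes P: "prob_space P" "sets P = sets (line_space \<kappa>)" and J: "finite J" "k \<notin> J"
  shows "measure P {s \<in> space (line_space \<kappa>). \<forall>i\<in>J. s i = z i} =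
    (\<Sum>c\<le>\<kappa>. measure P {s \<in> space (line_space \<kappa>). \<forall>i\<in>insert k J. s i = (z(k := c)) i})"
proof -
  interpret prob_space P by fact
  let ?C = "\<lambda>c. {s \<in> space (line_space \<kappa>). \<forall>i\<in>insert k J. s i = (z(k := c)) i}"
  have "{s \<in> space (line_space \<kappa>). \<forall>i\<in>J. s i = z i} = (\<Union>c\<le>\<kappa>. ?C c)"
  proof (rule Set.set_eqI)
    fix s
    show "s \<in> {s \<in> space (line_space \<kappa>). \<forall>i\<in>J. s i = z i} \<longleftrightarrow> s \<in> (\<Union>c\<le>\<kappa>. ?C c)"
    proof
      assume s: "s \<in> {s \<in> space (line_space \<kappa>). \<forall>i\<in>J. s i = z i}"
      then have "s k \<le> \<kappa>" using line_spaceD by blast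
      moreover have "s \<in> ?C (s k)" using s J(2) by auto
      ultimately show "s \<in> (\<Union>c\<le>\<kappa>. ?C c)" by blast
    next
      assume "s \<in> (\<Union>c\<le>\<kappa>. ?C c)"
      then obtain c where "s \<in> ?C c" by blast
      then show "s \<in> {s \<in> space (line_space \<kappa>). \<forall>i\<in>J. s i = z i}" using J(2) by (auto split: if_splits)
    qed
  qed
  also have "measure P \<dots> = (\<Sum>c\<le>\<kappa>. measure P (?C c))"
  proof (rule finite_measure_finite_Union)
    show "?C ` {..\<kappa>} \<subseteq> sets P" using line_cylinder_sets[of "insert k J"] J(1) P(2) by blast
    show "disjoint_family_on ?C {..\<kappa>}" unfolding disjoint_family_on_def by auto
  qed simp
  finally show ?thesis .
qed

text \<open>The path is a deterministic function of independent variables: sites right of 0 are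
  drawn from K, sites left of 0 from the time-reversed kernel, whose denominators call for positive
  \<rho>. K depends on the site so that D and U can alternate.\<close>

lemma two_sided_chain_exists:
  fixes K :: "int \<Rightarrow> nat \<Rightarrow> nat \<Rightarrow> real" and \<rho> :: "nat \<Rightarrow> real"
  assumes K: "\<And>i x y. x \<le> \<kappa> \<Longrightarrow> y \<le> \<kappa> \<Longrightarrow> 0 \<le> K i x y" "\<And>i x. x \<le> \<kappa> \<Longrightarrow> (\<Sum>y\<le>\<kappa>. K i x y) = 1"
    and \<rho>: "\<And>x. x \<le> \<kappa> \<Longrightarrow> 0 < \<rho> x" "(\<Sum>x\<le>\<kappa>. \<rho> x) = 1"
    and stat: "\<And>i y. y \<le> \<kappa> \<Longrightarrow> (\<Sum>x\<le>\<kappa>. \<rho> x * K i x y) = \<rho> y"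
  obtains P where "prob_space P" "sets P = sets (line_space \<kappa>)"
    "\<And>l r z. l \<le> r \<Longrightarrow> (\<And>i. z i \<le> \<kappa>) \<Longrightarrow>
      measure P {s \<in> space (line_space \<kappa>). \<forall>i\<in>{l..r}. s i = z i} =
      \<rho> (z l) * (\<Prod>i\<in>{l..<r}. K i (z i) (z (i + 1)))"
proof -
  \<comment> \<open>\<open>K i\<close> leads from site i to i + 1, hence the shift
    \<open>i - 1\<close> on the right side. Clipping by \<open>min x \<kappa>\<close> gives every
    coordinate a probability law, whatever its second index.\<close>
  define q where "q i x c = (if i = 0 then \<rho> c else if 0 < i then K (i - 1) (min x \<kappa>) c
    else \<rho> c * K i c (min x \<kappa>) / \<rho> (min x \<kappa>))" for i x c
  have q0: "0 \<le> q i x c" if "c \<le> \<kappa>" for i x c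
    using that K \<rho>(1) by (auto simp: q_def less_imp_le intro!: divide_nonneg_nonneg mult_nonneg_nonneg)
  have q1: "(\<Sum>c\<le>\<kappa>. q i x c) = 1" for i x
  proof -
    have "min x \<kappa> \<le> \<kappa>" by simp
    then have "(\<Sum>c\<le>\<kappa>. \<rho> c * K i c (min x \<kappa>) / \<rho> (min x \<kappa>)) = 1"
      using \<rho>(1)[of "min x \<kappa>"] stat[of "min x \<kappa>" i] by (simp flip: sum_divide_distrib)
    then show ?thesis using \<rho>(2) K(2)[of "min x \<kappa>" "i - 1"] by (cases "i = 0"; cases "0 < i") (simp_all add: q_def)
  qed
  define M where "M p = point_measure {..\<kappa>} (\<lambda>c. ennreal (q (fst p) (snd p) c))" for p
  have setsM: "sets (M p) = Pow {..\<kappa>}" for p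
    by (simp add: M_def sets_point_measure)
  have probM: "prob_space (M p)" for p
    unfolding M_def
  proof (rule prob_space_point_measure)
    have "(\<Sum>c\<le>\<kappa>. ennreal (q (fst p) (snd p) c)) = ennreal (\<Sum>c\<le>\<kappa>. q (fst p) (snd p) c)"
      using q0 by (intro sum_ennreal) simp
    then show "(\<Sum>c\<le>\<kappa>. ennreal (q (fst p) (snd p) c)) = 1" by (simp add: q1)
  qed simp_all
  define \<Omega> where "\<Omega> = PiM UNIV M"
  interpret \<Omega>: prob_space \<Omega> unfolding \<Omega>_def by (intro prob_space_PiM probM)
  have coord: "(\<lambda>\<omega>. \<omega> p) \<in> measurable \<Omega> (count_space {..\<kappa>})" for p
  proof -
    have "(\<lambda>\<omega>. \<omega> p) \<in> measurable \<Omega> (M p)" unfolding \<Omega>_def by (rule measurable_component_singleton) simp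
    moreover have "measurable \<Omega> (M p) = measurable \<Omega> (count_space {..\<kappa>})"
      by (rule measurable_cong_sets) (simp_all add: setsM)
    ultimately show ?thesis by simp
  qed
  have half: "(\<lambda>\<omega>. half_path \<sigma> \<omega> n) \<in> measurable \<Omega> (count_space {..\<kappa>})" for \<sigma> n
  proof (induction n)
    case (Suc n)
    have "(\<lambda>\<omega>. (\<lambda>x \<omega>. \<omega> (\<sigma> (int (Suc n)), x)) (half_path \<sigma> \<omega> n) \<omega>) \<in> measurable \<Omega> (count_space {..\<kappa>})"
      by (rule measurable_compose_countable'[OF _ Suc]) (simp_all add: coord)
    then show ?case by simp
  qed (simp add: coord)
  have path: "(\<lambda>\<omega>. driven_path \<omega>) \<in> measurable \<Omega> (line_space \<kappa>)"
    unfolding line_space_def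
  proof (rule measurable_PiM_single')
    show c: "(\<lambda>\<omega>. driven_path \<omega> i) \<in> measurable \<Omega> (count_space {..\<kappa>})" for i
      unfolding driven_path_def using half by (cases "0 \<le> i") simp_all
    show "driven_path \<in> space \<Omega> \<rightarrow> UNIV \<rightarrow>\<^sub>E space (count_space {..\<kappa>})"
      using measurable_space[OF c] by (auto simp: PiE_iff)
  qed
  define P where "P = distr \<Omega> (line_space \<kappa>) driven_path"
  have P: "prob_space P" "sets P = sets (line_space \<kappa>)"
    unfolding P_def by (auto intro: \<Omega>.prob_space_distr[OF path])
  define F where "F l r z = \<rho> (z l) * (\<Prod>i\<in>{l..<r}. K i (z i) (z (i + 1)))" for l r :: int and z :: "int \<Rightarrow> nat"
  define C where "C J z = measure P {s \<in> space (line_space \<kappa>). \<forall>i\<in>J. s i = z i}" for J :: "int set" and z :: "int \<Rightarrow> nat"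
  have mid: "C {l..r} z = F l r z" if lr: "l \<le> 0" "0 \<le> r" and z: "\<And>i. z i \<le> \<kappa>" for l r z
  proof -
    define p where "p i = (if i = 0 then 0 else if 0 < i then z (i - 1) else z (i + 1))" for i :: int
    let ?J = "(\<lambda>i. (i, p i)) ` {l..r}"
    have "C {l..r} z = measure \<Omega> (driven_path -` {s \<in> space (line_space \<kappa>). \<forall>i\<in>{l..r}. s i = z i} \<inter> space \<Omega>)"
      unfolding C_def P_def by (rule measure_distr[OF path line_cylinder_sets]) simp
    also have "driven_path -` {s \<in> space (line_space \<kappa>). \<forall>i\<in>{l..r}. s i = z i} \<inter> space \<Omega> =
        prod_emb UNIV M ?J (Pi\<^sub>E ?J (\<lambda>j. {z (fst j)}))"
    proof (rule Set.set_eqI)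
      fix \<omega>
      have "\<omega> \<in> driven_path -` {s \<in> space (line_space \<kappa>). \<forall>i\<in>{l..r}. s i = z i} \<inter> space \<Omega> \<longleftrightarrow>
          \<omega> \<in> space \<Omega> \<and> (\<forall>i\<in>{l..r}. driven_path \<omega> i = z i)"
        using measurable_space[OF path, of \<omega>] by auto
      also have "\<dots> \<longleftrightarrow> \<omega> \<in> space \<Omega> \<and> (\<forall>i\<in>{l..r}. \<omega> (i, p i) = z i)"
        unfolding driven_path_eq_iff[OF lr] p_def ..
      also have "\<dots> \<longleftrightarrow> \<omega> \<in> prod_emb UNIV M ?J (Pi\<^sub>E ?J (\<lambda>j. {z (fst j)}))"
        by (auto simp: prod_emb_iff PiE_iff \<Omega>_def space_PiM)
      finally show "\<omega> \<in> driven_path -` {s \<in> space (line_space \<kappa>). \<forall>i\<in>{l..r}. s i = z i} \<inter> space \<Omega> \<longleftrightarrow>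
          \<omega> \<in> prod_emb UNIV M ?J (Pi\<^sub>E ?J (\<lambda>j. {z (fst j)}))" .
    qed
    also have "measure \<Omega> \<dots> = (\<Prod>i\<in>{l..r}. q i (p i) (z i))"
    proof -
      have "emeasure \<Omega> (prod_emb UNIV M ?J (Pi\<^sub>E ?J (\<lambda>j. {z (fst j)}))) = (\<Prod>j\<in>?J. emeasure (M j) {z (fst j)})"
        unfolding \<Omega>_def by (rule emeasure_PiM_emb) (use probM setsM z in auto)
      also have "\<dots> = (\<Prod>i\<in>{l..r}. emeasure (M (i, p i)) {z i})"
        by (subst prod.reindex) (auto intro: inj_onI)
      also have "\<dots> = (\<Prod>i\<in>{l..r}. ennreal (q i (p i) (z i)))"
        using z by (intro prod.cong) (auto simp: M_def emeasure_point_measure_finite)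
      also have "\<dots> = ennreal (\<Prod>i\<in>{l..r}. q i (p i) (z i))"
        using q0 z by (intro prod_ennreal) auto
      finally show ?thesis using q0 z by (simp add: measure_def prod_nonneg)
    qed
    also have "\<dots> = F l r z"
    proof -
      have r: "(\<Prod>i\<in>{0..r}. q i (p i) (z i)) = F 0 r z"
        using lr(2)
      proof (induction r rule: int_ge_induct)
        case base then show ?case by (simp add: F_def q_def)
      next
        case (step r)
        have "{0..r + 1} = insert (r + 1) {0..r}" "{0..<r + 1} = insert r {0..<r}" using step(1) by auto
        then show ?case using step z[of r] by (simp add: F_def q_def p_def)
      qed
      show ?thesis using lr(1)
      proof (induction l rule: int_le_induct)
        case base then show ?case by (rule r)
      next
        case (step l)
        have "{l - 1..r} = insert (l - 1) {l..r}" "{l - 1..<r} = insert (l - 1) {l..<r}"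
          using step(1) lr(2) by auto
        \<comment> \<open>The denominator of the reversed kernel cancels the initial weight of the
          window starting at l.\<close>
        moreover have "\<rho> (z l) \<noteq> 0" using \<rho>(1)[OF z[of l]] by simp
        ultimately show ?case using step z[of l] by (simp add: F_def q_def p_def)
      qed
    qed
    finally show ?thesis .
  qed
  \<comment> \<open>The left end moves away from 0: summing over the state at the dropped site uses
    stationarity.\<close>
  have right: "C {l..r} z = F l r z" if "l \<le> r" "0 \<le> l" "\<And>i. z i \<le> \<kappa>" for l r z
  proof -
    have "\<forall>z. (\<forall>i. z i \<le> \<kappa>) \<longrightarrow> l \<le> r \<longrightarrow> C {l..r} z = F l r z" using that(2)
    proof (induction l rule: int_ge_induct)
      case base then show ?case using mid[of 0 r] by simp
    next
      case (step l)
      show ?case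
      proof (intro allI impI)
        fix z :: "int \<Rightarrow> nat" assume z: "\<forall>i. z i \<le> \<kappa>" and lr: "l + 1 \<le> r"
        have ins: "insert l {l + 1..r} = {l..r}" "{l..<r} = insert l {l + 1..<r}" using lr by auto
        have "C {l + 1..r} z = (\<Sum>c\<le>\<kappa>. C {l..r} (z(l := c)))"
          unfolding C_def using line_cylinder_marginal[OF P, of "{l + 1..r}" l z] unfolding ins by simp
        also have "\<dots> = (\<Sum>c\<le>\<kappa>. F l r (z(l := c)))"
          using step(2) z lr by (intro sum.cong) auto
        also have "\<dots> = (\<Sum>c\<le>\<kappa>. \<rho> c * K l c (z (l + 1)) * (\<Prod>i\<in>{l + 1..<r}. K i (z i) (z (i + 1))))"
          unfolding F_def ins(2) by (intro sum.cong) (auto intro!: prod.cong)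
        also have "\<dots> = F (l + 1) r z"
          unfolding F_def sum_distrib_right[symmetric] using z stat by simp
        finally show "C {l + 1..r} z = F (l + 1) r z" .
      qed
    qed
    then show ?thesis using that by blast
  qed
  \<comment> \<open>The right end moves away from 0: here the row sums of K absorb the dropped
    state.\<close>
  have left: "C {l..r} z = F l r z" if "l \<le> r" "r \<le> 0" "\<And>i. z i \<le> \<kappa>" for l r z
  proof -
    have "\<forall>z. (\<forall>i. z i \<le> \<kappa>) \<longrightarrow> l \<le> r \<longrightarrow> C {l..r} z = F l r z" using that(2)
    proof (induction r rule: int_le_induct)
      case base then show ?case using mid[of l 0] by simp
    next
      case (step r)
      show ?case
      proof (intro allI impI)
        fix z :: "int \<Rightarrow> nat" assume z: "\<forall>i. z i \<le> \<kappa>" and lr: "l \<le> r - 1"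
        have ins: "insert r {l..r - 1} = {l..r}" "{l..<r} = insert (r - 1) {l..<r - 1}" using lr by auto
        have "C {l..r - 1} z = (\<Sum>c\<le>\<kappa>. C {l..r} (z(r := c)))"
          unfolding C_def using line_cylinder_marginal[OF P, of "{l..r - 1}" r z] unfolding ins by simp
        also have "\<dots> = (\<Sum>c\<le>\<kappa>. F l r (z(r := c)))"
          using step(2) z lr by (intro sum.cong) auto
        also have "\<dots> = (\<Sum>c\<le>\<kappa>. F l (r - 1) z * K (r - 1) (z (r - 1)) c)"
          unfolding F_def ins(2) using lr by (intro sum.cong) (auto intro!: prod.cong simp: mult_ac)
        also have "\<dots> = F l (r - 1) z"
          unfolding sum_distrib_left[symmetric] using z K(2) by simp
        finally show "C {l..r - 1} z = F l (r - 1) z" .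
      qed
    qed
    then show ?thesis using that by blast
  qed
  show ?thesis
  proof (rule that[OF P])
    fix l r :: int and z :: "int \<Rightarrow> nat" assume lr: "l \<le> r" and z: "\<And>i. z i \<le> \<kappa>"
    have "C {l..r} z = F l r z"
    proof (cases "0 \<le> l")
      case True then show ?thesis using lr z by (intro right)
    next
      case l: False
      show ?thesis
      proof (cases "r \<le> 0")
        case True then show ?thesis using lr z by (intro left)
      next
        case False with l show ?thesis using z by (intro mid) auto
      qed
    qed
    then show "measure P {s \<in> space (line_space \<kappa>). \<forall>i\<in>{l..r}. s i = z i} =
      \<rho> (z l) * (\<Prod>i\<in>{l..<r}. K i (z i) (z (i + 1)))"
      unfolding C_def F_def .
  qed
qed

text \<open>Read in the order S0(0), S1(0), S0(1), S1(1), ..., the zigzag is one chain alternating D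
  and U; it is stationary because \<rho> is invariant under both.\<close>

lemma HZMC_law_exists:
  assumes D: "markov_kernel \<kappa> D" and U: "markov_kernel \<kappa> U"
    and \<rho>D: "invariant_dist \<kappa> D \<rho>" and \<rho>U: "invariant_dist \<kappa> U \<rho>"
    and \<rho>p: "\<And>i. i \<le> \<kappa> \<Longrightarrow> 0 < \<rho> $ i"
  obtains m where "HZMC_law_init \<kappa> D U \<rho> m"
proof -
  note CD = markov_kernelD(1)[OF D] and CU = markov_kernelD(1)[OF U]
  define K :: "int \<Rightarrow> nat \<Rightarrow> nat \<Rightarrow> real" where "K i x y = (if even i then D $$ (x, y) else U $$ (x, y))" for i x y
  have K0: "0 \<le> K i x y" if "x \<le> \<kappa>" "y \<le> \<kappa>" for i x y
    using that markov_kernelD(2)[OF D] markov_kernelD(2)[OF U] by (simp add: K_def)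
  have K1: "(\<Sum>y\<le>\<kappa>. K i x y) = 1" if "x \<le> \<kappa>" for i x
    using that markov_kernelD(3)[OF D] markov_kernelD(3)[OF U] by (cases "even i") (simp_all add: K_def)
  have \<rho>1: "(\<Sum>x\<le>\<kappa>. \<rho> $ x) = 1" using \<rho>D by (simp add: invariant_dist_def prob_vec_def)
  have stat: "(\<Sum>x\<le>\<kappa>. \<rho> $ x * K i x y) = \<rho> $ y" if "y \<le> \<kappa>" for i y
    using that \<rho>D \<rho>U unfolding invariant_dist_iff[OF CD] invariant_dist_iff[OF CU]
    by (cases "even i") (simp_all add: K_def)
  show ?thesis
  proof (rule two_sided_chain_exists[of \<kappa> K "\<lambda>i. \<rho> $ i"])
    fix P :: "(int \<Rightarrow> nat) measure"
    assume P: "prob_space P" "sets P = sets (line_space \<kappa>)"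
      and chain: "\<And>l r z. l \<le> r \<Longrightarrow> (\<And>i. z i \<le> \<kappa>) \<Longrightarrow>
        measure P {s \<in> space (line_space \<kappa>). \<forall>i\<in>{l..r}. s i = z i} =
        \<rho> $ z l * (\<Prod>i\<in>{l..<r}. K i (z i) (z (i + 1)))"
    interpret prob_space P by fact
    have spP: "space P = space (line_space \<kappa>)" by (rule sets_eq_imp_space_eq[OF P(2)])
    define g where "g s = (\<lambda>i. s (2 * i), \<lambda>i. s (2 * i + 1))" for s :: "int \<Rightarrow> nat"
    have sub: "(\<lambda>s i. s (h i)) \<in> measurable (line_space \<kappa>) (line_space \<kappa>)" for h :: "int \<Rightarrow> int"
    proof -
      have "(\<lambda>s i. s (h i)) \<in> measurable (line_space \<kappa>) (PiM UNIV (\<lambda>_. count_space {..\<kappa>}))"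
        by (rule measurable_PiM_single') (auto simp: space_line_space PiE_iff measurable_line_coordinate)
      then show ?thesis by (simp add: line_space_def)
    qed
    have "g \<in> measurable (line_space \<kappa>) (HZ_space \<kappa>)"
      unfolding g_def HZ_space_def by (intro measurable_Pair sub)
    then have g: "g \<in> measurable P (HZ_space \<kappa>)"
      using P(2) by (simp cong: measurable_cong_sets)
    define m where "m = distr P (HZ_space \<kappa>) g"
    have m: "HZ_law \<kappa> m"
      unfolding HZ_law_def m_def using prob_space_distr[OF g] by simp
    have "measure m (window \<kappa> i0 n a b) =
        \<rho> $ a 0 * (\<Prod>i<n. D $$ (a i, b i) * U $$ (b i, a (i + 1))) * D $$ (a n, b n)"
      if ab: "\<forall>i\<le>n. a i \<le> \<kappa> \<and> b i \<le> \<kappa>" for i0 n a b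
    proof -
      define l where "l = 2 * i0"
      \<comment> \<open>The interleaved word. \<open>nat\<close> and \<open>min n\<close> clamp the
        column to 0..n, since \<open>chain\<close> asks for valid states at all sites.\<close>
      define z where "z j = (let i = min n (nat (j div 2 - i0)) in if even j then a i else b i)" for j :: int
      have z: "z j \<le> \<kappa>" for j using ab by (simp add: z_def Let_def)
      have ze: "z (l + 2 * int i) = a i" and zo: "z (l + 2 * int i + 1) = b i" if "i \<le> n" for i
      proof -
        have "l + 2 * int i = 2 * (i0 + int i)" by (simp add: l_def)
        then show "z (l + 2 * int i) = a i" "z (l + 2 * int i + 1) = b i"
          using that by (simp_all add: z_def Let_def)
      qed
      have rng: "(\<forall>j\<in>{l..l + 2 * int n + 1}. Q j) \<longleftrightarrow> (\<forall>i\<le>n. Q (l + 2 * int i) \<and> Q (l + 2 * int i + 1))" for Q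
      proof
        assume R: "\<forall>i\<le>n. Q (l + 2 * int i) \<and> Q (l + 2 * int i + 1)"
        show "\<forall>j\<in>{l..l + 2 * int n + 1}. Q j"
        proof
          fix j assume j: "j \<in> {l..l + 2 * int n + 1}"
          define i where "i = nat ((j - l) div 2)"
          have "i \<le> n" and "j = l + 2 * int i \<or> j = l + 2 * int i + 1" using j by (auto simp: i_def)
          then show "Q j" using R by auto
        qed
      qed auto
      have "measure m (window \<kappa> i0 n a b) = measure P (g -` window \<kappa> i0 n a b \<inter> space P)"
        unfolding m_def by (rule measure_distr[OF g window_sets])
      also have "g -` window \<kappa> i0 n a b \<inter> space P =
          {s \<in> space (line_space \<kappa>). \<forall>j\<in>{l..l + 2 * int n + 1}. s j = z j}"
      proof (rule Set.set_eqI)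
        fix s
        have "s \<in> g -` window \<kappa> i0 n a b \<inter> space P \<longleftrightarrow> s \<in> space (line_space \<kappa>) \<and>
            (\<forall>i\<le>n. s (2 * (i0 + int i)) = a i \<and> s (2 * (i0 + int i) + 1) = b i)"
          using measurable_space[OF g, of s] by (auto simp: window_def g_def spP)
        also have "\<dots> \<longleftrightarrow> s \<in> space (line_space \<kappa>) \<and>
            (\<forall>i\<le>n. s (l + 2 * int i) = z (l + 2 * int i) \<and> s (l + 2 * int i + 1) = z (l + 2 * int i + 1))"
        proof -
          have l: "2 * (i0 + int i) = l + 2 * int i" for i by (simp add: l_def)
          show ?thesis unfolding l using ze zo by auto
        qed
        also have "\<dots> \<longleftrightarrow> s \<in> {s \<in> space (line_space \<kappa>). \<forall>j\<in>{l..l + 2 * int n + 1}. s j = z j}"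
          by (simp only: rng mem_Collect_eq)
        finally show "s \<in> g -` window \<kappa> i0 n a b \<inter> space P \<longleftrightarrow>
            s \<in> {s \<in> space (line_space \<kappa>). \<forall>j\<in>{l..l + 2 * int n + 1}. s j = z j}" .
      qed
      also have "measure P \<dots> = \<rho> $ z l * (\<Prod>i\<in>{l..<l + 2 * int n + 1}. K i (z i) (z (i + 1)))"
        by (rule chain) (simp_all add: z)
      also have "(\<Prod>i\<in>{l..<l + 2 * int n + 1}. K i (z i) (z (i + 1))) =
          (\<Prod>i<n. D $$ (a i, b i) * U $$ (b i, a (i + 1))) * D $$ (a n, b n)"
      proof -
        \<comment> \<open>Each further column adds a U step at an odd site and a D step at an even
          one.\<close>
        have "(\<Prod>i\<in>{l..<l + 2 * int k + 1}. K i (z i) (z (i + 1))) =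
          (\<Prod>i<k. D $$ (a i, b i) * U $$ (b i, a (i + 1))) * D $$ (a k, b k)" if "k \<le> n" for k
          using that
        proof (induction k)
          case 0
          have "{l..<l + 1} = {l}" by auto
          then show ?case using ze[of 0] zo[of 0] by (simp add: K_def l_def)
        next
          case (Suc k)
          let ?j = "l + 2 * int k + 1"
          have set: "{l..<l + 2 * int (Suc k) + 1} = insert (?j + 1) (insert ?j {l..<?j})" by auto
          have j: "\<not> even ?j" "even (?j + 1)" by (simp_all add: l_def)
          have zj: "z ?j = b k" "z (?j + 1) = a (Suc k)" "z (?j + 1 + 1) = b (Suc k)"
            using zo[of k] ze[of "Suc k"] zo[of "Suc k"] Suc.prems by (simp_all add: algebra_simps)
          have "(\<Prod>i\<in>{l..<l + 2 * int (Suc k) + 1}. K i (z i) (z (i + 1))) =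
              K (?j + 1) (z (?j + 1)) (z (?j + 1 + 1)) * (K ?j (z ?j) (z (?j + 1)) *
              (\<Prod>i\<in>{l..<?j}. K i (z i) (z (i + 1))))"
            unfolding set by (subst prod.insert, simp, simp)+ (rule refl)
          also have "\<dots> = D $$ (a (Suc k), b (Suc k)) * (U $$ (b k, a (Suc k)) *
              ((\<Prod>i<k. D $$ (a i, b i) * U $$ (b i, a (i + 1))) * D $$ (a k, b k)))"
            using Suc.IH Suc.prems j unfolding zj by (simp add: K_def)
          also have "\<dots> = (\<Prod>i<Suc k. D $$ (a i, b i) * U $$ (b i, a (i + 1))) * D $$ (a (Suc k), b (Suc k))"
            by (simp add: mult_ac)
          finally show ?case .
        qed
        then show ?thesis by blast
      qed
      finally show ?thesis using ze[of 0] by (simp add: mult.assoc)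
    qed
    then have "HZMC_law_init \<kappa> D U \<rho> m"
      unfolding HZMC_law_init_def window_def HZ_lawD(3)[OF m]
      using D U m invariant_dist_mult[OF CD CU \<rho>D \<rho>U] by blast
    then show ?thesis by (rule that)
  qed (use K0 K1 \<rho>1 \<rho>p stat in auto)
qed

section \<open>Existence and uniqueness of the chain, and the characterization\<close>

lemma (in positive_pca) zigzag_HZMC_law_ex1:
  assumes Z: "zigzag_factorization D U \<rho>"
  shows "\<exists>!m. HZMC_law \<kappa> D U m"
proof -
  have D: "markov_kernel \<kappa> D" and U: "markov_kernel \<kappa> U" and Dp: "\<forall>i\<le>\<kappa>. \<forall>j\<le>\<kappa>. 0 < D $$ (i, j)"
    and \<rho>: "invariant_dist \<kappa> D \<rho>" "invariant_dist \<kappa> U \<rho>"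
    using Z unfolding zigzag_factorization_def by blast+
  obtain m where "HZMC_law_init \<kappa> D U \<rho> m"
    using HZMC_law_exists[OF D U \<rho> invariant_dist_pos[OF markov_kernelD(1)[OF D] Dp \<rho>(1)]] by blast
  then show ?thesis unfolding HZMC_law_zigzag_iff[OF Z] using HZMC_law_init_unique by blast
qed

theorem theorem2p6:
  fixes \<kappa> :: nat and T :: "nat \<Rightarrow> nat \<Rightarrow> nat \<Rightarrow> real"
    and D U :: "real Matrix.mat" and \<gamma> \<rho> :: "real Matrix.vec" and cond1 cond2 admits :: bool
  assumes "\<kappa> \<ge> 1" and "transition_matrix \<kappa> T" and "positive_rate \<kappa> T"
  defines "\<gamma> \<equiv> gamma_vec \<kappa> T"
    and "D \<equiv> D_mat \<kappa> T \<gamma>" and "U \<equiv> U_mat \<kappa> T \<gamma>"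
    and "\<rho> \<equiv> pointwise_prod \<kappa> \<gamma> (mu_vec \<kappa> T)"
    and "cond1 \<equiv> \<forall>a\<le>\<kappa>. \<forall>b\<le>\<kappa>. \<forall>c\<le>\<kappa>.
           T a b c = (T 0 0 0 * T a b 0 * T a 0 c * T 0 b c) / (T a 0 0 * T 0 b 0 * T 0 0 c)"
    and "cond2 \<equiv> D * U = U * D"
    and "admits \<equiv> \<exists>D' U' m. HZMC_law \<kappa> D' U' m \<and> pca_invariant \<kappa> T m"
  shows "(admits \<longleftrightarrow> cond1 \<and> cond2)
    \<and> (cond1 \<and> cond2 \<longrightarrow>
         (\<exists>!m. HZMC_law \<kappa> D U m) \<and>
         (\<forall>m. HZMC_law \<kappa> D U m \<longrightarrow> pca_invariant \<kappa> T m) \<and>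
         (\<forall>K \<in> {D, U, D * U, U * D}. markov_kernel \<kappa> K \<and> (\<forall>\<eta>. invariant_dist \<kappa> K \<eta> \<longleftrightarrow> \<eta> = \<rho>)))
    \<and> (\<kappa> = 1 \<longrightarrow>
         (cond1 \<longrightarrow> cond2) \<and>
         (admits \<longleftrightarrow> cond1) \<and>
         (cond1 \<longleftrightarrow> T 0 0 0 * T 1 1 0 * T 1 0 1 * T 0 1 1 = T 1 1 1 * T 0 0 1 * T 0 1 0 * T 1 0 0))"
proof -
  interpret positive_pca \<kappa> T by standard (fact assms)+
  have c1: "cond1 \<longleftrightarrow> separable" unfolding cond1_def separable_def ..
  note defs = D_def U_def \<gamma>_def
  have zig: "zigzag_factorization D U \<rho>" if c: "cond1" "cond2"
  proof -
    have "separable" using c(1) c1 by blast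
    moreover have "D_mat \<kappa> T (gamma_vec \<kappa> T) * U_mat \<kappa> T (gamma_vec \<kappa> T) =
        U_mat \<kappa> T (gamma_vec \<kappa> T) * D_mat \<kappa> T (gamma_vec \<kappa> T)"
      using c(2) unfolding cond2_def defs .
    ultimately obtain \<sigma> where Z: "zigzag_factorization D U \<sigma>"
      unfolding defs by (rule zigzag_factorizationI)
    \<comment> \<open>The invariant distribution obtained abstractly is recognised as the product of
      \<gamma> and \<mu>.\<close>
    from zigzag_factorizationD(4)[OF Z] have "\<sigma> = \<rho>" unfolding \<rho>_def \<gamma>_def by simp
    with Z show ?thesis by simp
  qed
  have main: "(\<exists>!m. HZMC_law \<kappa> D U m) \<and> (\<forall>m. HZMC_law \<kappa> D U m \<longrightarrow> pca_invariant \<kappa> T m) \<and>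
      (\<forall>K \<in> {D, U, D * U, U * D}. markov_kernel \<kappa> K \<and> (\<forall>\<eta>. invariant_dist \<kappa> K \<eta> \<longleftrightarrow> \<eta> = \<rho>))"
    if c: "cond1 \<and> cond2"
  proof -
    from c have Z: "zigzag_factorization D U \<rho>" by (intro zig) simp_all
    show ?thesis
      using zigzag_HZMC_law_ex1[OF Z] zigzag_factorization_kernels[OF Z] pca_invariant_zigzag[OF Z]
      unfolding HZMC_law_zigzag_iff[OF Z] by blast
  qed
  have nec: "cond1 \<and> cond2" if admits
  proof -
    from that obtain D' U' \<sigma> m where H: "HZMC_law_init \<kappa> D' U' \<sigma> m" "pca_invariant \<kappa> T m"
      unfolding admits_def HZMC_law_def by blast
    have Z: "zigzag_factorization D' U' \<sigma>" by (rule zigzag_factorization_of_invariant[OF H])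
    then have "D' * U' = U' * D'" by (simp add: zigzag_factorization_def)
    \<comment> \<open>The kernels of an arbitrary invariant chain are forced to be D and U, so their
      commutation is condition (2).\<close>
    with zigzag_factorizationD(1-3)[OF Z] show ?thesis unfolding c1 cond2_def defs by simp
  qed
  \<comment> \<open>The existence part of \<open>main\<close> supplies the invariant law.\<close>
  have suf: admits if "cond1 \<and> cond2"
    using main[OF that] unfolding admits_def by blast
  have two: "cond1 \<longrightarrow> cond2" if "\<kappa> = 1"
    using separable_commute_two_states[OF that] unfolding c1 cond2_def defs by blast
  show ?thesis
    using main nec suf two separable_two_states_iff c1 by blast
qed

end
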